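(* Let $E$ be a real separable Banach space and $m\ge1$ an integer. Put $$\tau_m(s)=\frac{1}{(m-1)!}\int_0^s(-\log u)^{m-1}\,du,\qquad 0<s\le1.$$ Then $$\mathcal{U}^{\langle m\rangle}=\Big\{\mathcal{L}\Big(\int_{(0,1)}s\,dY_\nu(\tau_m(s))\Big):\ \nu\in ID\Big\}.$$
   Context: $E$ is a real separable Banach space with dual $E'$. $ID$ denotes the class of infinitely divisible probability measures on $E$. For $\nu\in ID$, $(Y_\nu(t))_{t\ge0}$ is an $E$-valued càdlàg Lévy process with $Y_\nu(0)=0$ and $\mathcal{L}(Y_\nu(1))=\nu$. For $h$ of bounded variation and $r$ nondecreasing, the random integral is $$\int_{(a,b]}h(s)\,dY_\nu(r(s)):=h(b)Y_\nu(r(b))-h(a)Y_\nu(r(a))-\int_{(a,b]}Y_\nu(r(s))\,dh(s).$$ Its law has $\log$-characteristic functional $y\mapsto\int_{(a,b]}\log\hat\nu(h(s)y)\,dr(s)$. Integrals over $(0,1)$ are limits in distribution as $a\downarrow0$. Define the mapping $\mathcal{J}:ID\to ID$ by $\mathcal{J}(\nu)=\mathcal{L}\big(\int_{(0,1)}s\,dY_\nu(s)\big)$. The classes of $m$-times s-selfdecomposable distributions are $$\mathcal{U}^{\langle1\rangle}=\mathcal{J}(ID),\qquad \mathcal{U}^{\langle m+1\rangle}=\mathcal{J}(\mathcal{U}^{\langle m\rangle}),$$ i.e. $\mathcal{U}^{\langle m\rangle}=\mathcal{J}^m(ID)$, the $m$-fold iterate. *)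

theory Defs
  imports "HOL-Probability.Probability"
begin

text \<open>Ambient space: a real separable Banach space is modelled by a type of class
  banach + second_countable_topology (for a metric space, separable iff second countable).\<close>

definition bconv :: "'a::{banach,second_countable_topology} measure \<Rightarrow> 'a measure \<Rightarrow> 'a measure" where
  "bconv M N = distr (M \<Otimes>\<^sub>M N) borel (\<lambda>(x, y). x + y)"

fun bconv_pow :: "'a::{banach,second_countable_topology} measure \<Rightarrow> nat \<Rightarrow> 'a measure" where
  "bconv_pow M 0 = return borel 0"
| "bconv_pow M (Suc n) = bconv (bconv_pow M n) M"

definition prob_measures :: "'a::{banach,second_countable_topology} measure set" where
  "prob_measures = {\<nu>. prob_space \<nu> \<and> sets \<nu> = sets borel}"

definition ID :: "'a::{banach,second_countable_topology} measure set" where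
  "ID = {\<nu> \<in> prob_measures. \<forall>n::nat. n \<ge> 1 \<longrightarrow>
            (\<exists>\<mu> \<in> prob_measures. bconv_pow \<mu> n = \<nu>)}"

definition levy_process :: "'w measure \<Rightarrow> (real \<Rightarrow> 'w \<Rightarrow> 'a::{banach,second_countable_topology})
    \<Rightarrow> 'a measure \<Rightarrow> bool" where
  "levy_process M Y \<nu> \<longleftrightarrow>
     prob_space M \<and>
     (\<forall>t. Y t \<in> borel_measurable M) \<and>
     (\<forall>\<omega>\<in>space M. Y 0 \<omega> = 0) \<and>
     (\<forall>\<omega>\<in>space M. \<forall>t\<ge>0. continuous (at_right t) (\<lambda>s. Y s \<omega>)) \<and>
     (\<forall>\<omega>\<in>space M. \<forall>t>0. \<exists>l. ((\<lambda>s. Y s \<omega>) \<longlongrightarrow> l) (at_left t)) \<and>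
     (\<forall>(n::nat) (t::nat \<Rightarrow> real). 0 \<le> t 0 \<and> (\<forall>k<n. t k < t (Suc k)) \<longrightarrow>
        prob_space.indep_vars M (\<lambda>_. borel) (\<lambda>k \<omega>. Y (t (Suc k)) \<omega> - Y (t k) \<omega>) {..<n}) \<and>
     (\<forall>s t. 0 \<le> s \<and> s \<le> t \<longrightarrow>
        distr M borel (\<lambda>\<omega>. Y t \<omega> - Y s \<omega>) = distr M borel (Y (t - s))) \<and>
     distr M borel (Y 1) = \<nu>"

text \<open>The random integral int_{(a,1]} s dY(r(s)) for h(s)=s, following the
  integration-by-parts definition: h(1)Y(r(1)) - h(a)Y(r(a)) - int_{(a,1]} Y(r(s)) ds
  (the last one is pathwise, as dh(s) = ds).\<close>
definition rint_s :: "(real \<Rightarrow> 'w \<Rightarrow> 'a::{banach,second_countable_topology}) \<Rightarrow> (real \<Rightarrow> real)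
    \<Rightarrow> real \<Rightarrow> 'w \<Rightarrow> 'a" where
  "rint_s Y r a \<omega> = Y (r 1) \<omega> - a *\<^sub>R Y (r a) \<omega> - (LINT s:{a<..1}|lborel. Y (r s) \<omega>)"

definition weak_conv_right0 :: "(real \<Rightarrow> 'a::{banach,second_countable_topology} measure)
    \<Rightarrow> 'a measure \<Rightarrow> bool" where
  "weak_conv_right0 \<mu>s \<mu> \<longleftrightarrow>
     (\<forall>f :: 'a \<Rightarrow> real. continuous_on UNIV f \<and> bounded (range f) \<longrightarrow>
        ((\<lambda>a. integral\<^sup>L (\<mu>s a) f) \<longlongrightarrow> integral\<^sup>L \<mu> f) (at_right 0))"

text \<open>mu is the law of int_{(0,1)} s dY_nu(r(s)), the limit in distribution as a decreases to 0.\<close>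
definition is_law_rint :: "'a::{banach,second_countable_topology} measure \<Rightarrow> (real \<Rightarrow> real)
    \<Rightarrow> 'a measure \<Rightarrow> bool" where
  "is_law_rint \<nu> r \<mu> \<longleftrightarrow> \<mu> \<in> prob_measures \<and>
     (\<exists>(M :: (real \<Rightarrow> 'a) measure) Y. levy_process M Y \<nu> \<and>
        weak_conv_right0 (\<lambda>a. distr M borel (rint_s Y r a)) \<mu>)"

definition J_img :: "'a::{banach,second_countable_topology} measure set \<Rightarrow> 'a measure set" where
  "J_img S = {\<mu>. \<exists>\<nu>\<in>S. is_law_rint \<nu> (\<lambda>s. s) \<mu>}"

definition U_class :: "nat \<Rightarrow> 'a::{banach,second_countable_topology} measure set" where
  "U_class m = (J_img ^^ m) ID"

definition tau :: "nat \<Rightarrow> real \<Rightarrow> real" where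
  "tau m s = (LINT u:{0<..s}|lborel. (- ln u) ^ (m - 1)) / fact (m - 1)"

end

theory Submission
  imports Defs
begin

text \<open>Integration by parts makes the integral of \<open>s\<close> along a clock \<open>r\<close> a pathwise limit of the sums of
  \<open>(j/n) (Y (r ((j+1)/n)) - Y (r (j/n)))\<close>. Hence its characteristic functional is multiplicative in
  \<open>r\<close>, and scaling the integrand amounts to rescaling the clock. For a Levy process \<open>Y'\<close>
  whose law at time 1 is that of the integral along \<open>tau m\<close>, the law of \<open>Y' (1/n)\<close> is identified
  by the uniqueness of continuous n-th roots of nowhere vanishing functions. The integral of \<open>u\<close>
  along \<open>Y'\<close> then belongs to the average of the clocks \<open>tau m (min (s/u) 1)\<close> over \<open>0 < u < 1\<close>, which
  is \<open>tau (m+1) s\<close>. A law on \<open>E\<close> is determined by its one-dimensional projections (Hahn-Banach), so this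
  identifies the law of the iterated integral. That \<open>Y'\<close> exists follows from Kolmogorov extension
  to dyadic times, where an Ottaviani-type bound on the number of oscillations yields one-sided limits.\<close>

text \<open>\<open>is_law_rint\<close> asks for some Levy process on the sample space
  \<open>real \<Rightarrow> 'a\<close>. Applying the mapping again to a law that already arose as an
  integral therefore needs a new process on that very space, so existence has to be proved and
  characteristic functionals alone do not suffice. In infinite dimensions one-sided limits cannot be
  read off from projections, since convergence of every functional does not give convergence in
  norm; counting large displacements of random walks works with the norm itself. Logarithms of
  characteristic functionals are avoided: additivity in the clock becomes a product formula, and
  division by n becomes extraction of a root along a ray. Paths are continuous only from the right,
  so approximations of times and clocks come from above: grid points are rounded up, truncated
  clocks are frozen at a larger value, and averages of clocks are left sums of decreasing functions.
  Finally, \<open>tau m\<close> is the distribution function of a product of m independent uniform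
  variables, which is why one more average of rescaled clocks over 0 < u < 1 yields the next
  clock.\<close>

abbreviation seq_borel :: "(nat \<Rightarrow> 'a::topological_space) measure" where
  "seq_borel \<equiv> \<Pi>\<^sub>M i\<in>UNIV. borel"

lemma measurable_PiM_UNIV:
  assumes "\<And>i. f i \<in> measurable N (M i)"
  shows "(\<lambda>x i. f i x) \<in> measurable N (PiM UNIV M)"
  by (rule measurable_PiM_single') (use assms in \<open>auto dest: measurable_space\<close>)

section \<open>Functionals on a separable Banach space\<close>

text \<open>Zorn's lemma is applied to graphs: subspaces of the product with the line that lie below
  the norm. Single-valuedness is automatic, since a point over 0 and its negative are both bounded
  by \<open>norm 0\<close>; maximality gives totality.\<close>

lemma hahn_banach_norming:
  fixes d :: "'a::real_normed_vector"
  shows "\<exists>f. bounded_linear f \<and> (\<forall>x. \<bar>f x\<bar> \<le> norm x) \<and> f d = norm d"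
proof -
  define A where "A = {G :: ('a \<times> real) set. subspace G \<and> (d, norm d) \<in> G \<and> (\<forall>(x, a)\<in>G. a \<le> norm x)}"
  have base: "span {(d, norm d)} \<in> A"
    using span_base[of "(d, norm d)" "{(d, norm d)}"] subspace_span[of "{(d, norm d)}"]
    by (auto simp: A_def span_singleton intro!: mult_right_mono)
  have "\<exists>U\<in>A. \<forall>X\<in>C. X \<subseteq> U" if C: "subset.chain A C" for C
  proof (cases "C = {}")
    case True
    then show ?thesis using base by auto
  next
    case False
    have CA: "C \<subseteq> A" and lin: "\<And>X Y. X \<in> C \<Longrightarrow> Y \<in> C \<Longrightarrow> X \<subseteq> Y \<or> Y \<subseteq> X"
      using C by (auto simp: subset_chain_def)
    have "subspace (\<Union>C)"
    proof (rule subspaceI)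
      show "0 \<in> \<Union>C" using False CA subspace_0 by (fastforce simp: A_def)
      show "x + y \<in> \<Union>C" if x: "x \<in> \<Union>C" and y: "y \<in> \<Union>C" for x y
      proof -
        obtain X Y where X: "X \<in> C" "x \<in> X" and Y: "Y \<in> C" "y \<in> Y" using x y by auto
        have sub: "subspace X" "subspace Y" using X Y CA by (auto simp: A_def)
        from lin[OF X(1) Y(1)] show ?thesis
          using X Y subspace_add[OF sub(1)] subspace_add[OF sub(2)] by blast
      qed
      show "c *\<^sub>R x \<in> \<Union>C" if "x \<in> \<Union>C" for c x
        using that CA by (auto simp: A_def intro: subspace_scale)
    qed
    then have "\<Union>C \<in> A" using False CA by (fastforce simp: A_def)
    then show ?thesis by blast
  qed
  from subset_Zorn[OF this] obtain G where G: "G \<in> A" and max: "\<And>X. X \<in> A \<Longrightarrow> G \<subseteq> X \<Longrightarrow> X = G"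
    by blast
  have sub: "subspace G" and dG: "(d, norm d) \<in> G" and le: "\<And>x a. (x, a) \<in> G \<Longrightarrow> a \<le> norm x"
    using G by (auto simp: A_def)
  have uniq: "a = b" if "(x, a) \<in> G" "(x, b) \<in> G" for x a b
    using le[of 0 "a - b"] le[of 0 "b - a"] subspace_diff[OF sub that] subspace_diff[OF sub that(2,1)]
    by auto
  have tot: "\<exists>a. (x0, a) \<in> G" for x0
  proof -
    \<comment> \<open>Extending the graph by \<open>(x0, c)\<close> requires \<open>c\<close> to lie
      above all of \<open>S\<close> and below every \<open>norm (y + x0) - b\<close>. By
      \<open>up\<close> these two sets are separated, so the supremum of \<open>S\<close> is a
      possible value.\<close>
    define S where "S = (\<lambda>(x, a). a - norm (x - x0)) ` G"
    have up: "s \<le> norm (y + x0) - b" if s: "s \<in> S" and y: "(y, b) \<in> G" for s y b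
    proof -
      obtain x a where xa: "(x, a) \<in> G" "s = a - norm (x - x0)" using s by (auto simp: S_def)
      have "a + b \<le> norm (x + y)" using le subspace_add[OF sub xa(1) y] by auto
      also have "\<dots> \<le> norm (x - x0) + norm (y + x0)"
        using norm_triangle_ineq[of "x - x0" "y + x0"] by simp
      finally show ?thesis using xa by simp
    qed
    have ne: "S \<noteq> {}" using dG by (auto simp: S_def)
    have bdd: "bdd_above S" using up[OF _ dG] by (auto simp: bdd_above_def)
    define c where "c = Sup S"
    have c1: "a - norm (x - x0) \<le> c" if "(x, a) \<in> G" for x a
      unfolding c_def by (rule cSup_upper[OF _ bdd]) (use that in \<open>force simp: S_def\<close>)
    have c2: "c \<le> norm (y + x0) - b" if "(y, b) \<in> G" for y b
      unfolding c_def by (rule cSup_least[OF ne]) (rule up[OF _ that])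
    have ext: "a + t * c \<le> norm (x + t *\<^sub>R x0)" if xa: "(x, a) \<in> G" for x a t
    proof (cases t "0::real" rule: linorder_cases)
      case equal
      then show ?thesis using le[OF xa] by simp
    next
      case greater
      have "(x /\<^sub>R t, a / t) \<in> G" using subspace_scale[OF sub xa, of "inverse t"] by (simp add: field_simps)
      from c2[OF this] have "t * (a / t + c) \<le> t * norm (x /\<^sub>R t + x0)"
        using greater by (intro mult_left_mono) auto
      also have "\<dots> = norm (t *\<^sub>R (x /\<^sub>R t + x0))" using greater by simp
      also have "t *\<^sub>R (x /\<^sub>R t + x0) = x + t *\<^sub>R x0" using greater by (simp add: algebra_simps)
      finally show ?thesis using greater by (simp add: algebra_simps)
    next
      case less
      define s where "s = - t"
      have s: "s > 0" "t = - s" using less by (auto simp: s_def)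
      have "(x /\<^sub>R s, a / s) \<in> G" using subspace_scale[OF sub xa, of "inverse s"] by (simp add: field_simps)
      from c1[OF this] have "s * (a / s - c) \<le> s * norm (x /\<^sub>R s - x0)"
        using s by (intro mult_left_mono) auto
      also have "\<dots> = norm (s *\<^sub>R (x /\<^sub>R s - x0))" using s by simp
      also have "s *\<^sub>R (x /\<^sub>R s - x0) = x + t *\<^sub>R x0" using s by (simp add: algebra_simps)
      finally show ?thesis using s by (simp add: algebra_simps)
    qed
    have "span (insert (x0, c) G) \<in> A"
    proof -
      have "z \<in> span (insert (x0, c) G) \<longleftrightarrow> (\<exists>k. z - k *\<^sub>R (x0, c) \<in> G)" for z
        unfolding span_insert span_eq_iff[THEN iffD2, OF sub] by simp
      then have "b \<le> norm y" if "(y, b) \<in> span (insert (x0, c) G)" for y b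
        using that ext[of "y - k *\<^sub>R x0" "b - k * c" k for k] by auto
      then show ?thesis using dG by (auto simp: A_def span_base subspace_span)
    qed
    then have "span (insert (x0, c) G) = G"
      by (rule max) (auto simp: span_base)
    then have "(x0, c) \<in> G" by (metis insertI1 span_base)
    then show ?thesis by blast
  qed
  define f where "f x = (THE a. (x, a) \<in> G)" for x
  have f: "(x, f x) \<in> G" for x
    unfolding f_def using tot[of x] uniq[of x] by (metis theI)
  have feq: "f x = a" if "(x, a) \<in> G" for x a using uniq[OF f that] .
  have add: "f (x + y) = f x + f y" for x y
    using subspace_add[OF sub f f, of x y] by (intro feq) simp
  have scale: "f (c *\<^sub>R x) = c * f x" for c x
    using subspace_scale[OF sub f, of c x] by (intro feq) simp
  have "f x \<le> norm x" for x using le[OF f] .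
  moreover have "- f x \<le> norm x" for x using le[OF f, of "- x"] scale[of "-1" x] by simp
  ultimately have bd: "\<bar>f x\<bar> \<le> norm x" for x by (metis abs_le_iff)
  have "bounded_linear f"
    by (rule bounded_linear_intro[where K = 1]) (use add scale bd in auto)
  then show ?thesis using bd feq[OF dG] by blast
qed

text \<open>Functionals that norm the points of a dense sequence determine the norm of every vector,
  so a vector can be measurably recovered from countably many real coordinates. This carries
  measures on E to real sequences and back, both for uniqueness of laws and for the Kolmogorov
  extension.\<close>

lemma separable_coordinates:
  obtains y :: "nat \<Rightarrow> 'a::{banach,second_countable_topology} \<Rightarrow> real"
    and G :: "(nat \<Rightarrow> real) \<Rightarrow> 'a"
  where "\<And>i. bounded_linear (y i)" "G \<in> measurable seq_borel borel"
    "\<And>x. G (\<lambda>i. y i x) = x"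
proof -
  obtain D :: "'a set" where D: "countable D" "\<And>U. open U \<Longrightarrow> U \<noteq> {} \<Longrightarrow> \<exists>d\<in>D. d \<in> U"
    using countable_dense_exists by blast
  have "D \<noteq> {}" using D(2)[of UNIV] by auto
  define d where "d = from_nat_into D"
  have dense: "\<exists>i. dist (d i) x < e" if "e > 0" for e and x :: 'a
  proof -
    from D(2)[of "ball x e"] that obtain p where p: "p \<in> D" "p \<in> ball x e" by auto
    obtain i where "d i = p" using p(1) D(1) unfolding d_def by (metis from_nat_into_surj)
    then show ?thesis using p(2) by (auto simp: dist_commute)
  qed
  obtain y where y: "\<And>i. bounded_linear (y i)" "\<And>i x. \<bar>y i x\<bar> \<le> norm x" "\<And>i. y i (d i) = norm (d i)"
    using hahn_banach_norming[of "d i" for i] by metis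
  interpret y: bounded_linear "y i" for i by (rule y)
  have norming: "norm x \<le> c" if c: "\<And>i. \<bar>y i x\<bar> \<le> c" for x c
  proof (rule field_le_epsilon)
    fix e :: real assume "e > 0"
    then obtain i where i: "dist (d i) x < e / 2" using dense[of "e / 2"] by auto
    have "norm x \<le> norm (d i) + norm (x - d i)" by (metis add_diff_cancel_left' add.commute norm_triangle_sub)
    also have "norm (d i) = y i x + y i (d i - x)" using y(3)[of i] by (simp add: y.diff)
    also have "y i x + y i (d i - x) + norm (x - d i) \<le> c + norm (d i - x) + norm (x - d i)"
      using c[of i] y(2)[of i "d i - x"] by auto
    also have "\<dots> \<le> c + e" using i by (simp add: dist_norm norm_minus_commute)
    finally show "norm x \<le> c + e" .
  qed
  \<comment> \<open>\<open>d (N k v)\<close> is the first dense point whose coordinates are all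
    within \<open>1 / Suc k\<close> of \<open>v\<close>. If \<open>v\<close> consists of the
    coordinates of x, then by \<open>norming\<close> this point is within \<open>1 / Suc k\<close>
    of x in norm, so the limit over k is x.\<close>
  define N where "N k v = (LEAST i. \<forall>l. \<bar>v l - y l (d i)\<bar> \<le> 1 / real (Suc k))" for k and v :: "nat \<Rightarrow> real"
  define G where "G v = lim (\<lambda>k. d (N k v))" for v
  have N[measurable]: "N k \<in> measurable seq_borel (count_space UNIV)" for k
    unfolding N_def by measurable
  have "(\<lambda>v. d (N k v)) \<in> borel_measurable seq_borel" for k
    by measurable
  then have "G \<in> borel_measurable seq_borel"
    unfolding G_def by (rule borel_measurable_lim_metric)
  moreover have "G (\<lambda>i. y i x) = x" for x
  proof -
    have "norm (x - d (N k (\<lambda>i. y i x))) \<le> 1 / real (Suc k)" for k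
    proof -
      obtain i where i: "dist (d i) x < 1 / real (Suc k)" using dense[of "1 / real (Suc k)"] by auto
      have "\<forall>l. \<bar>y l x - y l (d i)\<bar> \<le> 1 / real (Suc k)"
        using y(2)[of _ "x - d i"] i by (auto simp: y.diff dist_norm norm_minus_commute intro: order_trans less_imp_le)
      then have "\<forall>l. \<bar>y l x - y l (d (N k (\<lambda>i. y i x)))\<bar> \<le> 1 / real (Suc k)"
        unfolding N_def by (rule LeastI)
      then show ?thesis by (intro norming) (simp add: y.diff)
    qed
    then have "(\<lambda>k. d (N k (\<lambda>i. y i x))) \<longlonglongrightarrow> x"
      by (intro Lim_transform_bound[OF _ LIMSEQ_inverse_real_of_nat, THEN LIM_zero_cancel])
         (auto simp: norm_minus_commute inverse_eq_divide)
    then show ?thesis unfolding G_def by (rule limI)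
  qed
  ultimately show ?thesis using that y(1) by blast
qed

section \<open>Characteristic functionals\<close>

text \<open>Having a function as second argument lets one symbol serve a law paired with a
  functional and a real random variable on a sample space.\<close>

definition cf :: "'w measure \<Rightarrow> ('w \<Rightarrow> real) \<Rightarrow> complex" where
  "cf M f = (CLINT x|M. iexp (f x))"

lemma (in prob_space) integrable_iexp':
  assumes [measurable]: "f \<in> borel_measurable M"
  shows "integrable M (\<lambda>x. iexp (f x))"
  by (rule integrable_const_bound[of _ 1]) auto

text \<open>Normalized by its total mass \<open>c\<close>, which is the same under both measures by
  the case t = 0, the weight is a probability density. The hypothesis then equates the
  characteristic functions of \<open>f\<close> under the two tilted measures, and Levy's uniqueness
  theorem applies. If the mass is zero, both sides vanish.\<close>

lemma weighted_char_unique: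
  fixes f w :: "'a \<Rightarrow> real"
  assumes P: "prob_space P" and Q: "prob_space Q" and PQ: "sets P = sets Q"
    and [measurable]: "f \<in> borel_measurable P" "w \<in> borel_measurable P"
    and w: "\<And>x. 0 \<le> w x" "\<And>x. w x \<le> C"
    and eq: "\<And>t. (CLINT x|P. w x * iexp (t * f x)) = (CLINT x|Q. w x * iexp (t * f x))"
    and B[measurable]: "B \<in> sets borel"
  shows "(LINT x|P. w x * indicator B (f x)) = (LINT x|Q. w x * indicator B (f x))"
proof -
  interpret P: prob_space P by fact
  interpret Q: prob_space Q by fact
  have [measurable]: "f \<in> borel_measurable Q" "w \<in> borel_measurable Q"
    using assms(4,5) PQ by (simp_all cong: measurable_cong_sets)
  have iP: "integrable P w" and iQ: "integrable Q w"
    by (rule P.integrable_const_bound[of _ C] Q.integrable_const_bound[of _ C]; use w in auto)+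
  define c where "c = (LINT x|P. w x)"
  have cQ: "c = (LINT x|Q. w x)"
    using eq[of 0] by (simp add: c_def)
  define D where "D R = distr (density R (\<lambda>x. ennreal (w x / c))) borel f" for R
  have dist: "real_distribution (D R)"
    and chr: "char (D R) t = (CLINT x|R. w x * iexp (t * f x)) / c"
    and msr: "measure (D R) B = (LINT x|R. w x * indicator B (f x)) / c"
    if R: "prob_space R" and [measurable]: "f \<in> borel_measurable R" "w \<in> borel_measurable R"
      and iR: "integrable R w" and c: "c = (LINT x|R. w x)" "c > 0" for R t
  proof -
    interpret R: prob_space R by fact
    have "emeasure (density R (\<lambda>x. ennreal (w x / c))) (space R) = ennreal (LINT x|R. w x / c)"
      using w(1) c iR by (subst emeasure_density) (auto simp: nn_integral_eq_integral cong: nn_integral_cong)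
    also have "\<dots> = 1" using c by simp
    finally have pd: "prob_space (density R (\<lambda>x. ennreal (w x / c)))"
      by (intro prob_spaceI) simp
    then interpret D: prob_space "density R (\<lambda>x. ennreal (w x / c))" .
    have "f \<in> measurable (density R (\<lambda>x. ennreal (w x / c))) borel" by simp
    from D.prob_space_distr[OF this] show "real_distribution (D R)"
      unfolding D_def by (intro real_distribution.intro real_distribution_axioms.intro) auto
    show "char (D R) t = (CLINT x|R. w x * iexp (t * f x)) / c"
      using w(1) c by (simp add: D_def char_def integral_distr integral_density scaleR_conv_of_real)
    have "measure (D R) B
       = (LINT x|D R. indicator B x)"
      by (simp add: D_def)
    also have "\<dots> = (LINT x|R. w x * indicator B (f x)) / c"
      unfolding D_def using w(1) c by (subst integral_distr) (simp_all add: integral_density)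
    finally show "measure (D R) B = (LINT x|R. w x * indicator B (f x)) / c" .
  qed
  show ?thesis
  proof (cases "c > 0")
    case True
    have mQ: "f \<in> borel_measurable Q" "w \<in> borel_measurable Q" by simp_all
    note cP = chr[OF P assms(4,5) iP c_def True] and cQ' = chr[OF Q mQ iQ cQ True]
    have "D P = D Q"
    proof (rule Levy_uniqueness)
      show "real_distribution (D P)"
        using dist[OF P assms(4,5) iP c_def True] .
      show "real_distribution (D Q)"
        using dist[OF Q mQ iQ cQ True] .
    qed (simp only: fun_eq_iff cP cQ' eq simp_thms)
    then show ?thesis
      using msr[OF P _ _ iP c_def True] msr[OF Q _ _ iQ cQ True] True by simp
  next
    case False
    have *: "(LINT x|R. w x * indicator B (f x)) = 0"
      if R: "prob_space R" and [measurable]: "f \<in> borel_measurable R" "w \<in> borel_measurable R"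
      and iR: "integrable R w" and c: "c = (LINT x|R. w x)" for R
    proof -
      have "(LINT x|R. w x * indicator B (f x)) \<le> (LINT x|R. w x)"
        by (intro integral_mono integrable_mult_indicator Bochner_Integration.integrable_bound[OF iR] iR AE_I2)
           (use w(1) in \<open>auto split: split_indicator\<close>)
      moreover have "0 \<le> (LINT x|R. w x * indicator B (f x))"
        by (intro integral_nonneg_AE AE_I2) (use w(1) in auto)
      ultimately show ?thesis using False c by linarith
    qed
    show ?thesis using *[OF P _ _ iP c_def] *[OF Q _ _ iQ cQ] by simp
  qed
qed

lemma cf_cylinder_eq:
  fixes P Q :: "'a::{banach,second_countable_topology} measure"
  assumes P: "prob_space P" "sets P = sets borel" and Q: "prob_space Q" "sets Q = sets borel"
    and eq: "\<And>z. bounded_linear z \<Longrightarrow> cf P z = cf Q z"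
    and y: "\<And>i::nat. bounded_linear (y i :: 'a \<Rightarrow> real)" and B[measurable]: "\<And>i. B i \<in> sets borel"
    and J: "finite J" and z: "bounded_linear z"
  shows "(CLINT x|P. of_real (\<Prod>j\<in>J. indicator (B j) (y j x)) * iexp (z x))
       = (CLINT x|Q. of_real (\<Prod>j\<in>J. indicator (B j) (y j x)) * iexp (z x))"
  using J z
proof (induction J arbitrary: z rule: finite_induct)
  case empty
  then show ?case using eq by (simp add: cf_def)
next
  case (insert l J)
  interpret P: prob_space P by fact
  interpret Q: prob_space Q by fact
  define b where "b x = (\<Prod>j\<in>J. indicator (B j) (y j x) :: real)" for x
  have meas: "bounded_linear u \<Longrightarrow> u \<in> borel_measurable borel" for u :: "'a \<Rightarrow> real"
    by (intro borel_measurable_continuous_onI linear_continuous_on)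
  have [measurable]: "y i \<in> borel_measurable borel" "z \<in> borel_measurable borel" for i
    using meas[OF y] meas[OF insert.prems] by simp_all
  have [measurable]: "b \<in> borel_measurable borel" unfolding b_def by measurable
  have b01: "0 \<le> b x" "b x \<le> 1" for x
    unfolding b_def by (auto intro!: prod_nonneg prod_le_1 split: split_indicator)
  have IH: "(CLINT x|P. b x * iexp (u x)) = (CLINT x|Q. b x * iexp (u x))" if "bounded_linear u" for u
    using insert.IH[OF that] by (simp add: b_def)
  have int: "integrable R (\<lambda>x. h x * iexp (u x))"
    if "R = P \<or> R = Q" and hu[measurable]: "h \<in> borel_measurable borel" "u \<in> borel_measurable borel"
       "\<And>x. \<bar>h x\<bar> \<le> C" for R C and h u :: "'a \<Rightarrow> real"
  proof -
    have "prob_space R" and "sets R = sets borel" using that(1) P Q by auto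
    then interpret R: prob_space R by simp
    have [measurable]: "h \<in> borel_measurable R" "u \<in> borel_measurable R"
      using hu \<open>sets R = sets borel\<close> by (simp_all cong: measurable_cong_sets)
    show ?thesis by (rule R.integrable_const_bound[of _ C]) (use hu in \<open>auto simp: norm_mult\<close>)
  qed
  have wc: "(CLINT x|P. (b x * g (z x)) * iexp (t * y l x)) = (CLINT x|Q. (b x * g (z x)) * iexp (t * y l x))"
    if g: "g = (\<lambda>_. 1) \<or> g = (\<lambda>s. 1 + cos s) \<or> g = (\<lambda>s. 1 + sin s)" for g :: "real \<Rightarrow> real" and t
  proof -
    let ?u = "\<lambda>x. t * y l x" and ?p = "\<lambda>x. z x + t * y l x" and ?m = "\<lambda>x. - z x + t * y l x"
    have bl: "bounded_linear ?u" "bounded_linear ?p" "bounded_linear ?m"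
      by (intro bounded_linear_add bounded_linear_minus insert.prems bounded_linear_const_mult y)+
    have e: "iexp p * iexp q = iexp (p + q)" for p q by (simp add: exp_add algebra_simps)
    \<comment> \<open>By Euler's formulas each weight is a combination of 1, \<open>iexp s\<close>
      and \<open>iexp (- s)\<close>. Multiplied by \<open>iexp (t * y l x)\<close> it becomes a
      combination of exponentials of the linear functionals \<open>?u\<close>, \<open>?p\<close> and
      \<open>?m\<close>, to which the induction hypothesis applies.\<close>
    obtain \<alpha> \<beta> \<gamma> :: complex where g': "\<And>s. complex_of_real (g s) = \<alpha> + \<beta> * iexp s + \<gamma> * iexp (- s)"
    proof -
      have c: "complex_of_real (1 + cos s) = 1 + 1/2 * iexp s + 1/2 * iexp (- s)" for s
        by (simp add: complex_eq_iff Re_exp Im_exp)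
      have s: "complex_of_real (1 + sin s) = 1 + (-\<i>/2) * iexp s + (\<i>/2) * iexp (- s)" for s
        by (simp add: complex_eq_iff Re_exp Im_exp)
      have o: "complex_of_real 1 = 1 + 0 * iexp s + 0 * iexp (- s)" for s by simp
      from g that c s o show ?thesis by blast
    qed
    have "(CLINT x|R. (b x * g (z x)) * iexp (t * y l x))
        = \<alpha> * (CLINT x|R. b x * iexp (?u x)) + \<beta> * (CLINT x|R. b x * iexp (?p x)) + \<gamma> * (CLINT x|R. b x * iexp (?m x))"
      if R: "R = P \<or> R = Q" for R
    proof -
      have "(CLINT x|R. (b x * g (z x)) * iexp (t * y l x))
          = (CLINT x|R. \<alpha> * (b x * iexp (?u x)) + \<beta> * (b x * iexp (?p x)) + \<gamma> * (b x * iexp (?m x)))"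
        by (intro Bochner_Integration.integral_cong refl)
           (simp only: of_real_mult g' e[symmetric], simp add: algebra_simps)
      also have "\<dots> = \<alpha> * (CLINT x|R. b x * iexp (?u x)) + \<beta> * (CLINT x|R. b x * iexp (?p x)) + \<gamma> * (CLINT x|R. b x * iexp (?m x))"
        using int[OF R, of b ?u 1] int[OF R, of b ?p 1] int[OF R, of b ?m 1] b01 by simp
      finally show ?thesis .
    qed
    then show ?thesis using IH[OF bl(1)] IH[OF bl(2)] IH[OF bl(3)] by simp
  qed
  define h where "h g x = (b x * g (z x)) * indicator (B l) (y l x)" for g x
  have w: "(LINT x|P. h g x) = (LINT x|Q. h g x)"
    if g: "g = (\<lambda>_. 1) \<or> g = (\<lambda>s. 1 + cos s) \<or> g = (\<lambda>s. 1 + sin s)" for g :: "real \<Rightarrow> real"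
  unfolding h_def
  proof (rule weighted_char_unique[OF P(1) Q(1), where C = 2])
    show "sets P = sets Q" using P Q by simp
    have [measurable]: "g \<in> borel_measurable borel" using g by auto
    show "y l \<in> borel_measurable P" "(\<lambda>x. b x * g (z x)) \<in> borel_measurable P"
      using P(2) by (simp_all cong: measurable_cong_sets)
    have t2: "0 \<le> 1 + cos s" "0 \<le> 1 + sin s" for s :: real
      using cos_ge_minus_one[of s] sin_ge_minus_one[of s] by linarith+
    have g2: "0 \<le> g s" "g s \<le> 2" for s
      using g t2 by auto
    show "0 \<le> b x * g (z x)" for x using b01 g2 by simp
    show "b x * g (z x) \<le> 2" for x using mult_mono[OF b01(2)[of x] g2(2)[of "z x"]] g2(1) by simp
    show "B l \<in> sets borel" by simp
    show "(CLINT x|P. (b x * g (z x)) * iexp (t * y l x)) = (CLINT x|Q. (b x * g (z x)) * iexp (t * y l x))" for t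
      using wc[OF g] .
  qed
  have re: "(CLINT x|R. of_real (\<Prod>j\<in>insert l J. indicator (B j) (y j x)) * iexp (z x))
     = Complex ((LINT x|R. h (\<lambda>s. 1 + cos s) x) - (LINT x|R. h (\<lambda>_. 1) x))
        ((LINT x|R. h (\<lambda>s. 1 + sin s) x) - (LINT x|R. h (\<lambda>_. 1) x))"
    if R: "R = P \<or> R = Q" for R
  proof -
    have sR: "sets R = sets borel" and "prob_space R" using R P Q by auto
    then interpret R: prob_space R by simp
    have ir: "integrable R (\<lambda>x. h g x)"
      if [measurable]: "g \<in> borel_measurable borel" and g2: "\<And>s. \<bar>g s\<bar> \<le> 2" for g :: "real \<Rightarrow> real"
      unfolding h_def
    proof (rule R.integrable_const_bound[of _ 2])
      have "\<bar>b x * g (z x)\<bar> \<le> 2" for x using mult_mono[OF b01(2)[of x] g2[of "z x"]] b01 by (simp add: abs_mult)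
      then show "AE x in R. norm ((b x * g (z x)) * indicator (B l) (y l x)) \<le> 2"
        by (auto split: split_indicator)
      show "(\<lambda>x. (b x * g (z x)) * indicator (B l) (y l x)) \<in> borel_measurable R"
        using sR by (simp cong: measurable_cong_sets)
    qed
    have a1: "\<bar>1 + cos s\<bar> \<le> 2" "\<bar>1 + sin s\<bar> \<le> 2" for s :: real
      using cos_ge_minus_one[of s] sin_ge_minus_one[of s] cos_le_one[of s] sin_le_one[of s] by linarith+
    have i3: "integrable R (\<lambda>x. h (\<lambda>_. 1) x)"
       "integrable R (\<lambda>x. h (\<lambda>s. 1 + cos s) x)"
       "integrable R (\<lambda>x. h (\<lambda>s. 1 + sin s) x)"
      by (rule ir; use a1 in simp)+
    define c1 where "c1 x = h (\<lambda>s. 1 + cos s) x - h (\<lambda>_. 1) x" for x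
    define c2 where "c2 x = h (\<lambda>s. 1 + sin s) x - h (\<lambda>_. 1) x" for x
    have int12: "integrable R c1" "integrable R c2"
      unfolding c1_def c2_def by (intro Bochner_Integration.integrable_diff i3)+
    have "of_real (\<Prod>j\<in>insert l J. indicator (B j) (y j x)) * iexp (z x) = complex_of_real (c1 x) + \<i> * complex_of_real (c2 x)" for x
    proof -
      have pr: "(\<Prod>j\<in>insert l J. indicator (B j) (y j x)) = b x * indicator (B l) (y l x)"
        using insert.hyps by (simp add: b_def mult.commute)
      show ?thesis unfolding pr by (simp add: c1_def c2_def h_def complex_eq_iff Re_exp Im_exp algebra_simps)
    qed
    then have "(CLINT x|R. of_real (\<Prod>j\<in>insert l J. indicator (B j) (y j x)) * iexp (z x))
       = (CLINT x|R. complex_of_real (c1 x) + \<i> * complex_of_real (c2 x))"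
      by (intro Bochner_Integration.integral_cong refl)
    also have "\<dots> = complex_of_real (LINT x|R. c1 x) + \<i> * complex_of_real (LINT x|R. c2 x)"
      using int12 by simp
    also have "\<dots> = Complex (LINT x|R. c1 x) (LINT x|R. c2 x)"
      by (simp add: complex_eq_iff)
    also have "(LINT x|R. c1 x) = (LINT x|R. h (\<lambda>s. 1 + cos s) x) - (LINT x|R. h (\<lambda>_. 1) x)"
      unfolding c1_def by (intro Bochner_Integration.integral_diff i3)
    also have "(LINT x|R. c2 x) = (LINT x|R. h (\<lambda>s. 1 + sin s) x) - (LINT x|R. h (\<lambda>_. 1) x)"
      unfolding c2_def by (intro Bochner_Integration.integral_diff i3)
    finally show ?thesis .
  qed
  show ?case
    using re[of P] re[of Q] w[of "\<lambda>_. 1"] w[of "\<lambda>s. 1 + cos s"] w[of "\<lambda>s. 1 + sin s"]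
    by (simp del: prod.insert)
qed

text \<open>The coordinates map E measurably into the real sequences, where finite cylinders
  determine a law; \<open>cf_cylinder_eq\<close> with z = 0 compares these. The left inverse
  \<open>G\<close> brings the equality back to E.\<close>

theorem cf_unique:
  fixes P Q :: "'a::{banach,second_countable_topology} measure"
  assumes P: "prob_space P" "sets P = sets borel" and Q: "prob_space Q" "sets Q = sets borel"
    and eq: "\<And>z. bounded_linear z \<Longrightarrow> cf P z = cf Q z"
  shows "P = Q"
proof -
  obtain y :: "nat \<Rightarrow> 'a \<Rightarrow> real" and G where y: "\<And>i. bounded_linear (y i)"
    and G[measurable]: "G \<in> measurable seq_borel borel" and Gy: "\<And>x. G (\<lambda>i. y i x) = x"
    using separable_coordinates by blast
  interpret P: prob_space P by fact
  interpret Q: prob_space Q by fact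
  have [measurable]: "y i \<in> borel_measurable borel" for i
    by (intro borel_measurable_continuous_onI linear_continuous_on y)
  have yPQ[measurable]: "y i \<in> borel_measurable P" "y i \<in> borel_measurable Q" for i
    using P Q by (simp_all cong: measurable_cong_sets)
  let ?Y = "\<lambda>x i. y i x"
  define S where "S = (seq_borel :: (nat \<Rightarrow> real) measure)"
  have mS: "?Y \<in> measurable P S" "?Y \<in> measurable Q S"
    unfolding S_def by (intro measurable_PiM_UNIV yPQ)+
  have "distr P S ?Y = distr Q S ?Y"
  proof (rule measure_eqI_PiM_infinite[where I = UNIV and M = "\<lambda>_. borel"])
    show "sets (distr P S ?Y) = sets seq_borel"
       "sets (distr Q S ?Y) = sets seq_borel" by (simp_all add: S_def)
    show "finite_measure (distr P S ?Y)"
      using mS by (simp add: P.prob_space_distr prob_space.finite_measure)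
  next
    fix A :: "nat \<Rightarrow> real set" and J :: "nat set"
    assume J: "finite J" "J \<subseteq> UNIV" and A: "\<And>i. i \<in> J \<Longrightarrow> A i \<in> sets borel"
    let ?E = "prod_emb UNIV (\<lambda>_. borel :: real measure) J (Pi\<^sub>E J A)"
    define B where "B i = (if i \<in> J then A i else UNIV)" for i
    have B[measurable]: "B i \<in> sets borel" for i using A by (simp add: B_def)
    let ?A = "{v. \<forall>j\<in>J. v j \<in> A j}"
    have emb: "?E = {v. \<forall>j\<in>J. v j \<in> A j}"
      by (auto simp: prod_emb_def PiE_iff restrict_def extensional_def)
    have ms: "?E \<in> sets S"
      unfolding S_def using J A by (intro sets_PiM_I) auto
    have "measure R (?Y -` ?A \<inter> space R)
       = Re (CLINT x|R. of_real (\<Prod>j\<in>J. indicator (B j) (y j x)) * iexp 0)" if R: "R = P \<or> R = Q" for R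
    proof -
      have "sets R = sets borel" "prob_space R" using R P Q by auto
      then interpret R: prob_space R by simp
      have sp: "space R = UNIV" using sets_eq_imp_space_eq[OF \<open>sets R = sets borel\<close>] by simp
      have [measurable]: "y i \<in> borel_measurable R" for i using R by auto
      have "(\<Prod>j\<in>J. indicator (B j) (y j x) :: real) = indicator {x. \<forall>j\<in>J. y j x \<in> A j} x" for x
        using J(1) by (auto simp: B_def indicator_def prod_zero_iff)
      moreover have "{x. \<forall>j\<in>J. y j x \<in> A j} \<in> sets R"
      proof -
        have "{x\<in>space R. \<forall>j\<in>J. y j x \<in> B j} \<in> sets R" using J by measurable
        then show ?thesis by (simp add: sp B_def cong: ball_cong)
      qed
      ultimately show ?thesis by (simp add: sp vimage_def)
    qed
    from this[of P] this[of Q] cf_cylinder_eq[OF P Q eq y B J(1), of "\<lambda>_. 0"]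
    have "measure P (?Y -` ?A \<inter> space P)
        = measure Q (?Y -` ?A \<inter> space Q)" by simp
    then show "emeasure (distr P S ?Y) (?E) =
        emeasure (distr Q S ?Y) (?E)"
      using ms mS by (simp add: emeasure_distr emb P.emeasure_eq_measure Q.emeasure_eq_measure)
  qed
  then have "distr (distr P S ?Y) borel G = distr (distr Q S ?Y) borel G" by simp
  moreover have "distr (distr P S ?Y) borel G = distr P borel (\<lambda>x. x)"
    using mS unfolding S_def by (subst distr_distr) (simp_all add: o_def Gy)
  moreover have "distr (distr Q S ?Y) borel G = distr Q borel (\<lambda>x. x)"
    using mS unfolding S_def by (subst distr_distr) (simp_all add: o_def Gy)
  ultimately show ?thesis using P Q distr_id2[of borel P] distr_id2[of borel Q] by simp
qed

section \<open>Integration of cadlag paths along a clock\<close>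

definition cadlag :: "(real \<Rightarrow> 'a::real_normed_vector) \<Rightarrow> bool" where
  "cadlag f \<longleftrightarrow> (\<forall>t\<ge>0. continuous (at_right t) f) \<and> (\<forall>t>0. \<exists>l. (f \<longlongrightarrow> l) (at_left t))"

text \<open>Monotonicity and nonnegativity confine the clock to \<open>[0, r 1]\<close> on the
  half-open interval, so a cadlag path stays bounded along it and integrals reach down to 0 without
  a limit.\<close>

definition clock :: "(real \<Rightarrow> real) \<Rightarrow> bool" where
  "clock r \<longleftrightarrow> mono_on {0<..1} r \<and> continuous_on {0<..1} r \<and> (\<forall>s\<in>{0<..1}. 0 \<le> r s)"

text \<open>Integration by parts for the integrand s on all of (0,1]. The boundary term at a has the
  factor a in front of a bounded path and therefore disappears as a tends to 0.\<close>

definition path_int :: "(real \<Rightarrow> 'a::{banach,second_countable_topology}) \<Rightarrow> (real \<Rightarrow> real) \<Rightarrow> 'a" where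
  "path_int f r = f (r 1) - (LINT s:{0<..1}|lborel. f (r s))"

text \<open>Bisection: the one-sided limits bound the path near each point, and bounds on adjacent
  intervals combine.\<close>

lemma cadlag_bounded:
  assumes f: "cadlag f"
  shows "\<exists>C. \<forall>t\<in>{0..T}. norm (f t) \<le> C"
proof -
  \<comment> \<open>The guard \<open>0 \<le> t\<close> admits intervals that stick out to the left
    of 0, which occur in the local step at the point 0.\<close>
  define P where "P a b \<longleftrightarrow> (\<exists>C. \<forall>t\<in>{a..b}. 0 \<le> t \<longrightarrow> norm (f t) \<le> C)" for a b
  have "P 0 T" if "0 \<le> T"
    using that
  proof (induction rule: Bolzano)
    case (trans a b c)
    then obtain C D where "\<forall>t\<in>{a..b}. 0 \<le> t \<longrightarrow> norm (f t) \<le> C" "\<forall>t\<in>{b..c}. 0 \<le> t \<longrightarrow> norm (f t) \<le> D"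
      unfolding P_def by blast
    then have "\<forall>t\<in>{a..c}. 0 \<le> t \<longrightarrow> norm (f t) \<le> max C D"
      by (metis atLeastAtMost_iff le_max_iff_disj linorder_le_cases)
    then show ?case unfolding P_def by blast
  next
    case (local x)
    have "(f \<longlongrightarrow> f x) (at_right x)"
      using f local by (auto simp: cadlag_def continuous_within)
    then have "((\<lambda>s. norm (f s)) \<longlongrightarrow> norm (f x)) (at_right x)" by (rule tendsto_norm)
    then have "\<forall>\<^sub>F s in at_right x. norm (f s) < norm (f x) + 1"
      by (rule order_tendstoD) simp
    then obtain u where u: "u > x" "\<And>s. x < s \<Longrightarrow> s < u \<Longrightarrow> norm (f s) < norm (f x) + 1"
      by (auto simp: eventually_at_right_field)
    obtain v C where v: "v < x" "\<And>s. v < s \<Longrightarrow> 0 \<le> s \<Longrightarrow> s < x \<Longrightarrow> norm (f s) < C"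
    proof (cases "x > 0")
      case True
      then obtain l where "(f \<longlongrightarrow> l) (at_left x)" using f by (auto simp: cadlag_def)
      then have "((\<lambda>s. norm (f s)) \<longlongrightarrow> norm l) (at_left x)" by (rule tendsto_norm)
      then have "\<forall>\<^sub>F s in at_left x. norm (f s) < norm l + 1"
        by (rule order_tendstoD) simp
      then show ?thesis using that by (auto simp: eventually_at_left_field)
    next
      case False
      then show ?thesis using that[of "x - 1"] by auto
    qed
    show ?case
    proof (intro exI[of _ "min (u - x) (x - v)"] conjI allI impI)
      show "0 < min (u - x) (x - v)" using u v by simp
      fix a b assume ab: "a \<le> x \<and> x \<le> b \<and> b - a < min (u - x) (x - v)"
      have "norm (f t) \<le> max C (norm (f x) + 1)" if "t \<in> {a..b}" "0 \<le> t" for t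
        using u(2)[of t] v(2)[of t] that ab by (cases t x rule: linorder_cases) (auto simp: le_max_iff_disj)
      then show "P a b" unfolding P_def by blast
    qed
  qed
  then show ?thesis by (cases "0 \<le> T") (auto simp: P_def)
qed

lemma cadlag_tendsto:
  assumes "cadlag f" "0 \<le> t" "(x \<longlongrightarrow> t) F" "\<forall>\<^sub>F n in F. t \<le> x n"
  shows "((\<lambda>n. f (x n)) \<longlongrightarrow> f t) F"
proof -
  have "continuous (at t within {t<..}) f" using assms by (simp add: cadlag_def)
  moreover have "{t..} - {t} = {t<..}" by auto
  ultimately have "continuous (at t within {t..}) f"
    by (simp add: continuous_within at_within_def)
  then show ?thesis
    by (rule continuous_within_tendsto_compose) (use assms in auto)
qed

lemma clockD:
  assumes "clock r" "0 < s" "s \<le> t" "t \<le> 1"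
  shows "0 \<le> r s" "r s \<le> r t"
  using assms by (auto simp: clock_def mono_on_def)

text \<open>Rounding goes upwards so that the rounded argument tends to \<open>s\<close> from the
  side on which cadlag paths are continuous.\<close>

definition grid_ceil :: "nat \<Rightarrow> real \<Rightarrow> real" where
  "grid_ceil n s = of_int \<lceil>real n * s\<rceil> / real n"

lemma ceil_grid:
  assumes "0 < s" "s \<le> 1" "n > (0::nat)"
  shows "s \<le> grid_ceil n s" "grid_ceil n s \<le> s + 1 / real n" "grid_ceil n s \<le> 1" "0 < grid_ceil n s"
proof -
  have a: "real n * s \<le> of_int \<lceil>real n * s\<rceil>" "of_int \<lceil>real n * s\<rceil> \<le> real n * s + 1" by linarith+
  show "s \<le> grid_ceil n s" "grid_ceil n s \<le> s + 1 / real n"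
    using a assms by (simp_all add: grid_ceil_def field_simps)
  have "\<lceil>real n * s\<rceil> \<le> int n" using assms by (simp add: ceiling_le_iff mult_left_le)
  then show "grid_ceil n s \<le> 1" using assms by (simp add: grid_ceil_def)
  have "0 < real n * s" using assms by simp
  then show "0 < grid_ceil n s" using assms by (simp add: grid_ceil_def)
qed

lemma clock_step_tendsto:
  assumes f: "cadlag f" and r: "clock r" and s: "0 < s" "s \<le> 1"
  shows "(\<lambda>n. f (r (grid_ceil (Suc n) s))) \<longlonglongrightarrow> f (r s)"
proof (rule cadlag_tendsto[OF f])
  show "0 \<le> r s" using clockD(1)[OF r s(1) order.refl s(2)] .
  note g = ceil_grid[OF s, of "Suc n" for n]
  have "(\<lambda>n. grid_ceil (Suc n) s) \<longlonglongrightarrow> s"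
  proof (rule tendsto_sandwich[of "\<lambda>_. s" _ _ "\<lambda>n. s + 1 / real (Suc n)"])
    have "(\<lambda>n. s + 1 / real (Suc n)) \<longlonglongrightarrow> s + 0"
      by (intro tendsto_add tendsto_const LIMSEQ_Suc[OF lim_1_over_n])
    then show "(\<lambda>n. s + 1 / real (Suc n)) \<longlonglongrightarrow> s" by simp
  qed (use g in auto)
  moreover have "continuous (at s within {0<..1}) r"
    using r s by (auto simp: clock_def continuous_on_eq_continuous_within)
  ultimately show "(\<lambda>n. r (grid_ceil (Suc n) s)) \<longlonglongrightarrow> r s"
    by (intro continuous_within_tendsto_compose[of s "{0<..1}" r]) (use g in auto)
  show "\<forall>\<^sub>F n in sequentially. r s \<le> r (grid_ceil (Suc n) s)"
    using clockD(2)[OF r s(1) g(1) g(3)] by simp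
qed

lemma clock_path_measurable:
  assumes f: "cadlag f" and r: "clock r"
  shows "set_borel_measurable lborel {0<..1} (\<lambda>s. f (r s) :: 'a::{banach,second_countable_topology})"
  unfolding set_borel_measurable_def
proof (rule borel_measurable_LIMSEQ_metric)
  fix n :: nat
  have "(\<lambda>k::int. f (r (of_int k / real (Suc n)))) \<circ> (\<lambda>s. \<lceil>real (Suc n) * s\<rceil>) \<in> borel_measurable borel"
    by (rule measurable_comp[where N = "count_space UNIV"]) auto
  then have "(\<lambda>s. f (r (grid_ceil (Suc n) s))) \<in> borel_measurable borel"
    by (simp only: o_def grid_ceil_def)
  then show "(\<lambda>s. indicat_real {0<..1} s *\<^sub>R f (r (grid_ceil (Suc n) s))) \<in> borel_measurable lborel"
    by simp
next
  fix s
  show "(\<lambda>n. indicat_real {0<..1} s *\<^sub>R f (r (grid_ceil (Suc n) s))) \<longlonglongrightarrow> indicat_real {0<..1} s *\<^sub>R f (r s)"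
    using clock_step_tendsto[OF f r, of s] by (auto split: split_indicator)
qed

lemma clock_path_bounded:
  assumes f: "cadlag f" and r: "\<And>s. 0 < s \<Longrightarrow> s \<le> 1 \<Longrightarrow> 0 \<le> r s \<and> r s \<le> K"
  shows "\<exists>C. \<forall>s\<in>{0<..1}. norm (f (r s)) \<le> C"
  using cadlag_bounded[OF f, of K] r by fastforce

lemma clock_path_integrable:
  assumes f: "cadlag f" and r: "clock r"
  shows "set_integrable lborel {0<..1} (\<lambda>s. f (r s) :: 'a::{banach,second_countable_topology})"
proof -
  obtain C where C: "\<forall>s\<in>{0<..1}. norm (f (r s)) \<le> C"
    using clock_path_bounded[OF f, of r "r 1"] clockD[OF r] by auto
  show ?thesis
    unfolding set_integrable_def
    by (rule integrableI_bounded_set[where A = "{0<..1}" and B = C])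
       (use C clock_path_measurable[OF f r] in \<open>auto simp: set_borel_measurable_def\<close>)
qed

text \<open>The approximating clocks lie above \<open>r\<close> because the path is only
  right-continuous; its bound on \<open>[0, K]\<close> dominates the integrands. Measurability is
  assumed in place of the clock property so that discontinuous step clocks are covered.\<close>

lemma path_int_tendsto:
  fixes f :: "real \<Rightarrow> 'a::{banach,second_countable_topology}"
  assumes f: "cadlag f"
    and r: "\<And>s. 0 < s \<Longrightarrow> s \<le> 1 \<Longrightarrow> 0 \<le> r s"
    and rn: "\<And>n s. 0 < s \<Longrightarrow> s \<le> 1 \<Longrightarrow> r s \<le> rn n s" "\<And>n s. 0 < s \<Longrightarrow> s \<le> 1 \<Longrightarrow> rn n s \<le> K"
    and lim: "\<And>s. 0 < s \<Longrightarrow> s \<le> 1 \<Longrightarrow> (\<lambda>n. rn n s) \<longlonglongrightarrow> r s"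
    and m: "set_borel_measurable lborel {0<..1} (\<lambda>s. f (r s))"
      "\<And>n. set_borel_measurable lborel {0<..1} (\<lambda>s. f (rn n s))"
  shows "(\<lambda>n. path_int f (rn n)) \<longlonglongrightarrow> path_int f r"
proof -
  have conv: "(\<lambda>n. f (rn n s)) \<longlonglongrightarrow> f (r s)" if "0 < s" "s \<le> 1" for s
    by (rule cadlag_tendsto[OF f]) (use that r rn lim in auto)
  obtain C where C: "\<forall>t\<in>{0..K}. norm (f t) \<le> C" using cadlag_bounded[OF f] by blast
  have "(\<lambda>n. LINT s:{0<..1}|lborel. f (rn n s)) \<longlonglongrightarrow> (LINT s:{0<..1}|lborel. f (r s))"
    unfolding set_lebesgue_integral_def
  proof (rule integral_dominated_convergence[where w = "\<lambda>s. indicator {0<..1} s *\<^sub>R C"])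
    show "AE x in lborel. (\<lambda>i. indicat_real {0<..1} x *\<^sub>R f (rn i x)) \<longlonglongrightarrow> indicat_real {0<..1} x *\<^sub>R f (r x)"
      using conv by (auto split: split_indicator)
    show "AE x in lborel. norm (indicat_real {0<..1} x *\<^sub>R f (rn i x)) \<le> indicat_real {0<..1} x *\<^sub>R C" for i
    proof (rule AE_I2)
      fix x
      have "0 \<le> rn i x \<and> rn i x \<le> K" if "0 < x" "x \<le> 1" using r[OF that] rn[OF that, of i] by auto
      then show "norm (indicat_real {0<..1} x *\<^sub>R f (rn i x)) \<le> indicat_real {0<..1} x *\<^sub>R C"
        using C by (auto split: split_indicator)
    qed
    show "integrable lborel (\<lambda>x::real. indicat_real {0<..1} x *\<^sub>R C)"
      by (intro integrable_scaleR_left integrable_real_indicator) simp_all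
  qed (use m in \<open>auto simp: set_borel_measurable_def\<close>)
  then show ?thesis unfolding path_int_def by (intro tendsto_diff conv) auto
qed

lemma path_int_tendsto_clock:
  fixes f :: "real \<Rightarrow> 'a::{banach,second_countable_topology}"
  assumes f: "cadlag f" and r: "clock r" and rn: "\<And>n. clock (rn n)"
    and ge: "\<And>n s. 0 < s \<Longrightarrow> s \<le> 1 \<Longrightarrow> r s \<le> rn n s" and K: "\<And>n. rn n 1 \<le> K"
    and lim: "\<And>s. 0 < s \<Longrightarrow> s \<le> 1 \<Longrightarrow> (\<lambda>n. rn n s) \<longlonglongrightarrow> r s"
  shows "(\<lambda>n. path_int f (rn n)) \<longlonglongrightarrow> path_int f r"
proof (rule path_int_tendsto[OF f _ ge _ lim clock_path_measurable[OF f r] clock_path_measurable[OF f rn]])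
  fix n and s :: real assume s: "0 < s" "s \<le> 1"
  show "0 \<le> r s" using clockD(1)[OF r s(1) order.refl s(2)] .
  show "rn n s \<le> K" using clockD(2)[OF rn s order.refl] K[of n] by (rule order_trans)
qed

lemma set_integral_Ioc_const:
  "a \<le> b \<Longrightarrow> (LINT s:{a<..b}|lborel. c) = (b - a) *\<^sub>R (c :: 'a::{banach,second_countable_topology})"
  by (simp add: set_lebesgue_integral_def)

text \<open>Summation by parts, the discrete counterpart of the integration by parts in
  \<open>path_int\<close>.\<close>

lemma abel_sum:
  fixes a :: "nat \<Rightarrow> 'a::real_vector"
  shows "(\<Sum>j\<in>{1..<n}. real j *\<^sub>R (a (Suc j) - a j)) = real n *\<^sub>R a n - (\<Sum>k\<in>{1..n}. a k)"
proof (induction n)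
  case (Suc n)
  have "(\<Sum>j\<in>{1..<Suc n}. real j *\<^sub>R (a (Suc j) - a j))
      = (\<Sum>j\<in>{1..<n}. real j *\<^sub>R (a (Suc j) - a j)) + real n *\<^sub>R (a (Suc n) - a n)"
    by (cases n) auto
  then show ?case using Suc by (simp add: algebra_simps)
qed simp

text \<open>Along the clock evaluated at the next grid point, the time integral is the mean of the
  grid values of the path, and Abel summation turns \<open>path_int\<close> into the stated sum.
  These step clocks decrease to \<open>r\<close> from above in the sense of
  \<open>path_int_tendsto\<close>, which gives the limit.\<close>

lemma path_int_Riemann:
  fixes f :: "real \<Rightarrow> 'a::{banach,second_countable_topology}"
  assumes f: "cadlag f" and r: "clock r"
  shows "(\<lambda>n. \<Sum>j\<in>{1..<n}. (real j / n) *\<^sub>R (f (r (real (Suc j) / n)) - f (r (real j / n)))) \<longlonglongrightarrow> path_int f r"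
proof -
  define rn where "rn n s = r (grid_ceil (Suc n) s)" for n s
  have lim: "(\<lambda>n. rn n s) \<longlonglongrightarrow> r s" if "0 < s" "s \<le> 1" for s
  proof -
    \<comment> \<open>For the identity path, convergence of the path along the step clocks is
      convergence of the clocks themselves.\<close>
    have "cadlag (\<lambda>x::real. x)"
      by (auto simp: cadlag_def intro!: tendsto_ident_at continuous_intros exI)
    from clock_step_tendsto[OF this r that] show ?thesis by (simp add: rn_def)
  qed
  have mrn: "set_borel_measurable lborel {0<..1} (\<lambda>s. f (rn n s))" for n
  proof -
    have "(\<lambda>k::int. f (r (of_int k / real (Suc n)))) \<circ> (\<lambda>s. \<lceil>real (Suc n) * s\<rceil>) \<in> borel_measurable borel"
      by (rule measurable_comp[where N = "count_space UNIV"]) auto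
    then have "(\<lambda>s. f (rn n s)) \<in> borel_measurable borel"
      by (simp only: o_def rn_def grid_ceil_def)
    then show ?thesis by (simp add: set_borel_measurable_def)
  qed
  have "(\<lambda>n. path_int f (rn n)) \<longlonglongrightarrow> path_int f r"
  proof (rule path_int_tendsto[OF f _ _ _ lim clock_path_measurable[OF f r] mrn, where K = "r 1"])
    fix n and s :: real assume s: "0 < s" "s \<le> 1"
    note g = ceil_grid[OF s, of "Suc n"]
    show "0 \<le> r s" using clockD(1)[OF r s(1) order.refl s(2)] .
    show "r s \<le> rn n s" "rn n s \<le> r 1"
      unfolding rn_def using clockD(2)[OF r s(1) g(1) g(3)] clockD(2)[OF r g(4) g(3) order.refl] by auto
  qed
  moreover have "path_int f (rn n) = (\<Sum>j\<in>{1..<Suc n}. (real j / real (Suc n)) *\<^sub>R (f (r (real (Suc j) / real (Suc n))) - f (r (real j / real (Suc n)))))" for n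
  proof -
    let ?n = "Suc n"
    let ?f = "\<lambda>k. f (r (real k / real ?n))" and ?A = "\<lambda>k. {real (k - 1) / real ?n<..real k / real ?n}"
    have step: "indicat_real {0<..1} s *\<^sub>R f (rn n s)
       = (\<Sum>k\<in>{1..?n}. indicat_real (?A k) s *\<^sub>R ?f k)" for s
    proof (cases "0 < s \<and> s \<le> 1")
      case True
      have iff: "k = nat \<lceil>real ?n * s\<rceil> \<longleftrightarrow> s \<in> ?A k" if "k \<in> {1..?n}" for k
      proof -
        have "k = nat \<lceil>real ?n * s\<rceil> \<longleftrightarrow> \<lceil>real ?n * s\<rceil> = int k" using that by auto
        also have "\<dots> \<longleftrightarrow> real k - 1 < real ?n * s \<and> real ?n * s \<le> real k" by (simp add: ceiling_eq_iff)
        also have "\<dots> \<longleftrightarrow> s \<in> ?A k"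
          using that by (auto simp: field_simps of_nat_diff)
        finally show ?thesis .
      qed
      note g = ceil_grid[of s ?n]
      have mem: "nat \<lceil>real ?n * s\<rceil> \<in> {1..?n}"
        using g True by (auto simp: grid_ceil_def le_nat_iff nat_le_iff field_simps)
      have "(\<Sum>k\<in>{1..?n}. indicat_real (?A k) s *\<^sub>R ?f k)
        = (\<Sum>k\<in>{1..?n}. if k = nat \<lceil>real ?n * s\<rceil> then ?f k else 0)"
        using iff by (intro sum.cong refl) (auto simp: indicator_def)
      also have "\<dots> = f (r (real (nat \<lceil>real ?n * s\<rceil>) / real ?n))"
        by (subst sum.delta) (use mem in \<open>simp_all only: finite_atLeastAtMost if_True\<close>)
      also have "real (nat \<lceil>real ?n * s\<rceil>) = of_int \<lceil>real ?n * s\<rceil>" using mem by auto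
      also have "f (r (of_int \<lceil>real ?n * s\<rceil> / real ?n)) = f (rn n s)" by (simp only: rn_def grid_ceil_def)
      finally show ?thesis using True by simp
    next
      case False
      have "s \<notin> ?A k" if "k \<in> {1..?n}" for k
      proof
        assume a: "s \<in> ?A k"
        then have "real (k - 1) / real ?n < s" "s \<le> real k / real ?n" by simp_all
        moreover have "real k / real ?n \<le> 1" "0 \<le> real (k - 1) / real ?n" using that by simp_all
        ultimately show False using False by linarith
      qed
      then show ?thesis using False by (auto intro!: sum.neutral[symmetric])
    qed
    have "(LINT s:{0<..1}|lborel. f (rn n s)) = (\<Sum>k\<in>{1..?n}. (1 / real ?n) *\<^sub>R ?f k)"
      unfolding set_lebesgue_integral_def step
    proof (subst Bochner_Integration.integral_sum)
      fix k assume "k \<in> {1..?n}"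
      show "integrable lborel (\<lambda>s. indicat_real (?A k) s *\<^sub>R ?f k)"
        by (rule integrable_scaleR_left) (auto intro!: integrable_real_indicator simp: emeasure_lborel_Ioc divide_right_mono)
    next
      show "(\<Sum>k\<in>{1..?n}. LINT s|lborel. indicat_real (?A k) s *\<^sub>R ?f k)
        = (\<Sum>k\<in>{1..?n}. (1 / real ?n) *\<^sub>R ?f k)"
      proof (rule sum.cong)
        fix k assume "k \<in> {1..?n}"
        then have "real k / real ?n - real (k - 1) / real ?n = 1 / real ?n"
          by (simp add: diff_divide_distrib[symmetric] of_nat_diff)
        moreover have "real (k - 1) / real ?n \<le> real k / real ?n" by (simp add: divide_right_mono)
        ultimately show "(LINT s|lborel. indicat_real (?A k) s *\<^sub>R ?f k) = (1 / real ?n) *\<^sub>R ?f k"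
          using set_integral_Ioc_const[of "real (k - 1) / real ?n" "real k / real ?n" "?f k"]
          unfolding set_lebesgue_integral_def by simp
      qed simp
    qed
    moreover have "grid_ceil ?n 1 = 1" by (simp add: grid_ceil_def del: of_nat_Suc)
    ultimately have "path_int f (rn n) = (1 / real ?n) *\<^sub>R (real ?n *\<^sub>R f (r (real ?n / real ?n)) - (\<Sum>k\<in>{1..?n}. ?f k))"
      by (simp add: path_int_def rn_def scaleR_sum_right scaleR_diff_right scaleR_add_right)
    also have "\<dots> = (1 / real ?n) *\<^sub>R (\<Sum>j\<in>{1..<?n}. real j *\<^sub>R (f (r (real (Suc j) / real ?n)) - f (r (real j / real ?n))))"
      using abel_sum[where n = ?n and a = "\<lambda>k. ?f k"] by simp
    also have "\<dots> = (\<Sum>j\<in>{1..<?n}. (real j / real ?n) *\<^sub>R (f (r (real (Suc j) / real ?n)) - f (r (real j / real ?n))))"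
      unfolding scaleR_sum_right by (intro sum.cong) (simp_all del: of_nat_Suc)
    finally show ?thesis .
  qed
  ultimately show ?thesis by (subst filterlim_sequentially_Suc[symmetric]) simp
qed

lemma path_int_cong:
  assumes "\<And>s. 0 < s \<Longrightarrow> s \<le> 1 \<Longrightarrow> r s = q s"
  shows "path_int f r = path_int f q"
  unfolding path_int_def using assms by (auto intro!: arg_cong2[where f = minus] set_lebesgue_integral_cong)

lemma path_int_const: "path_int f (\<lambda>_. c) = 0"
  by (simp add: path_int_def set_lebesgue_integral_def)

lemma clock_cong: "(\<And>s. 0 < s \<Longrightarrow> s \<le> 1 \<Longrightarrow> r s = q s) \<Longrightarrow> clock r = clock q"
  by (auto simp: clock_def mono_on_def cong: continuous_on_cong_simp)

lemma clock_compose: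
  assumes "clock r" "clock g" "\<And>s. 0 < s \<Longrightarrow> s \<le> 1 \<Longrightarrow> 0 < g s \<and> g s \<le> 1"
  shows "clock (\<lambda>s. r (g s))"
  unfolding clock_def
proof (intro conjI)
  show "continuous_on {0<..1} (\<lambda>s. r (g s))"
    by (rule continuous_on_compose2[of "{0<..1}" r]) (use assms in \<open>auto simp: clock_def\<close>)
qed (use assms in \<open>auto simp: clock_def mono_on_def\<close>)

lemma clock_add: "clock r \<Longrightarrow> clock q \<Longrightarrow> clock (\<lambda>s. r s + q s)"
  by (auto simp: clock_def mono_on_def intro!: continuous_intros add_mono)

lemma clock_const: "0 \<le> c \<Longrightarrow> clock (\<lambda>_. c)"
  by (auto simp: clock_def mono_on_def)

lemma clock_mult: "0 \<le> c \<Longrightarrow> clock r \<Longrightarrow> clock (\<lambda>s. c * r s)"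
  by (auto simp: clock_def mono_on_def intro!: continuous_intros mult_left_mono)

lemma clock_sum: "(\<And>i. i \<in> J \<Longrightarrow> clock (r i)) \<Longrightarrow> clock (\<lambda>s. \<Sum>i\<in>J. r i s)"
  by (induction J rule: infinite_finite_induct) (auto intro!: clock_add clock_const)

lemma clock_max: "0 < a \<Longrightarrow> a \<le> 1 \<Longrightarrow> clock r \<Longrightarrow> clock (\<lambda>s. r (max a s))"
  by (rule clock_compose[of r "max a"]) (auto simp: clock_def mono_on_def intro!: continuous_intros)

lemma clock_min: "0 < c \<Longrightarrow> clock (\<lambda>s. min (s / c) 1)"
  unfolding clock_def mono_on_def
  by (intro conjI continuous_intros) (auto simp: min_def divide_right_mono)

lemma clock_scale: "0 < c \<Longrightarrow> clock r \<Longrightarrow> clock (\<lambda>s. r (min (s / c) 1))"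
  by (rule clock_compose[of r "\<lambda>s. min (s / c) 1"]) (auto intro: clock_min)

lemma set_integral_Ioc_split:
  fixes f :: "real \<Rightarrow> 'a::{banach,second_countable_topology}"
  assumes "0 \<le> c" "c \<le> 1" "set_integrable lborel {0<..1} f"
  shows "(LINT s:{0<..1}|lborel. f s) = (LINT s:{0<..c}|lborel. f s) + (LINT s:{c<..1}|lborel. f s)"
proof -
  have "set_integrable lborel {0<..c} f" "set_integrable lborel {c<..1} f"
    by (rule set_integrable_subset[OF assms(3)]; use assms in auto)+
  moreover have "{0<..c} \<union> {c<..1} = {0<..1}" "{0<..c} \<inter> {c<..1} = {}" using assms by auto
  ultimately show ?thesis using set_integral_Un[of "{0<..c}" "{c<..1}" lborel f] by simp
qed

lemma path_int_scale:
  fixes f :: "real \<Rightarrow> 'a::{banach,second_countable_topology}"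
  assumes f: "cadlag f" and r: "clock r" and c: "0 < c" "c \<le> 1"
  shows "path_int f (\<lambda>s. r (min (s / c) 1)) = c *\<^sub>R path_int f r"
proof -
  have "(LINT s:{0<..1}|lborel. f (r (min (s / c) 1)))
    = (LINT s:{0<..c}|lborel. f (r (min (s / c) 1))) + (LINT s:{c<..1}|lborel. f (r (min (s / c) 1)))"
    using c by (intro set_integral_Ioc_split clock_path_integrable[OF f] clock_scale r) auto
  also have "(LINT s:{c<..1}|lborel. f (r (min (s / c) 1))) = (LINT s:{c<..1}|lborel. f (r 1))"
    using c by (intro set_lebesgue_integral_cong) (auto simp: min_def)
  also have "\<dots> = (1 - c) *\<^sub>R f (r 1)" using c by (simp add: set_integral_Ioc_const)
  also have "(LINT s:{0<..c}|lborel. f (r (min (s / c) 1))) = (LINT s|lborel. indicator {0<..c} s *\<^sub>R f (r (min (s / c) 1)))"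
    by (simp add: set_lebesgue_integral_def)
  also have "\<dots> = \<bar>c\<bar> *\<^sub>R (LINT s|lborel. indicator {0<..c} (0 + c * s) *\<^sub>R f (r (min ((0 + c * s) / c) 1)))"
    using c by (intro lborel_integral_real_affine) auto
  also have "\<dots> = c *\<^sub>R (LINT s|lborel. indicator {0<..1} s *\<^sub>R f (r s))"
    using c by (auto intro!: Bochner_Integration.integral_cong simp: indicator_def zero_less_mult_iff min_def)
  finally show ?thesis
    using c by (simp add: path_int_def set_lebesgue_integral_def algebra_simps)
qed

section \<open>Characteristic functionals of integrals of Levy processes\<close>

lemma (in prob_space) cf_tendsto_AE:
  assumes [measurable]: "\<And>n. X n \<in> borel_measurable M" "Y \<in> borel_measurable M"
    and lim: "AE w in M. (\<lambda>n. X n w) \<longlonglongrightarrow> Y w"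
  shows "(\<lambda>n. cf M (X n)) \<longlonglongrightarrow> cf M Y"
  unfolding cf_def
proof (rule integral_dominated_convergence[where w = "\<lambda>_. 1"])
  show "AE w in M. (\<lambda>n. iexp (X n w)) \<longlonglongrightarrow> iexp (Y w)"
    using lim by eventually_elim (intro tendsto_intros)
qed auto

lemmas (in prob_space) cf_tendsto = cf_tendsto_AE[OF _ _ AE_I2]

lemma cf_cong: "(\<And>w. w \<in> space M \<Longrightarrow> f w = g w) \<Longrightarrow> cf M f = cf M g"
  unfolding cf_def by (intro Bochner_Integration.integral_cong) auto

lemma cf_distr:
  fixes y :: "'a::{banach,second_countable_topology} \<Rightarrow> real"
  assumes [measurable]: "X \<in> borel_measurable M" and y: "bounded_linear y"
  shows "cf (distr M borel X) y = cf M (\<lambda>w. y (X w))"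
proof -
  have [measurable]: "y \<in> borel_measurable borel"
    by (intro borel_measurable_continuous_onI linear_continuous_on y)
  show ?thesis unfolding cf_def by (subst integral_distr) auto
qed

lemma bounded_linear_borel: "bounded_linear y \<Longrightarrow> y \<in> borel_measurable borel"
  for y :: "'a::real_normed_vector \<Rightarrow> 'b::real_normed_vector"
  by (intro borel_measurable_continuous_onI linear_continuous_on)

lemma (in prob_space) cf_zero: "cf M (\<lambda>_. 0) = 1"
  by (simp add: cf_def prob_space)

text \<open>Supplies the curves to which \<open>nth_root_curve_unique\<close> is applied: both start
  from the value 1 at u = 0.\<close>

lemma (in prob_space) continuous_cf_ray:
  assumes [measurable]: "f \<in> borel_measurable M"
  shows "continuous_on UNIV (\<lambda>u. cf M (\<lambda>w. u * f w))"
  unfolding continuous_on_sequentially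
  by (auto simp: o_def intro!: cf_tendsto tendsto_intros)

text \<open>The quotient of two continuous curves with equal nowhere vanishing n-th powers is a
  continuous curve of n-th roots of unity, hence constant.\<close>

lemma nth_root_curve_unique:
  fixes a b :: "real \<Rightarrow> complex"
  assumes a: "continuous_on UNIV a" and b: "continuous_on UNIV b"
    and n: "n > 0" and eq: "\<And>u. a u ^ n = b u ^ n" and nz: "\<And>u. b u \<noteq> 0"
    and "a 0 = b 0"
  shows "a u = b u"
proof -
  have "(\<lambda>u. a u / b u) constant_on UNIV"
  proof (rule continuous_finite_range_constant)
    show "continuous_on UNIV (\<lambda>u. a u / b u)" using a b nz by (intro continuous_intros) auto
    have "range (\<lambda>u. a u / b u) \<subseteq> {z. z ^ n = 1}"
      using eq nz by (auto simp: power_divide)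
    then show "finite (range (\<lambda>u. a u / b u))"
      by (rule finite_subset) (use n in \<open>simp add: finite_roots_unity\<close>)
  qed simp
  then have "a u / b u = a 0 / b 0" unfolding constant_on_def by (metis UNIV_I)
  then show ?thesis using nz[of u] nz[of 0] \<open>a 0 = b 0\<close> by (simp add: field_simps)
qed

locale levy =
  fixes M :: "'w measure" and Y :: "real \<Rightarrow> 'w \<Rightarrow> 'a::{banach,second_countable_topology}" and \<nu> :: "'a measure"
  assumes levy: "levy_process M Y \<nu>"
begin

sublocale prob_space M
  using levy by (simp add: levy_process_def)

lemma measurable_Y[measurable]: "Y t \<in> borel_measurable M"
  using levy by (simp add: levy_process_def)

lemma Y_0: "w \<in> space M \<Longrightarrow> Y 0 w = 0"
  using levy by (simp add: levy_process_def)

lemma cadlag_Y: "w \<in> space M \<Longrightarrow> cadlag (\<lambda>t. Y t w)"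
  using levy unfolding levy_process_def cadlag_def by blast

lemma law_1: "distr M borel (Y 1) = \<nu>"
  using levy by (simp add: levy_process_def)

lemma increment_law: "0 \<le> s \<Longrightarrow> s \<le> t \<Longrightarrow> distr M borel (\<lambda>w. Y t w - Y s w) = distr M borel (Y (t - s))"
  using levy unfolding levy_process_def by blast

lemma increments_indep:
  assumes "0 \<le> t 0" "\<And>k. k < n \<Longrightarrow> t k < t (Suc k)"
  shows "indep_vars (\<lambda>_. borel) (\<lambda>k w. Y (t (Suc k)) w - Y (t k) w) {..<n}"
  using levy assms unfolding levy_process_def by blast

definition phi :: "('a \<Rightarrow> real) \<Rightarrow> real \<Rightarrow> complex" where
  "phi y t = cf M (\<lambda>w. y (Y t w))"

definition RI :: "(real \<Rightarrow> real) \<Rightarrow> 'w \<Rightarrow> 'a" where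
  "RI r w = path_int (\<lambda>t. Y t w) r"

lemma cf_increment:
  assumes "bounded_linear y" "0 \<le> s" "s \<le> t"
  shows "cf M (\<lambda>w. y (Y t w - Y s w)) = phi y (t - s)"
proof -
  have "cf (distr M borel (\<lambda>w. Y t w - Y s w)) y = cf (distr M borel (Y (t - s))) y"
    using increment_law[OF assms(2,3)] by simp
  then show ?thesis using assms(1) by (simp add: cf_distr phi_def)
qed

lemma phi_0: "bounded_linear y \<Longrightarrow> phi y 0 = 1"
  unfolding phi_def by (subst cf_cong[where g = "\<lambda>_. 0"]) (simp_all add: Y_0 cf_zero linear_simps)

lemma phi_tendsto:
  assumes y: "bounded_linear y" and "0 \<le> t" "x \<longlonglongrightarrow> t" "\<And>n. t \<le> x n"
  shows "(\<lambda>n. phi y (x n)) \<longlonglongrightarrow> phi y t"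
proof -
  have [measurable]: "y \<in> borel_measurable borel" by (rule bounded_linear_borel[OF y])
  show ?thesis
    unfolding phi_def
    by (rule cf_tendsto)
       (auto intro!: bounded_linear.tendsto[OF y] cadlag_tendsto[OF cadlag_Y] assms always_eventually)
qed

text \<open>Every increment has its own functional, because the Riemann sums weight the j-th
  increment by j/n.\<close>

lemma cf_increments_strict:
  fixes y :: "nat \<Rightarrow> 'a \<Rightarrow> real"
  assumes y: "\<And>k. bounded_linear (y k)" and t: "0 \<le> t 0" "\<And>k. k < n \<Longrightarrow> t k < t (Suc k)"
  shows "cf M (\<lambda>w. \<Sum>k<n. y k (Y (t (Suc k)) w - Y (t k) w)) = (\<Prod>k<n. phi (y k) (t (Suc k) - t k))"
proof -
  let ?D = "\<lambda>t k w. Y (t (Suc k)) w - Y (t k) w"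
  have [measurable]: "y k \<in> borel_measurable borel" for k by (rule bounded_linear_borel[OF y])
  have pos: "k \<le> n \<Longrightarrow> 0 \<le> t k" for k
  proof (induction k)
    case (Suc k)
    then show ?case using t(2)[of k] by auto
  qed (use t in simp)
  have "indep_vars (\<lambda>_. borel) (\<lambda>k w. iexp (y k (?D t k w))) {..<n}"
    by (rule indep_vars_compose2[OF increments_indep[where n = n and t = t]]) (use t in auto)
  then have "(CLINT w|M. (\<Prod>k<n. iexp (y k (?D t k w))))
     = (\<Prod>k<n. CLINT w|M. iexp (y k (?D t k w)))"
    by (intro indep_vars_lebesgue_integral integrable_iexp') auto
  also have "\<dots> = (\<Prod>k<n. phi (y k) (t (Suc k) - t k))"
    using t pos by (intro prod.cong refl) (simp add: cf_increment[OF y, symmetric] cf_def less_imp_le)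
  finally show ?thesis
    by (simp add: cf_def sum_distrib_left exp_sum)
qed

text \<open>Coinciding times are separated by a perturbation to the right.\<close>

lemma cf_increments:
  fixes y :: "nat \<Rightarrow> 'a \<Rightarrow> real"
  assumes y: "\<And>k. bounded_linear (y k)" and t: "0 \<le> t 0" "\<And>k. k < n \<Longrightarrow> t k \<le> t (Suc k)"
  shows "cf M (\<lambda>w. \<Sum>k<n. y k (Y (t (Suc k)) w - Y (t k) w)) = (\<Prod>k<n. phi (y k) (t (Suc k) - t k))"
proof -
  let ?D = "\<lambda>t k w. Y (t (Suc k)) w - Y (t k) w"
  have [measurable]: "y k \<in> borel_measurable borel" for k by (rule bounded_linear_borel[OF y])
  have pos: "k \<le> n \<Longrightarrow> 0 \<le> t k" for k
  proof (induction k)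
    case (Suc k)
    then show ?case using t(2)[of k] by auto
  qed (use t in simp)
  \<comment> \<open>The shift grows with \<open>k\<close>, so each gap becomes
    \<open>t (Suc k) - t k + 1 / Suc i\<close>. Times and gaps alike converge from above, where the
    paths and \<open>phi\<close> are continuous.\<close>
  define s where "s i k = t k + real k * inverse (real (Suc i))" for i k :: nat
  have s: "(\<lambda>i. s i k) \<longlonglongrightarrow> t k" for k
    unfolding s_def by (rule tendsto_eq_intros LIMSEQ_inverse_real_of_nat refl)+ simp
  have d: "(\<lambda>i. s i (Suc k) - s i k) \<longlonglongrightarrow> t (Suc k) - t k" for k
    by (intro tendsto_diff s)
  have "(\<lambda>i. cf M (\<lambda>w. \<Sum>k<n. y k (?D (s i) k w)))
     \<longlonglongrightarrow> cf M (\<lambda>w. \<Sum>k<n. y k (?D t k w))"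
  proof (rule cf_tendsto)
    fix w assume w: "w \<in> space M"
    have Yk: "(\<lambda>i. Y (s i k) w) \<longlonglongrightarrow> Y (t k) w" if "k \<le> n" for k
      by (rule cadlag_tendsto[OF cadlag_Y[OF w] pos[OF that] s]) (simp add: s_def)
    show "(\<lambda>i. \<Sum>k<n. y k (?D (s i) k w)) \<longlonglongrightarrow> (\<Sum>k<n. y k (?D t k w))"
      by (intro tendsto_sum bounded_linear.tendsto[OF y] tendsto_diff Yk) auto
  qed measurable
  moreover have "(\<lambda>i. \<Prod>k<n. phi (y k) (s i (Suc k) - s i k)) \<longlonglongrightarrow> (\<Prod>k<n. phi (y k) (t (Suc k) - t k))"
    by (intro tendsto_prod phi_tendsto y d) (use t in \<open>auto simp: s_def algebra_simps\<close>)
  moreover have "cf M (\<lambda>w. \<Sum>k<n. y k (?D (s i) k w)) = (\<Prod>k<n. phi (y k) (s i (Suc k) - s i k))" for i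
    by (rule cf_increments_strict[OF y]) (use t in \<open>auto simp: s_def intro!: add_le_less_mono mult_strict_right_mono\<close>)
  ultimately show ?thesis by (simp add: LIMSEQ_unique)
qed

lemma phi_add:
  assumes "bounded_linear y" "0 \<le> s" "0 \<le> t"
  shows "phi y (s + t) = phi y s * phi y t"
proof -
  define T where "T k = (if k = 0 then 0 else if k = 1 then s else s + t)" for k :: nat
  have "cf M (\<lambda>w. \<Sum>k<2. y (Y (T (Suc k)) w - Y (T k) w)) = (\<Prod>k<2. phi y (T (Suc k) - T k))"
    by (rule cf_increments) (use assms in \<open>auto simp: T_def\<close>)
  moreover have "cf M (\<lambda>w. \<Sum>k<2. y (Y (T (Suc k)) w - Y (T k) w)) = phi y (s + t)"
    unfolding phi_def using assms(1)
    by (intro cf_cong) (simp add: T_def numeral_2_eq_2 Y_0 linear_simps)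
  ultimately show ?thesis by (simp add: T_def numeral_2_eq_2)
qed

lemma phi_power:
  assumes "bounded_linear y" "0 \<le> t"
  shows "phi y (real n * t) = phi y t ^ n"
proof (induction n)
  case (Suc n)
  have "real (Suc n) * t = t + real n * t" by (simp add: algebra_simps)
  then show ?case using Suc assms by (simp add: phi_add)
qed (use assms in \<open>simp add: phi_0\<close>)

text \<open>Since \<open>phi y\<close> is right-continuous at 0 with value 1, it does not vanish at
  some \<open>1 / Suc n\<close>; its value at 1 is a power of that number.\<close>

lemma phi_1_nonzero:
  assumes y: "bounded_linear y"
  shows "phi y 1 \<noteq> 0"
proof -
  have "(\<lambda>n. phi y (inverse (real (Suc n)))) \<longlonglongrightarrow> phi y 0"
    by (rule phi_tendsto[OF y _ LIMSEQ_inverse_real_of_nat]) auto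
  then have "\<forall>\<^sub>F n in sequentially. phi y (inverse (real (Suc n))) \<noteq> 0"
    using phi_0[OF y] by (intro tendsto_imp_eventually_ne) auto
  then obtain n where "phi y (inverse (real (Suc n))) \<noteq> 0" by (auto simp: eventually_sequentially)
  then show ?thesis using phi_power[OF y, of "inverse (real (Suc n))" "Suc n"] by auto
qed

lemma RI_Riemann:
  assumes "clock r" "w \<in> space M"
  shows "(\<lambda>n. \<Sum>j\<in>{1..<n}. (real j / n) *\<^sub>R (Y (r (real (Suc j) / n)) w - Y (r (real j / n)) w)) \<longlonglongrightarrow> RI r w"
  unfolding RI_def by (rule path_int_Riemann[OF cadlag_Y]) fact+

text \<open>As a pathwise limit of Riemann sums the integral is measurable without recourse to joint
  measurability of the process in time and outcome.\<close>

lemma measurable_RI[measurable]: "clock r \<Longrightarrow> RI r \<in> borel_measurable M"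
  by (rule borel_measurable_LIMSEQ_metric[OF _ RI_Riemann]) auto

definition chi :: "('a \<Rightarrow> real) \<Rightarrow> (real \<Rightarrow> real) \<Rightarrow> complex" where
  "chi y r = cf M (\<lambda>w. y (RI r w))"

definition law :: "(real \<Rightarrow> real) \<Rightarrow> 'a measure" where
  "law r = distr M borel (RI r)"

lemma cf_law: "clock r \<Longrightarrow> bounded_linear y \<Longrightarrow> cf (law r) y = chi y r"
  by (simp add: law_def chi_def cf_distr measurable_RI)

lemma law_prob: "clock r \<Longrightarrow> prob_space (law r)" and sets_law: "sets (law r) = sets borel"
  by (simp_all add: law_def prob_space_distr measurable_RI)

text \<open>The characteristic functional of the n-th Riemann sum, factored by independence of
  increments. The product starts at 1: the term with j = 0 has weight 0 and would evaluate the clock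
  at 0, where it is unconstrained.\<close>

definition phi_prod :: "('a \<Rightarrow> real) \<Rightarrow> (real \<Rightarrow> real) \<Rightarrow> nat \<Rightarrow> complex" where
  "phi_prod y r n = (\<Prod>j\<in>{1..<n}. phi (\<lambda>x. real j / n * y x) (r (real (Suc j) / n) - r (real j / n)))"

lemma cf_RI_lim:
  assumes y: "bounded_linear y" and r: "clock r"
  shows "phi_prod y r \<longlonglongrightarrow> chi y r"
proof -
  have [measurable]: "y \<in> borel_measurable borel" by (rule bounded_linear_borel[OF y])
  note [measurable] = measurable_RI[OF r]
  interpret y: bounded_linear y by fact
  have "(\<lambda>n. cf M (\<lambda>w. y (\<Sum>j\<in>{1..<n}. (real j / n) *\<^sub>R (Y (r (real (Suc j) / n)) w - Y (r (real j / n)) w))))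
      \<longlonglongrightarrow> chi y r"
    unfolding chi_def using RI_Riemann[OF r] by (intro cf_tendsto y.tendsto) simp_all
  moreover have "cf M (\<lambda>w. y (\<Sum>j\<in>{1..<n}. (real j / n) *\<^sub>R (Y (r (real (Suc j) / n)) w - Y (r (real j / n)) w)))
     = phi_prod y r n" for n
  proof -
    define t where "t k = r (real (Suc k) / n)" for k
    have re: "(\<Sum>j\<in>{1..<n}. g j) = (\<Sum>k<n - 1. g (Suc k))" for g :: "nat \<Rightarrow> real"
      by (rule sum.reindex_bij_witness[of _ Suc "\<lambda>j. j - 1"]) auto
    have rep: "(\<Prod>j\<in>{1..<n}. g j) = (\<Prod>k<n - 1. g (Suc k))" for g :: "nat \<Rightarrow> complex"
      by (rule prod.reindex_bij_witness[of _ Suc "\<lambda>j. j - 1"]) auto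
    have "cf M (\<lambda>w. \<Sum>k<n - 1. (\<lambda>x. real (Suc k) / n * y x) (Y (t (Suc k)) w - Y (t k) w))
      = (\<Prod>k<n - 1. phi (\<lambda>x. real (Suc k) / n * y x) (t (Suc k) - t k))"
    \<comment> \<open>For n = 0 the grid point \<open>1 / n\<close> equals 0, outside the range
      where the clock is known to be nonnegative; both sides are then empty.\<close>
    proof (cases "n = 0")
      case True
      then show ?thesis by (simp add: cf_zero)
    next
      case False
      show ?thesis
      proof (rule cf_increments)
        show "bounded_linear (\<lambda>x. real (Suc k) / n * y x)" for k
          by (rule bounded_linear_const_mult[OF y])
        show "0 \<le> t 0" using False clockD(1)[OF r, of "1 / n" 1] by (simp add: t_def)
      next
        fix k assume "k < n - 1"
        then show "t k \<le> t (Suc k)"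
          unfolding t_def by (intro clockD(2)[OF r] divide_right_mono) auto
      qed
    qed
    then show ?thesis
      unfolding phi_prod_def y.sum y.scaleR re rep t_def by simp
  qed
  ultimately show ?thesis by simp
qed

text \<open>This takes the place of the formula that integrates log-characteristic functionals with
  respect to dr: multiplicativity in the clock holds factor by factor in \<open>phi_prod\<close> by
  \<open>phi_add\<close> and survives the limit, and no branch of the logarithm has to be
  chosen.\<close>

lemma cf_RI_add:
  assumes y: "bounded_linear y" and r: "clock r" and q: "clock q"
  shows "chi y (\<lambda>s. r s + q s) = chi y r * chi y q"
proof (rule LIMSEQ_unique)
  let ?rq = "\<lambda>s. r s + q s"
  show "phi_prod y ?rq \<longlonglongrightarrow> chi y ?rq"
    by (rule cf_RI_lim[OF y clock_add[OF r q]])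
  have "phi_prod y ?rq = (\<lambda>n. phi_prod y r n * phi_prod y q n)"
    unfolding phi_prod_def prod.distrib[symmetric]
  proof (intro ext prod.cong)
    fix n j :: nat assume j: "j \<in> {1..<n}"
    let ?a = "real j / n" and ?b = "real (Suc j) / n"
    have *: "0 \<le> r ?b - r ?a" "0 \<le> q ?b - q ?a"
      using j clockD(2)[OF r, of ?a ?b] clockD(2)[OF q, of ?a ?b] by (auto simp: divide_right_mono)
    have "?rq ?b - ?rq ?a = (r ?b - r ?a) + (q ?b - q ?a)" by simp
    then show "phi (\<lambda>x. ?a * y x) (?rq ?b - ?rq ?a) = phi (\<lambda>x. ?a * y x) (r ?b - r ?a) * phi (\<lambda>x. ?a * y x) (q ?b - q ?a)"
      using phi_add[OF bounded_linear_const_mult[OF y] *] by (simp only:)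
  qed simp
  moreover have "(\<lambda>n. phi_prod y r n * phi_prod y q n) \<longlonglongrightarrow> chi y r * chi y q"
    by (intro tendsto_mult cf_RI_lim y r q)
  ultimately show "phi_prod y ?rq \<longlonglongrightarrow> chi y r * chi y q"
    by simp
qed

lemma cf_RI_const:
  assumes "bounded_linear y"
  shows "chi y (\<lambda>_. c) = 1"
  using assms by (simp add: chi_def RI_def path_int_const linear_simps cf_zero)

lemma cf_RI_sum:
  assumes y: "bounded_linear y" and r: "\<And>i. i \<in> J \<Longrightarrow> clock (r i)"
  shows "chi y (\<lambda>s. \<Sum>i\<in>J. r i s) = (\<Prod>i\<in>J. chi y (r i))"
  using r
proof (induction J rule: infinite_finite_induct)
  case (insert i J)
  have "chi y (\<lambda>s. r i s + (\<Sum>i\<in>J. r i s)) = chi y (r i) * chi y (\<lambda>s. \<Sum>i\<in>J. r i s)"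
    by (rule cf_RI_add[OF y]) (use insert in \<open>auto intro: clock_sum\<close>)
  then show ?case using insert by simp
qed (use y in \<open>simp_all add: cf_RI_const\<close>)

lemma cf_RI_power:
  assumes y: "bounded_linear y" and r: "clock r"
  shows "chi y (\<lambda>s. real n * r s) = chi y r ^ n"
  using cf_RI_sum[OF y, of "{..<n}" "\<lambda>_. r"] r by simp

lemma RI_scale:
  assumes "clock r" "0 < c" "c \<le> 1" "w \<in> space M"
  shows "RI (\<lambda>s. r (min (s / c) 1)) w = c *\<^sub>R RI r w"
  unfolding RI_def by (rule path_int_scale[OF cadlag_Y]) fact+

lemma RI_cong: "(\<And>s. 0 < s \<Longrightarrow> s \<le> 1 \<Longrightarrow> r s = q s) \<Longrightarrow> RI r = RI q"
  by (auto simp: RI_def fun_eq_iff intro: path_int_cong)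

lemma RI_tendsto:
  assumes "clock r" "\<And>n. clock (rn n)" "\<And>n s. 0 < s \<Longrightarrow> s \<le> 1 \<Longrightarrow> r s \<le> rn n s" "\<And>n. rn n 1 \<le> K"
    "\<And>s. 0 < s \<Longrightarrow> s \<le> 1 \<Longrightarrow> (\<lambda>n. rn n s) \<longlonglongrightarrow> r s" "w \<in> space M"
  shows "(\<lambda>n. RI (rn n) w) \<longlonglongrightarrow> RI r w"
  unfolding RI_def by (rule path_int_tendsto_clock[OF cadlag_Y]) (use assms in auto)

text \<open>Freezing the clock below \<open>a\<close> adds \<open>a *\<^sub>R Y (r a) w\<close> to
  the time integral, and this is the boundary term at \<open>a\<close>. Truncated integrals thus
  become integrals over (0,1] along modified clocks.\<close>

lemma rint_s_eq_RI:
  assumes r: "clock r" and a: "0 < a" "a \<le> 1" and w: "w \<in> space M"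
  shows "rint_s Y r a w = RI (\<lambda>s. r (max a s)) w"
proof -
  have "(LINT s:{0<..1}|lborel. Y (r (max a s)) w)
     = (LINT s:{0<..a}|lborel. Y (r (max a s)) w) + (LINT s:{a<..1}|lborel. Y (r (max a s)) w)"
    using a by (intro set_integral_Ioc_split clock_path_integrable[OF cadlag_Y[OF w]] clock_max r) auto
  also have "(LINT s:{0<..a}|lborel. Y (r (max a s)) w) = (LINT s:{0<..a}|lborel. Y (r a) w)"
    by (intro set_lebesgue_integral_cong) (auto simp: max_def)
  also have "\<dots> = a *\<^sub>R Y (r a) w" using a by (simp add: set_integral_Ioc_const)
  also have "(LINT s:{a<..1}|lborel. Y (r (max a s)) w) = (LINT s:{a<..1}|lborel. Y (r s) w)"
    by (intro set_lebesgue_integral_cong) (auto simp: max_def)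
  finally show ?thesis using a by (simp add: rint_s_def RI_def path_int_def max_def)
qed

lemma prob_measures_law: "clock r \<Longrightarrow> law r \<in> prob_measures"
  by (simp add: prob_measures_def law_prob sets_law)

text \<open>The clocks frozen below a lie above \<open>r\<close> and agree with it at s as soon as a
  < s. The truncated integrals therefore converge for every path, hence also in law.\<close>

lemma weak_limit_rint_s:
  fixes f :: "'a \<Rightarrow> real"
  assumes r: "clock r" and f: "continuous_on UNIV f" "bounded (range f)"
  shows "((\<lambda>a. integral\<^sup>L (distr M borel (rint_s Y r a)) f) \<longlongrightarrow> integral\<^sup>L (law r) f) (at_right 0)"
proof (rule tendsto_at_right_sequentially[where b = 1])
  fix S :: "nat \<Rightarrow> real" assume S: "\<And>n. 0 < S n" "\<And>n. S n < 1" "decseq S" "S \<longlonglongrightarrow> 0"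
  have fm[measurable]: "f \<in> borel_measurable borel" using f by (intro borel_measurable_continuous_onI)
  obtain B where B: "\<And>x. \<bar>f x\<bar> \<le> B" using f(2) by (auto simp: bounded_iff)
  have cm: "clock (\<lambda>s. r (max (S n) s))" for n using S r by (intro clock_max) (auto simp: less_imp_le)
  have d: "distr M borel (rint_s Y r (S n)) = law (\<lambda>s. r (max (S n) s))" for n
    unfolding law_def using rint_s_eq_RI[OF r] S by (intro distr_cong) (auto simp: less_imp_le)
  note [measurable] = measurable_RI[OF r] measurable_RI[OF cm]
  have lim: "(\<lambda>n. RI (\<lambda>s. r (max (S n) s)) w) \<longlonglongrightarrow> RI r w" if w: "w \<in> space M" for w
  proof (rule RI_tendsto[OF r cm _ _ _ w])
    fix n and s :: real assume s: "0 < s" "s \<le> 1"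
    show "r s \<le> r (max (S n) s)" using S s by (intro clockD[OF r]) (auto simp: less_imp_le)
  next
    show "r (max (S n) 1) \<le> r 1" for n using S by (simp add: max_def less_imp_le)
  next
    fix s :: real assume s: "0 < s" "s \<le> 1"
    have "\<forall>\<^sub>F n in sequentially. S n < s" using S(4) s(1) by (rule order_tendstoD)
    then have "\<forall>\<^sub>F n in sequentially. r (max (S n) s) = r s" by eventually_elim (simp add: max_def)
    then show "(\<lambda>n. r (max (S n) s)) \<longlonglongrightarrow> r s" by (rule tendsto_eventually)
  qed
  have "(\<lambda>n. LINT w|M. f (RI (\<lambda>s. r (max (S n) s)) w)) \<longlonglongrightarrow> (LINT w|M. f (RI r w))"
  proof (rule integral_dominated_convergence[where w = "\<lambda>_. B"])
    have "isCont f x" for x using f(1) by (simp add: continuous_on_eq_continuous_at)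
    then show "AE w in M. (\<lambda>n. f (RI (\<lambda>s. r (max (S n) s)) w)) \<longlonglongrightarrow> f (RI r w)"
      by (intro AE_I2 isCont_tendsto_compose[of _ f] lim)
  qed (use B in auto)
  then show "(\<lambda>n. integral\<^sup>L (distr M borel (rint_s Y r (S n))) f) \<longlonglongrightarrow> integral\<^sup>L (law r) f"
    by (simp add: d law_def integral_distr)
qed simp

text \<open>Uniqueness of the weak limit: the cosine and sine of a functional are bounded continuous
  test functions, so the limits have equal characteristic functionals.\<close>

lemma weak_conv_iff_law:
  assumes r: "clock r" and \<mu>: "\<mu> \<in> prob_measures"
  shows "weak_conv_right0 (\<lambda>a. distr M borel (rint_s Y r a)) \<mu> \<longleftrightarrow> \<mu> = law r"
proof
  assume w: "weak_conv_right0 (\<lambda>a. distr M borel (rint_s Y r a)) \<mu>"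
  have e: "integral\<^sup>L \<mu> f = integral\<^sup>L (law r) f" if f: "continuous_on UNIV f" "bounded (range f)" for f :: "'a \<Rightarrow> real"
    using w that weak_limit_rint_s[OF r f] unfolding weak_conv_right0_def
    by (intro tendsto_unique[of "at_right (0::real)"]) auto
  have P: "prob_space \<mu>" "sets \<mu> = sets borel" using \<mu> by (auto simp: prob_measures_def)
  note Q = law_prob[OF r] sets_law[of r]
  show "\<mu> = law r"
  proof (rule cf_unique[OF P Q])
    fix z :: "'a \<Rightarrow> real" assume z: "bounded_linear z"
    have re_im: "cf N z = Complex (LINT x|N. cos (z x)) (LINT x|N. sin (z x))" if "prob_space N" "sets N = sets borel" for N
    proof -
      interpret N: prob_space N by fact
      have "z \<in> borel_measurable N"
        using bounded_linear_borel[OF z] \<open>sets N = sets borel\<close> by (simp cong: measurable_cong_sets)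
      then have "integrable N (\<lambda>x. iexp (z x))" by (rule N.integrable_iexp')
      then show ?thesis unfolding cf_def
        by (simp add: complex_eq_iff Re_exp Im_exp flip: integral_Re integral_Im)
    qed
    have zc: "continuous_on UNIV z" by (rule linear_continuous_on[OF z])
    have "(LINT x|\<mu>. cos (z x)) = (LINT x|law r. cos (z x))"
      by (rule e) (auto intro!: continuous_intros zc boundedI[where B = 1])
    moreover have "(LINT x|\<mu>. sin (z x)) = (LINT x|law r. sin (z x))"
      by (rule e) (auto intro!: continuous_intros zc boundedI[where B = 1])
    ultimately show "cf \<mu> z = cf (law r) z" using re_im[OF P] re_im[OF Q] by simp
  qed
next
  assume "\<mu> = law r"
  then show "weak_conv_right0 (\<lambda>a. distr M borel (rint_s Y r a)) \<mu>"
    using weak_limit_rint_s[OF r] by (simp add: weak_conv_right0_def)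
qed

end

text \<open>Removes the limit in distribution; afterwards only the laws \<open>law r\<close> of
  integrals over (0,1] have to be compared.\<close>

lemma is_law_rint_iff:
  fixes \<nu> \<mu> :: "'a::{banach,second_countable_topology} measure"
  assumes r: "clock r"
  shows "is_law_rint \<nu> r \<mu> \<longleftrightarrow>
    (\<exists>(M :: (real \<Rightarrow> 'a) measure) Y. levy_process M Y \<nu> \<and> \<mu> = levy.law M Y r)"
proof
  assume "is_law_rint \<nu> r \<mu>"
  then obtain M :: "(real \<Rightarrow> 'a) measure" and Y where *: "\<mu> \<in> prob_measures" "levy_process M Y \<nu>"
      "weak_conv_right0 (\<lambda>a. distr M borel (rint_s Y r a)) \<mu>"
    by (auto simp: is_law_rint_def)
  then interpret levy M Y \<nu> by unfold_locales
  show "\<exists>(M :: (real \<Rightarrow> 'a) measure) Y. levy_process M Y \<nu> \<and> \<mu> = levy.law M Y r"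
    using * weak_conv_iff_law[OF r *(1)] by blast
next
  assume "\<exists>(M :: (real \<Rightarrow> 'a) measure) Y. levy_process M Y \<nu> \<and> \<mu> = levy.law M Y r"
  then obtain M :: "(real \<Rightarrow> 'a) measure" and Y where *: "levy_process M Y \<nu>" "\<mu> = levy.law M Y r"
    by blast
  interpret levy M Y \<nu> using *(1) by unfold_locales
  show "is_law_rint \<nu> r \<mu>"
    unfolding is_law_rint_def using * prob_measures_law[OF r] weak_conv_iff_law[OF r] by blast
qed

section \<open>The clocks\<close>

text \<open>The closed form of \<open>tau\<close>, as produced by repeated integration by parts.
  With x = - ln s it is the probability that a Poisson variable of mean x is less than m.\<close>

definition tau_poly :: "nat \<Rightarrow> real \<Rightarrow> real" where
  "tau_poly m s = s * (\<Sum>k<m. (- ln s) ^ k / fact k)"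

lemma tau_poly_Suc: "tau_poly (Suc m) s = tau_poly m s + s * (- ln s) ^ m / fact m"
  by (simp add: tau_poly_def algebra_simps)

lemma tau_poly_1: "m \<ge> 1 \<Longrightarrow> tau_poly m 1 = 1"
  by (induction m rule: dec_induct) (auto simp: tau_poly_def power_0_left)

text \<open>The derivative telescopes: differentiating the power in each new summand cancels what
  the previous ones left, so only the last power of the logarithm remains.\<close>

lemma has_derivative_tau_poly:
  assumes "0 < s"
  shows "(tau_poly (Suc m) has_real_derivative (- ln s) ^ m / fact m) (at s)"
proof (induction m)
  case 0
  have "tau_poly (Suc 0) = (\<lambda>s. s)" by (simp add: tau_poly_def fun_eq_iff)
  then show ?case by simp
next
  case (Suc m)
  have "((\<lambda>s. tau_poly (Suc m) s + s * (- ln s) ^ Suc m / fact (Suc m)) has_real_derivative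
      (- ln s) ^ m / fact m + (s * (real (Suc m) * (- ln s) ^ m * - (1 / s)) + (- ln s) ^ Suc m) / fact (Suc m)) (at s)"
    using assms by (auto intro!: derivative_eq_intros Suc simp del: power_Suc) 
  moreover have "(- ln s) ^ m / fact m + (s * (real (Suc m) * (- ln s) ^ m * - (1 / s)) + (- ln s) ^ Suc m) / fact (Suc m)
      = (- ln s) ^ Suc m / fact (Suc m)"
  proof -
    have "(s * (real (Suc m) * (- ln s) ^ m * - (1 / s))) / fact (Suc m) = - ((- ln s) ^ m / fact m)"
      using assms by simp
    then show ?thesis by (simp only: add_divide_distrib)
  qed
  moreover have "tau_poly (Suc (Suc m)) = (\<lambda>s. tau_poly (Suc m) s + s * (- ln s) ^ Suc m / fact (Suc m))"
    by (rule ext) (rule tau_poly_Suc)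
  ultimately show ?case by (simp only:)
qed

lemma tau_poly_tendsto_0: "(tau_poly m \<longlongrightarrow> 0) (at_right 0)"
proof -
  have "((\<lambda>s::real. s * (- ln s) ^ k) \<longlongrightarrow> 0) (at_right 0)" for k
  proof -
    \<comment> \<open>Substituting x = - ln s turns the term into \<open>x ^ k / exp x\<close> with
      x tending to infinity.\<close>
    have "filterlim (\<lambda>s::real. - ln s) at_top (at_right 0)"
      using ln_at_0 by (simp add: filterlim_uminus_at_bot)
    from filterlim_compose[OF tendsto_power_div_exp_0 this]
    have "((\<lambda>s::real. (- ln s) ^ k / exp (- ln s)) \<longlongrightarrow> 0) (at_right 0)" .
    moreover have "\<forall>\<^sub>F s in at_right (0::real). (- ln s) ^ k / exp (- ln s) = s * (- ln s) ^ k"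
      by (rule eventually_mono[OF eventually_at_right_less[of 0]]) (simp add: exp_minus field_simps)
    ultimately show ?thesis by (rule Lim_transform_eventually)
  qed
  then have "((\<lambda>s. \<Sum>k<m. (s * (- ln s) ^ k) / fact k) \<longlongrightarrow> (\<Sum>k<m. 0 / fact k)) (at_right (0::real))"
    by (intro tendsto_intros) auto
  then show ?thesis by (simp add: tau_poly_def[abs_def] sum_distrib_left)
qed

text \<open>The fundamental theorem for an integrand that may be unbounded at 0: it is nonnegative,
  and the antiderivative \<open>tau_poly m\<close> has limit 0 there.\<close>

lemma tau_eq_tau_poly:
  assumes m: "m \<ge> 1" and s: "0 < s" "s \<le> 1"
  shows "tau m s = tau_poly m s"
proof -
  obtain k where k: "m = Suc k" using m by (cases m) auto
  have d: "DERIV (tau_poly m) x :> (- ln x) ^ k / fact k" if "0 < x" for x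
    using has_derivative_tau_poly[OF that] by (simp add: k)
  have "(LBINT x=ereal 0..ereal s. (- ln x) ^ k / fact k) = tau_poly m s - 0"
  proof (rule interval_integral_FTC_nonneg[where F = "tau_poly m"])
    show "((tau_poly m \<circ> real_of_ereal) \<longlongrightarrow> 0) (at_right (ereal 0))"
      using tau_poly_tendsto_0 by (simp add: ereal_tendsto_simps zero_ereal_def)
    have "isCont (tau_poly m) s" by (rule DERIV_isCont[OF d[OF s(1)]])
    then have "(tau_poly m \<longlongrightarrow> tau_poly m s) (at_left s)"
      by (metis continuous_within isContD tendsto_within_subset subset_UNIV)
    then show "((tau_poly m \<circ> real_of_ereal) \<longlongrightarrow> tau_poly m s) (at_left (ereal s))"
      by (simp add: ereal_tendsto_simps)
    show "AE x in lborel. ereal 0 < ereal x \<longrightarrow> ereal x < ereal s \<longrightarrow> 0 \<le> (- ln x) ^ k / fact k"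
      using s by (auto intro!: AE_I2 divide_nonneg_nonneg zero_le_power)
  qed (use s in \<open>auto intro!: d continuous_intros\<close>)
  also have "(LBINT x=ereal 0..ereal s. (- ln x) ^ k / fact k) = (LINT x:{0<..s}|lborel. (- ln x) ^ k / fact k)"
    using s by (simp add: interval_integral_Ioc)
  finally show ?thesis by (simp add: tau_def k)
qed

lemma tau_poly_mono:
  assumes "m \<ge> 1" "0 < s" "s \<le> t" "t \<le> 1"
  shows "tau_poly m s \<le> tau_poly m t"
proof (rule DERIV_nonneg_imp_nondecreasing[OF assms(3)])
  fix x assume "s \<le> x" "x \<le> t"
  then have "0 < x" "x \<le> 1" using assms by auto
  moreover obtain k where "m = Suc k" using assms by (cases m) auto
  ultimately show "\<exists>y. DERIV (tau_poly m) x :> y \<and> 0 \<le> y"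
    using has_derivative_tau_poly[of x k] by (intro exI[of _ "(- ln x) ^ k / fact k"]) auto
qed

lemma clock_tau_poly: "m \<ge> 1 \<Longrightarrow> clock (tau_poly m)"
proof -
  assume m: "m \<ge> 1"
  then obtain k where k: "m = Suc k" by (cases m) auto
  show ?thesis
    unfolding clock_def
  proof (intro conjI ballI)
    show "mono_on {0<..1} (tau_poly m)" using tau_poly_mono[OF m] by (auto simp: mono_on_def)
    show "continuous_on {0<..1} (tau_poly m)"
      using has_derivative_tau_poly[of _ k] unfolding k
      by (intro continuous_at_imp_continuous_on ballI DERIV_isCont) auto
    show "0 \<le> tau_poly m s" if "s \<in> {0<..1}" for s
      using that by (auto simp: tau_poly_def intro!: mult_nonneg_nonneg sum_nonneg divide_nonneg_nonneg)
  qed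
qed

lemma clock_tau: "m \<ge> 1 \<Longrightarrow> clock (tau m)"
  using clock_tau_poly clock_cong[of "tau m" "tau_poly m"] tau_eq_tau_poly by blast

text \<open>The next clock is the average of the rescaled clocks: \<open>u * tau_poly (Suc m) (s / u)\<close> is an
  antiderivative of \<open>u \<mapsto> tau_poly m (s / u)\<close> on \<open>u > s\<close>.\<close>

lemma tau_poly_mean_bounds:
  assumes m: "m \<ge> 1" and s: "0 < s" and uv: "0 \<le> u" "u < v"
  defines "g \<equiv> \<lambda>u. if u = 0 then 1 else tau_poly m (min (s / u) 1)"
    and "G \<equiv> \<lambda>u. if u = 0 then 0 else u * tau_poly (Suc m) (min (s / u) 1)"
  shows "(v - u) * g v \<le> G v - G u" "G v - G u \<le> (v - u) * g u"
proof -
  \<comment> \<open>Up to u = s the argument is cut off at 1, so the clock has its full value. The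
    value at u = 0 is prescribed by hand because \<open>s / 0 = 0\<close> would give the wrong end
    of the clock.\<close>
  have g1: "g x = 1" if "0 \<le> x" "x \<le> s" for x
    using that s tau_poly_1[OF m] by (auto simp: g_def min_def field_simps)
  have G1: "G x = x" if "0 \<le> x" "x \<le> s" for x
    using that s tau_poly_1[of "Suc m"] by (auto simp: G_def min_def field_simps)
  have anti: "g y \<le> g x" if "0 < x" "x \<le> y" for x y
  proof -
    have "s / y \<le> s / x" using that s by (intro divide_left_mono) auto
    then have "tau_poly m (min (s / y) 1) \<le> tau_poly m (min (s / x) 1)"
      using that s by (intro tau_poly_mono[OF m]) auto
    then show ?thesis using that by (simp add: g_def)
  qed
  have A: "(v - u) * g v \<le> G v - G u \<and> G v - G u \<le> (v - u) * g u" if uv: "s \<le> u" "u < v" for u v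
  proof -
    obtain k where k: "m = Suc k" using m by (cases m) auto
    define H where "H x = x * tau_poly (Suc m) (s / x)" for x
    have dH: "DERIV H x :> tau_poly m (s / x)" if "u \<le> x" for x
    proof -
      have x: "0 < x" using that uv s by simp
      have "((\<lambda>x. tau_poly (Suc m) (s / x)) has_real_derivative (- ln (s / x)) ^ m / fact m * (- s / x\<^sup>2)) (at x)"
        by (rule DERIV_chain2[OF has_derivative_tau_poly]) (use x s in \<open>auto intro!: derivative_eq_intros simp: power2_eq_square\<close>)
      then have "DERIV H x :> 1 * tau_poly (Suc m) (s / x) + (- ln (s / x)) ^ m / fact m * (- s / x\<^sup>2) * x"
        unfolding H_def[abs_def] by (intro DERIV_mult DERIV_ident)
      moreover have "1 * tau_poly (Suc m) (s / x) + (- ln (s / x)) ^ m / fact m * (- s / x\<^sup>2) * x = tau_poly m (s / x)"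
        using x by (simp add: tau_poly_Suc power2_eq_square field_simps)
      ultimately show ?thesis by simp
    qed
    \<comment> \<open>By the mean value theorem the increment of \<open>G\<close> is the length
      times an intermediate value of \<open>g\<close>, and \<open>g\<close> is decreasing.\<close>
    obtain z where z: "u < z" "z < v" "H v - H u = (v - u) * tau_poly m (s / z)"
      using MVT2[OF uv(2) dH] by auto
    have "g z = tau_poly m (s / z)" using z uv s by (simp add: g_def min_def field_simps)
    moreover have "G x = H x" if "s \<le> x" for x
      using that s by (auto simp: G_def H_def min_def field_simps)
    moreover have "g v \<le> g z" "g z \<le> g u" using z uv s by (auto intro!: anti)
    ultimately show ?thesis using z uv by (auto intro!: mult_left_mono)
  qed
  have "(v - u) * g v \<le> G v - G u \<and> G v - G u \<le> (v - u) * g u"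
  proof (cases "v \<le> s \<or> s \<le> u")
    case True
    then show ?thesis using A[of u v] uv g1 G1 by auto
  next
    case False
    \<comment> \<open>Here u < s < v: the interval is split at s, where the flat part of
      \<open>g\<close> ends.\<close>
    have "(v - u) * g v = (v - s) * g v + (s - u) * g v" by (simp add: algebra_simps)
    moreover have "(s - u) * g v \<le> (s - u) * 1"
      using False anti[of s v] g1[of s] s by (intro mult_left_mono) auto
    ultimately show ?thesis using A[of s v] False uv g1[of u] g1[of s] G1[of s] G1[of u] s
      by (auto simp: algebra_simps)
  qed
  then show "(v - u) * g v \<le> G v - G u" "G v - G u \<le> (v - u) * g u" by auto
qed

text \<open>\<open>A\<close> is the left Riemann sum over u in [0,1] of a decreasing function whose
  integral is \<open>tau_poly (Suc m) s\<close>. It therefore lies above the integral, by at most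
  1/n times the total drop. The summand 1 is the value at u = 0; as a constant clock it does not
  alter laws, but it provides the upper approximation that \<open>RI_tendsto\<close>
  demands.\<close>

lemma tau_poly_average:
  assumes m: "m \<ge> 1" and s: "0 < s" "s \<le> 1" and n: "n > 0"
  defines "A \<equiv> (1 + (\<Sum>j\<in>{1..<n}. tau_poly m (min (s / (real j / n)) 1))) / n"
  shows "tau_poly (Suc m) s \<le> A" "A \<le> tau_poly (Suc m) s + 1 / n"
proof -
  define g where "g u = (if u = 0 then 1 else tau_poly m (min (s / u) 1))" for u
  define G where "G u = (if u = 0 then 0 else u * tau_poly (Suc m) (min (s / u) 1))" for u
  have b: "1 / n * g (real (Suc j) / n) \<le> G (real (Suc j) / n) - G (real j / n)"
       "G (real (Suc j) / n) - G (real j / n) \<le> 1 / n * g (real j / n)" for j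
    using tau_poly_mean_bounds[OF m s(1), of "real j / n" "real (Suc j) / n"] n
    by (auto simp: g_def G_def divide_strict_right_mono diff_divide_distrib[symmetric])
  have "(\<Sum>j<n. G (real (Suc j) / n) - G (real j / n)) = G (real n / n) - G (real 0 / n)"
    by (rule sum_lessThan_telescope)
  also have "\<dots> = tau_poly (Suc m) s" using n s by (simp add: G_def min_def)
  finally have tel: "(\<Sum>j<n. G (real (Suc j) / n) - G (real j / n)) = tau_poly (Suc m) s" .
  have "(\<Sum>j<n. g (real j / n)) = 1 + (\<Sum>j\<in>{1..<n}. tau_poly m (min (s / (real j / n)) 1))"
  proof -
    have "(\<Sum>j<n. g (real j / n)) = g 0 + (\<Sum>j\<in>{1..<n}. g (real j / n))"
      using n by (subst sum.remove[of _ 0]) (auto intro!: sum.cong)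
    then show ?thesis by (auto simp: g_def intro!: sum.cong)
  qed
  then have A: "A = (\<Sum>j<n. 1 / n * g (real j / n))"
    unfolding A_def by (simp add: sum_divide_distrib[symmetric])
  show "tau_poly (Suc m) s \<le> A" unfolding tel[symmetric] A by (intro sum_mono b)
  have "(\<Sum>j<n. 1 / n * g (real (Suc j) / n)) \<le> tau_poly (Suc m) s"
    unfolding tel[symmetric] by (intro sum_mono b)
  moreover have "A - (\<Sum>j<n. 1 / n * g (real (Suc j) / n)) = 1 / n * g 0 - 1 / n * g (real n / n)"
    unfolding A by (subst sum_subtractf[symmetric]) (use sum_lessThan_telescope'[of "\<lambda>j. 1 / n * g (real j / n)" n] in simp)
  moreover have "0 \<le> 1 / n * g (real n / n)"
    using n clockD(1)[OF clock_tau_poly[OF m], of "min s 1" 1] s by (simp add: g_def)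
  moreover have "g 0 = 1" by (simp add: g_def)
  ultimately show "A \<le> tau_poly (Suc m) s + 1 / n" by simp
qed

section \<open>Dyadic grids and increments over their cells\<close>

definition dyadic_level :: "nat \<Rightarrow> real set" where
  "dyadic_level n = range (\<lambda>k::nat. real k / 2 ^ n)"

definition incr :: "nat \<Rightarrow> nat \<Rightarrow> (real \<Rightarrow> 'a::real_normed_vector) \<Rightarrow> 'a" where
  "incr n i f = f (real (Suc i) / 2 ^ n) - f (real i / 2 ^ n)"

lemma dyadic_level_mono: "n \<le> n' \<Longrightarrow> dyadic_level n \<subseteq> dyadic_level n'"
proof (rule lift_Suc_mono_le[of dyadic_level])
  show "dyadic_level n \<subseteq> dyadic_level (Suc n)" for n
  proof
    fix t assume "t \<in> dyadic_level n"
    then obtain k where "t = real k / 2 ^ n" by (auto simp: dyadic_level_def)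
    then have "t = real (2 * k) / 2 ^ Suc n" by simp
    then show "t \<in> dyadic_level (Suc n)" unfolding dyadic_level_def by blast
  qed
qed

section \<open>Oscillations of random walks\<close>

text \<open>Number of times the walk started at displacement \<open>d\<close> leaves the ball of radius \<open>\<eta>\<close>
  around its current reference point, which is then reset to the current position.\<close>

fun phases :: "real \<Rightarrow> nat \<Rightarrow> 'a::real_normed_vector \<Rightarrow> (nat \<Rightarrow> 'a) \<Rightarrow> nat" where
  "phases \<eta> 0 d w = 0"
| "phases \<eta> (Suc n) d w =
    (if norm (d + w 0) > \<eta> then Suc (phases \<eta> n 0 (\<lambda>i. w (Suc i))) else phases \<eta> n (d + w 0) (\<lambda>i. w (Suc i)))"

lemma phases_0_close:
  assumes "norm d \<le> \<eta>" "phases \<eta> j d w = 0"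
  shows "norm (d + (\<Sum>l<j. w l)) \<le> \<eta>"
  using assms
proof (induction j arbitrary: d w)
  case (Suc j)
  then have *: "norm (d + w 0) \<le> \<eta>" "phases \<eta> j (d + w 0) (\<lambda>i. w (Suc i)) = 0"
    by (auto split: if_splits)
  show ?case using Suc.IH[OF *] by (simp add: sum.lessThan_Suc_shift add.assoc del: sum.lessThan_Suc)
qed simp

text \<open>If no phase ends between two times, the walk at both times is within \<eta> of the same
  reference point.\<close>

lemma phases_mono_close:
  assumes "norm d \<le> \<eta>" "i \<le> j"
  shows "phases \<eta> i d w \<le> phases \<eta> j d w \<and>
    (phases \<eta> i d w = phases \<eta> j d w \<longrightarrow> norm ((\<Sum>l<j. w l) - (\<Sum>l<i. w l)) \<le> 2 * \<eta>)"
  using assms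
proof (induction i arbitrary: j d w)
  case 0
  have "norm (\<Sum>l<j. w l) \<le> 2 * \<eta>" if "phases \<eta> j d w = 0"
    using phases_0_close[OF 0(1) that] norm_triangle_ineq4[of "d + (\<Sum>l<j. w l)" d] 0(1) by simp
  then show ?case by auto
next
  case (Suc i)
  then obtain j' where j: "j = Suc j'" "i \<le> j'" by (cases j) auto
  have "0 \<le> \<eta>" using Suc.prems norm_ge_zero[of d] by linarith
  then show ?case
    using Suc.IH[of "d + w 0" j' "\<lambda>i. w (Suc i)"] Suc.IH[of 0 j' "\<lambda>i. w (Suc i)"] j
    by (auto simp: sum.lessThan_Suc_shift simp del: sum.lessThan_Suc)
qed

text \<open>A displacement exceeding the diameter \<open>2 * \<eta>\<close> of the ball forces the
  end of at least one phase.\<close>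

lemma phases_chain:
  fixes c :: "nat \<Rightarrow> nat"
  assumes \<eta>: "0 \<le> \<eta>" and c: "\<And>l. l \<le> k \<Longrightarrow> c l \<le> n" "\<And>l. l < k \<Longrightarrow> c l < c (Suc l)"
    "\<And>l. l < k \<Longrightarrow> norm ((\<Sum>i<c (Suc l). w i) - (\<Sum>i<c l. w i)) > 2 * \<eta>"
  shows "k \<le> phases \<eta> n 0 w"
proof -
  have "l \<le> k \<Longrightarrow> l \<le> phases \<eta> (c l) 0 w" for l
  proof (induction l)
    case (Suc l)
    then show ?case
      using phases_mono_close[of 0 \<eta> "c l" "c (Suc l)" w] c(2)[of l] c(3)[of l] \<eta> by fastforce
  qed simp
  from this[of k] show ?thesis
    using phases_mono_close[of 0 \<eta> "c k" n w] c(1)[of k] \<eta> by auto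
qed

lemma measurable_phases:
  fixes f :: "'x \<Rightarrow> 'a::{banach,second_countable_topology}"
  assumes "f \<in> borel_measurable X" "\<And>i. (\<lambda>x. g x i) \<in> borel_measurable X"
  shows "(\<lambda>x. phases \<eta> n (f x) (g x)) \<in> measurable X (count_space UNIV)"
  using assms
proof (induction n arbitrary: f g)
  case (Suc n)
  note [measurable] = Suc.prems
  have [measurable]: "(\<lambda>x. phases \<eta> n 0 (\<lambda>i. g x (Suc i))) \<in> measurable X (count_space UNIV)"
     "(\<lambda>x. phases \<eta> n (f x + g x 0) (\<lambda>i. g x (Suc i))) \<in> measurable X (count_space UNIV)"
    by (rule Suc.IH; measurable)+
  show ?case by simp
qed simp

locale random_walk = prob_space N for N :: "'a::{banach,second_countable_topology} measure" +
  assumes sets_N[measurable_cong]: "sets N = sets borel"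
begin

lemma space_N: "space N = UNIV"
  using sets_eq_imp_space_eq[OF sets_N] by simp

abbreviation "W \<equiv> \<Pi>\<^sub>M i\<in>(UNIV::nat set). N"

sublocale W: prob_space W
  by (rule prob_space_PiM) unfold_locales

lemma measurable_phases_W[measurable]: "Measurable.pred W (\<lambda>w. k \<le> phases \<eta> n d w)"
proof -
  have [measurable]: "(\<lambda>w. phases \<eta> n d w) \<in> measurable W (count_space UNIV)"
    by (rule measurable_phases) auto
  show ?thesis by simp
qed

text \<open>An i.i.d. sequence is an independent first term followed by a fresh copy of itself. All
  the recursions for walks below condition on this first step.\<close>

lemma first_step:
  assumes [measurable]: "Measurable.pred W R"
  shows "emeasure W {w\<in>space W. R w} = (\<integral>\<^sup>+z. emeasure W {w\<in>space W. R (case_nat z w)} \<partial>N)"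
proof -
  let ?c = "\<lambda>(z, w). case_nat z w" and ?R = "{w\<in>space W. R w}"
  let ?X = "?c -` ?R \<inter> space (N \<Otimes>\<^sub>M W)"
  interpret NW: pair_sigma_finite N W ..
  interpret N: sequence_space N by unfold_locales
  have c[measurable]: "?c \<in> measurable (N \<Otimes>\<^sub>M W) W"
    by measurable
  have "emeasure W ?R = emeasure (distr (N \<Otimes>\<^sub>M W) W ?c) ?R"
    using N.PiM_iter by simp
  also have "\<dots> = emeasure (N \<Otimes>\<^sub>M W) (?X)"
    by (rule emeasure_distr) measurable
  also have "\<dots> = (\<integral>\<^sup>+z. emeasure W (Pair z -` (?X)) \<partial>N)"
    by (rule W.emeasure_pair_measure_alt) measurable
  also have "\<dots> = (\<integral>\<^sup>+z. emeasure W {w\<in>space W. R (case_nat z w)} \<partial>N)"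
  proof (rule nn_integral_cong)
    fix z assume "z \<in> space N"
    have "Pair z -` (?X) = {w\<in>space W. R (case_nat z w)}"
      by (auto simp: space_pair_measure space_PiM space_N split: nat.split)
    then show "emeasure W (Pair z -` (?X)) = emeasure W {w\<in>space W. R (case_nat z w)}"
      by simp
  qed
  finally show ?thesis .
qed

definition E :: "real \<Rightarrow> nat \<Rightarrow> nat \<Rightarrow> 'a \<Rightarrow> ennreal" where
  "E \<eta> k n d = emeasure W {w\<in>space W. k \<le> phases \<eta> n d w}"

definition T :: "real \<Rightarrow> nat \<Rightarrow> 'a \<Rightarrow> ennreal" where
  "T \<eta> n d = emeasure W {w\<in>space W. norm (d + (\<Sum>i<n. w i)) > \<eta>}"

lemma measurable_E: "(\<lambda>z. E \<eta> k n (d + z)) \<in> borel_measurable N"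
proof -
  have "(\<lambda>x. phases \<eta> n (d + fst x) (snd x)) \<in> measurable (N \<Otimes>\<^sub>M W) (count_space UNIV)"
    by (rule measurable_phases) measurable
  then have "Measurable.pred (N \<Otimes>\<^sub>M W) (\<lambda>x. k \<le> phases \<eta> n (d + fst x) (snd x))"
    by measurable
  then have "{x\<in>space (N \<Otimes>\<^sub>M W). k \<le> phases \<eta> n (d + fst x) (snd x)} \<in> sets (N \<Otimes>\<^sub>M W)"
    by (simp add: pred_def)
  from W.measurable_emeasure_Pair[OF this]
  show ?thesis
    unfolding E_def by (rule measurable_cong[THEN iffD1, rotated])
      (auto intro!: arg_cong[where f = "emeasure W"] simp: space_pair_measure space_N)
qed

lemma E_0: "E \<eta> 0 n d = 1"
  by (simp add: E_def W.emeasure_space_1)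

lemma E_Suc: "E \<eta> (Suc k) (Suc n) d = (\<integral>\<^sup>+z. (if norm (d + z) > \<eta> then E \<eta> k n 0 else E \<eta> (Suc k) n (d + z)) \<partial>N)"
proof -
  have "E \<eta> (Suc k) (Suc n) d = (\<integral>\<^sup>+z. emeasure W {w\<in>space W. Suc k \<le> phases \<eta> (Suc n) d (case_nat z w)} \<partial>N)"
    unfolding E_def by (rule first_step) measurable
  also have "\<dots> = (\<integral>\<^sup>+z. (if norm (d + z) > \<eta> then E \<eta> k n 0 else E \<eta> (Suc k) n (d + z)) \<partial>N)"
    by (intro nn_integral_cong) (auto simp: E_def)
  finally show ?thesis .
qed

lemma E_Suc_cmult:
  "c * E \<eta> 1 (Suc n) d = (\<integral>\<^sup>+z. c * (if norm (d + z) > \<eta> then E \<eta> 0 n 0 else E \<eta> 1 n (d + z)) \<partial>N)"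
  unfolding One_nat_def E_Suc
  by (intro nn_integral_cmult[symmetric] measurable_If measurable_const measurable_E) measurable

lemma T_Suc: "T \<eta> (Suc n) d = (\<integral>\<^sup>+z. T \<eta> n (d + z) \<partial>N)"
proof -
  have "T \<eta> (Suc n) d = (\<integral>\<^sup>+z. emeasure W {w\<in>space W. norm (d + (\<Sum>i<Suc n. case_nat z w i)) > \<eta>} \<partial>N)"
    unfolding T_def by (rule first_step) measurable
  also have "\<dots> = (\<integral>\<^sup>+z. T \<eta> n (d + z) \<partial>N)"
    by (intro nn_integral_cong) (simp add: T_def sum.lessThan_Suc_shift add.assoc del: sum.lessThan_Suc)
  finally show ?thesis .
qed

text \<open>Ottaviani's maximal inequality: by the induction, it suffices to treat a walk that has just
  left the ball, and such a walk stays outside half the radius with probability at least \<open>b\<close>.\<close>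

lemma ottaviani:
  assumes "\<And>j. j \<le> n \<Longrightarrow> b \<le> emeasure W {w\<in>space W. norm (\<Sum>i<j. w i) \<le> \<eta> / 2}"
  shows "b * E \<eta> 1 n d \<le> T (\<eta> / 2) n d"
  using assms
proof (induction n arbitrary: d)
  case 0
  then show ?case by (simp add: E_def)
next
  case (Suc n)
  have far: "b \<le> T (\<eta> / 2) n (d + z)" if z: "\<eta> < norm (d + z)" for z
  proof -
    have "emeasure W {w\<in>space W. norm (\<Sum>i<n. w i) \<le> \<eta> / 2} \<le> T (\<eta> / 2) n (d + z)"
      unfolding T_def
    proof (rule emeasure_mono)
      show "{w\<in>space W. norm (\<Sum>i<n. w i) \<le> \<eta> / 2} \<subseteq> {w\<in>space W. norm (d + z + (\<Sum>i<n. w i)) > \<eta> / 2}"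
      proof safe
        fix w :: "nat \<Rightarrow> 'a" assume "norm (\<Sum>i<n. w i) \<le> \<eta> / 2"
        then show "norm (d + z + (\<Sum>i<n. w i)) > \<eta> / 2"
          using norm_diff_ineq[of "d + z" "\<Sum>i<n. w i"] z by simp
      qed
    qed measurable
    then show ?thesis using Suc.prems[of n] by simp
  qed
  have "b * E \<eta> 1 (Suc n) d = (\<integral>\<^sup>+z. b * (if norm (d + z) > \<eta> then E \<eta> 0 n 0 else E \<eta> 1 n (d + z)) \<partial>N)"
    by (rule E_Suc_cmult)
  also have "\<dots> \<le> (\<integral>\<^sup>+z. T (\<eta> / 2) n (d + z) \<partial>N)"
    using Suc.IH Suc.prems far by (intro nn_integral_mono) (auto simp: E_0)
  also have "\<dots> = T (\<eta> / 2) (Suc n) d" by (simp add: T_Suc)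
  finally show ?case .
qed

text \<open>When a phase ends, the walk restarts with displacement 0 and fewer steps, so each
  further phase costs a factor \<open>c\<close>. The first phase starts from an arbitrary
  \<open>d\<close>, hence its probability is kept as it stands.\<close>

lemma E_geometric:
  assumes "\<And>j. j \<le> n \<Longrightarrow> E \<eta> 1 j 0 \<le> c"
  shows "E \<eta> (Suc k) n d \<le> c ^ k * E \<eta> 1 n d"
  using assms
proof (induction n arbitrary: k d)
  case 0
  then show ?case by (simp add: E_def)
next
  case (Suc n)
  have IH: "E \<eta> (Suc k) n d \<le> c ^ k * E \<eta> 1 n d" for k d using Suc by auto
  have E0: "E \<eta> k n 0 \<le> c ^ k" for k
  proof (cases k)
    case (Suc k')
    have "E \<eta> (Suc k') n 0 \<le> c ^ k' * E \<eta> 1 n 0" by (rule IH)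
    also have "\<dots> \<le> c ^ k' * c" by (intro mult_left_mono Suc.prems) auto
    finally show ?thesis using Suc by (simp add: mult.commute)
  qed (simp add: E_0)
  have "E \<eta> (Suc k) (Suc n) d \<le> (\<integral>\<^sup>+z. c ^ k * (if norm (d + z) > \<eta> then E \<eta> 0 n 0 else E \<eta> 1 n (d + z)) \<partial>N)"
    unfolding E_Suc using IH E0 by (intro nn_integral_mono) (auto simp: E_0)
  also have "\<dots> = c ^ k * E \<eta> 1 (Suc n) d"
    by (rule E_Suc_cmult[symmetric])
  finally show ?case .
qed

text \<open>A tail of at most 1/3 makes the constant in Ottaviani's inequality 2/3, so a phase
  started at 0 ends with probability at most (1/3) / (2/3) = 1/2, and phases multiply.\<close>

lemma phases_bound:
  assumes tail: "\<And>j. j \<le> n \<Longrightarrow> measure W {w\<in>space W. norm (\<Sum>i<j. w i) > \<eta> / 2} \<le> 1 / 3"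
  shows "measure W {w\<in>space W. k \<le> phases \<eta> n 0 w} \<le> (1 / 2) ^ k"
proof -
  have lower: "ennreal (2 / 3) \<le> emeasure W {w\<in>space W. norm (\<Sum>i<j. w i) \<le> \<eta> / 2}" if "j \<le> n" for j
  proof -
    have "W.prob {w\<in>space W. \<not> norm (\<Sum>i<j. w i) > \<eta> / 2} = 1 - W.prob {w\<in>space W. norm (\<Sum>i<j. w i) > \<eta> / 2}"
      by (rule W.prob_neg) measurable
    then show ?thesis using tail[OF that] by (simp add: W.emeasure_eq_measure not_less)
  qed
  have one: "E \<eta> 1 j 0 \<le> ennreal (1 / 2)" if "j \<le> n" for j
  proof -
    have "ennreal (2 / 3) * E \<eta> 1 j 0 \<le> T (\<eta> / 2) j 0"
      by (rule ottaviani) (use that lower in auto)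
    also have "\<dots> \<le> ennreal (1 / 3)"
      unfolding T_def using tail[OF that] by (simp add: W.emeasure_eq_measure)
    finally have "W.prob {w\<in>space W. 1 \<le> phases \<eta> j 0 w} \<le> 1 / 2"
      unfolding E_def W.emeasure_eq_measure by (simp add: ennreal_mult'[symmetric] del: ennreal_1)
    then show ?thesis unfolding E_def W.emeasure_eq_measure by (rule ennreal_leI)
  qed
  have "E \<eta> k n 0 \<le> ennreal ((1 / 2) ^ k)"
  proof (cases k)
    case (Suc k')
    have "E \<eta> (Suc k') n 0 \<le> ennreal (1 / 2) ^ k' * E \<eta> 1 n 0"
      by (rule E_geometric[OF one])
    also have "\<dots> \<le> ennreal (1 / 2) ^ k' * ennreal (1 / 2)"
      by (intro mult_left_mono one) auto
    also have "\<dots> = ennreal ((1 / 2) ^ k)"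
      using Suc by (simp only: ennreal_power ennreal_mult'[symmetric] power_Suc2 zero_le_power)
    finally show ?thesis using Suc by simp
  qed (simp add: E_0)
  then show ?thesis unfolding E_def W.emeasure_eq_measure by simp
qed

end

section \<open>Processes with prescribed independent dyadic increments\<close>

lemma (in prob_space) cf_indep_sum:
  assumes ind: "indep_vars (\<lambda>_. borel) X K" and K: "finite K" and y: "bounded_linear y"
  shows "cf M (\<lambda>w. y (\<Sum>i\<in>K. X i w)) = (\<Prod>i\<in>K. cf M (\<lambda>w. y (X i w :: 'b::{banach,second_countable_topology})))"
proof -
  interpret y: bounded_linear y by fact
  have [measurable]: "y \<in> borel_measurable borel" by (rule bounded_linear_borel[OF y])
  have rv: "X i \<in> borel_measurable M" if "i \<in> K" for i using ind that by (auto simp: indep_vars_def)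
  have "indep_vars (\<lambda>_. borel) (\<lambda>i w. iexp (y (X i w))) K"
    by (rule indep_vars_compose2[OF ind]) auto
  then have "(CLINT w|M. (\<Prod>i\<in>K. iexp (y (X i w)))) = (\<Prod>i\<in>K. CLINT w|M. iexp (y (X i w)))"
    using K rv by (intro indep_vars_lebesgue_integral integrable_iexp') auto
  then show ?thesis using K by (simp add: cf_def y.sum sum_distrib_left exp_sum)
qed

lemma (in prob_space) indep_vars_group_sums:
  fixes X :: "'i \<Rightarrow> 'a \<Rightarrow> 'b::{banach,second_countable_topology}"
  assumes ind: "indep_vars (\<lambda>_. borel) X I" and K: "\<And>j. j \<in> J \<Longrightarrow> K j \<subseteq> I" and d: "disjoint_family_on K J"
  shows "indep_vars (\<lambda>_. borel) (\<lambda>j w. \<Sum>i\<in>K j. X i w) J"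
proof -
  have "indep_vars (\<lambda>_. borel) (\<lambda>j w. (\<lambda>f. \<Sum>i\<in>K j. f i) (restrict (\<lambda>i. X i w) (K j))) J"
    by (rule indep_vars_compose2[OF indep_vars_restrict[OF ind K d]]) auto
  then show ?thesis by simp
qed

lemma indep_vars_PiM_coordinates:
  assumes "\<And>i. prob_space (N i)" "\<And>i. sets (N i) = sets borel"
  shows "prob_space.indep_vars (PiM UNIV N) (\<lambda>_. borel) (\<lambda>i w. w i) UNIV"
proof -
  interpret prob_space "PiM UNIV N" by (rule prob_space_PiM) (rule assms)
  have m: "(\<lambda>w. w i) \<in> borel_measurable (PiM UNIV N)" for i
    using measurable_component_singleton[of i UNIV N] assms(2) by (simp cong: measurable_cong_sets)
  have d: "distr (PiM UNIV N) borel (\<lambda>w. w i) = N i" for i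
    using distr_PiM_component[of UNIV N i] assms by (simp cong: distr_cong)
  have "distr (PiM UNIV N) (PiM UNIV (\<lambda>_. borel)) (\<lambda>x. \<lambda>i\<in>UNIV. x i) = distr (PiM UNIV N) (PiM UNIV N) (\<lambda>x. x)"
    by (intro distr_cong sets_PiM_cong) (auto simp: assms)
  then show ?thesis
    by (subst indep_vars_iff_distr_eq_PiM) (auto simp: m d distr_id)
qed

text \<open>Consistency of successive dyadic levels: adding neighbouring increments of the finer
  level reproduces the coarser one.\<close>

lemma half_sequence_law:
  fixes N N' :: "'a::{banach,second_countable_topology} measure"
  assumes N: "prob_space N" "sets N = sets borel" and N': "prob_space N'" "sets N' = sets borel"
    and half: "\<And>y. bounded_linear y \<Longrightarrow> cf N' y ^ 2 = cf N y"
  shows "distr (\<Pi>\<^sub>M i\<in>(UNIV::nat set). N') seq_borel (\<lambda>w i. w (2 * i) + w (2 * i + 1)) = (\<Pi>\<^sub>M i\<in>(UNIV::nat set). N)"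
proof -
  let ?S = "\<Pi>\<^sub>M i\<in>(UNIV::nat set). N'"
  interpret prob_space ?S by (rule prob_space_PiM) (rule N')
  have ind: "indep_vars (\<lambda>_. borel) (\<lambda>i w. w i :: 'a) (UNIV::nat set)"
    using indep_vars_PiM_coordinates[of "\<lambda>_. N'"] N' by simp
  have m[measurable]: "(\<lambda>w. w i) \<in> borel_measurable ?S" for i
    using ind by (auto simp: indep_vars_def)
  have law: "distr ?S borel (\<lambda>w. w i) = N'" for i
    using distr_PiM_component[of UNIV "\<lambda>_. N'" i] N' by (simp cong: distr_cong)
  have grp: "indep_vars (\<lambda>_. borel) (\<lambda>i w. \<Sum>l\<in>{2 * i, 2 * i + 1}. w l :: 'a) (UNIV::nat set)"
  proof (rule indep_vars_group_sums[OF ind])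
    have "{2 * i, 2 * i + 1} \<inter> {2 * j, 2 * j + 1} = {}" if "i \<noteq> j" for i j :: nat
      using that by (auto; presburger)
    then show "disjoint_family (\<lambda>j::nat. {2 * j, 2 * j + 1})" by (simp add: disjoint_family_on_def)
  qed simp
  then have pr: "indep_vars (\<lambda>_. borel) (\<lambda>i w. w (2 * i) + w (2 * i + 1) :: 'a) (UNIV::nat set)"
    by simp
  have "distr ?S borel (\<lambda>w. w (2 * i) + w (2 * i + 1)) = N" for i
  proof (rule cf_unique[OF _ _ N])
    show "prob_space (distr ?S borel (\<lambda>w. w (2 * i) + w (2 * i + 1)))" by (rule prob_space_distr) simp
    fix y :: "'a \<Rightarrow> real" assume y: "bounded_linear y"
    have "cf ?S (\<lambda>w. y (\<Sum>l\<in>{2 * i, 2 * i + 1}. w l)) = (\<Prod>l\<in>{2 * i, 2 * i + 1}. cf ?S (\<lambda>w. y (w l)))"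
      by (rule cf_indep_sum[OF indep_vars_subset[OF ind] _ y]) auto
    moreover have "cf ?S (\<lambda>w. y (w l)) = cf N' y" for l
      using cf_distr[OF m y, of l] by (simp add: law)
    ultimately show "cf (distr ?S borel (\<lambda>w. w (2 * i) + w (2 * i + 1))) y = cf N y"
      using half[OF y] y by (simp add: cf_distr power2_eq_square)
  qed simp
  then show ?thesis
    using indep_vars_iff_distr_eq_PiM[THEN iffD1, OF _ _ pr] by (simp add: restrict_def)
qed

lemma restrict_vimage_prod_emb:
  assumes "J \<subseteq> A"
  shows "A \<subseteq> I \<Longrightarrow> (\<lambda>v. restrict v A) -` prod_emb A (\<lambda>_. borel) J X \<inter> space (PiM I (\<lambda>_. borel :: 'b::topological_space measure)) = prod_emb I (\<lambda>_. borel) J X"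
    and "(\<lambda>w. \<lambda>p\<in>A. h w p) -` prod_emb A (\<lambda>_. borel :: 'b::topological_space measure) J X = (\<lambda>w. \<lambda>p\<in>J. h w p) -` X"
  using assms by (auto simp: prod_emb_def space_PiM Int_absorb1)

text \<open>The extension theorem is applied to real variables indexed by a dyadic time and a
  coordinate number; \<open>G\<close> reassembles the coordinates into a vector. The result is
  pushed to \<open>real \<Rightarrow> 'a\<close>, the sample space fixed in
  \<open>is_law_rint\<close>.\<close>

lemma dyadic_process_exists:
  fixes \<kappa> :: "nat \<Rightarrow> 'a::{banach,second_countable_topology} measure"
  assumes \<kappa>: "\<And>n. prob_space (\<kappa> n)" "\<And>n. sets (\<kappa> n) = sets borel"
    and half: "\<And>n y. bounded_linear y \<Longrightarrow> cf (\<kappa> (Suc n)) y ^ 2 = cf (\<kappa> n) y"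
  obtains Q :: "(real \<Rightarrow> 'a) measure" where "prob_space Q" "sets Q = sets (\<Pi>\<^sub>M t\<in>UNIV. borel)"
    "\<And>n. distr Q seq_borel (\<lambda>f i. incr n i f) = (\<Pi>\<^sub>M i\<in>UNIV. \<kappa> n)"
proof -
  obtain y :: "nat \<Rightarrow> 'a \<Rightarrow> real" and G where y: "\<And>i. bounded_linear (y i)"
    and G[measurable]: "G \<in> measurable seq_borel borel" and Gy: "\<And>x. G (\<lambda>i. y i x) = x"
    using separable_coordinates by blast
  have [measurable]: "y i \<in> borel_measurable borel" for i by (rule bounded_linear_borel[OF y])
  define S where "S n = (\<Pi>\<^sub>M i\<in>(UNIV::nat set). \<kappa> n)" for n
  have S: "prob_space (S n)" for n unfolding S_def by (rule prob_space_PiM) (rule \<kappa>)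
  have Ssets[measurable_cong]: "sets (S n) = sets seq_borel" for n
    unfolding S_def by (rule sets_PiM_cong) (simp_all add: \<kappa>)
  \<comment> \<open>The path with level-n increments \<open>w\<close> and value 0 at time 0; only
    its values at times of level n matter.\<close>
  define psum where "psum n w t = (\<Sum>l<nat \<lfloor>t * 2 ^ n\<rfloor>. w l)" for n and t :: real and w :: "nat \<Rightarrow> 'a"
  have psum_level: "psum n w (real k / 2 ^ n) = (\<Sum>l<k. w l)" for n k w
    by (simp add: psum_def)
  have [measurable]: "(\<lambda>w. psum n w t) \<in> borel_measurable (S m)" for n t m
    unfolding psum_def by measurable
  define V where "V n w p = y (snd p) (psum n w (fst p))" for n w and p :: "real \<times> nat"
  have V[measurable]: "(\<lambda>w. V n w p) \<in> borel_measurable (S m)" for n p m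
    unfolding V_def by measurable
  define D where "D = (\<Union>n. dyadic_level n)"
  define L where "L J n = distr (S n) (\<Pi>\<^sub>M p\<in>J. borel) (\<lambda>w. \<lambda>p\<in>J. V n w p)" for J n
  have L_Suc: "L J (Suc n) = L J n" if J: "fst ` J \<subseteq> dyadic_level n" for J n
  proof -
    let ?h = "\<lambda>w i::nat. w (2 * i) + w (2 * i + 1) :: 'a"
    have hm: "?h \<in> measurable (S (Suc n)) seq_borel"
      by (rule measurable_PiM_UNIV) measurable
    have d: "S n = distr (S (Suc n)) seq_borel ?h"
      unfolding S_def by (rule half_sequence_law[symmetric]) (simp_all add: \<kappa> half)
    have eq: "V n (?h w) p = V (Suc n) w p" if "p \<in> J" for w p
    proof -
      have "fst p \<in> dyadic_level n" using J that by auto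
      then obtain k where k: "fst p = real k / 2 ^ n" by (auto simp: dyadic_level_def)
      then have k': "fst p = real (2 * k) / 2 ^ Suc n" by simp
      have "(\<Sum>l<k. ?h w l) = (\<Sum>l<2 * k. w l)" by (induction k) (auto simp: algebra_simps)
      then show ?thesis unfolding V_def k by (subst (2) k'[unfolded k]) (simp only: psum_level)
    qed
    have m: "(\<lambda>w. \<lambda>p\<in>J. V n w p) \<in> measurable seq_borel (\<Pi>\<^sub>M p\<in>J. borel)"
      using V[of n _ n] by (intro measurable_restrict) (simp cong: measurable_cong_sets add: Ssets)
    have "L J n = distr (distr (S (Suc n)) seq_borel ?h) (\<Pi>\<^sub>M p\<in>J. borel) (\<lambda>w. \<lambda>p\<in>J. V n w p)"
      unfolding L_def d[symmetric] ..
    also have "\<dots> = L J (Suc n)"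
      unfolding L_def by (subst distr_distr[OF m hm]) (intro distr_cong refl, auto simp: o_def eq[simplified] restrict_def)
    finally show ?thesis by simp
  qed
  have L_const: "L J n' = L J n" if J: "fst ` J \<subseteq> dyadic_level n" and "n \<le> n'" for J n n'
    using that(2)
  proof (induction n' rule: dec_induct)
    case (step n')
    then show ?case using L_Suc[of J n'] J dyadic_level_mono[of n n'] by auto
  qed simp
  have lev_ex: "\<exists>n. fst ` J \<subseteq> dyadic_level n" if "finite J" "J \<subseteq> D \<times> UNIV" for J :: "(real \<times> nat) set"
    using that
  proof (induction J rule: finite_induct)
    case (insert p J)
    then obtain n where n: "fst ` J \<subseteq> dyadic_level n" by auto
    from insert obtain n' where "fst p \<in> dyadic_level n'" by (auto simp: D_def)
    then have "fst ` insert p J \<subseteq> dyadic_level (max n n')"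
      using n dyadic_level_mono[of n "max n n'"] dyadic_level_mono[of n' "max n n'"] by auto
    then show ?case by blast
  qed auto
  \<comment> \<open>A finite set of indices lives on some common level. By \<open>L_const\<close>
    all higher levels give the same law, so the least level is a consistent choice.\<close>
  define lev where "lev J = (LEAST n. fst ` J \<subseteq> dyadic_level n)" for J :: "(real \<times> nat) set"
  define P where "P J = L J (lev J)" for J
  have P_eq: "P J = L J n" if "fst ` J \<subseteq> dyadic_level n" for J n
  proof -
    have "fst ` J \<subseteq> dyadic_level (lev J)" unfolding lev_def using that by (rule LeastI)
    moreover have "lev J \<le> n" unfolding lev_def using that by (rule Least_le)
    ultimately show ?thesis unfolding P_def using L_const[of J "lev J" n] by simp
  qed
  interpret P: polish_projective "D \<times> (UNIV::nat set)" P
  proof (intro polish_projective.intro projective_family.intro)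
    fix J H :: "(real \<times> nat) set"
    assume JH: "J \<subseteq> H" and H: "finite H" "H \<subseteq> D \<times> UNIV"
    obtain n where n: "fst ` H \<subseteq> dyadic_level n" using lev_ex[OF H] by blast
    then have n': "fst ` J \<subseteq> dyadic_level n" using JH by auto
    have m1: "(\<lambda>w. \<lambda>p\<in>H. V n w p) \<in> measurable (S n) (\<Pi>\<^sub>M p\<in>H. borel)"
      by (intro measurable_restrict) simp
    have "L J n = distr (L H n) (\<Pi>\<^sub>M p\<in>J. borel) (\<lambda>f. restrict f J)"
      unfolding L_def distr_distr[OF measurable_restrict_subset[OF JH] m1]
      by (intro distr_cong refl) (use JH in \<open>auto simp: restrict_def fun_eq_iff\<close>)
    then show "P J = distr (P H) (\<Pi>\<^sub>M p\<in>J. borel) (\<lambda>f. restrict f J)"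
      using P_eq[OF n] P_eq[OF n'] by simp
  next
    fix J :: "(real \<times> nat) set" assume "finite J" "J \<subseteq> D \<times> UNIV"
    show "prob_space (P J)"
      unfolding P_def L_def by (rule prob_space.prob_space_distr[OF S]) (auto intro!: measurable_restrict)
  qed
  let ?I = "D \<times> (UNIV::nat set)"
  define X where "X v t = G (\<lambda>k. v (t, k))" for v :: "real \<times> nat \<Rightarrow> real" and t :: real
  have Xm: "(\<lambda>v. X v t) \<in> borel_measurable (\<Pi>\<^sub>M p\<in>A \<times> UNIV. borel)" if "t \<in> A" for t A
    unfolding X_def
    by (rule measurable_compose[OF measurable_PiM_UNIV G], rule measurable_component_singleton) (use that in simp)
  have lim_sets[measurable_cong]: "sets P.lim = sets (\<Pi>\<^sub>M p\<in>?I. borel)" by simp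
  \<comment> \<open>Times outside \<open>D\<close> carry no information, and the regularization
    reads only dyadic times, so a fixed value will do there.\<close>
  define pth where "pth v t = (if t \<in> D then X v t else 0)" for v t
  have pth: "pth \<in> measurable P.lim (\<Pi>\<^sub>M t\<in>UNIV. borel)"
    unfolding pth_def[abs_def]
  proof (rule measurable_PiM_UNIV)
    show "(\<lambda>v. if t \<in> D then X v t else 0) \<in> borel_measurable P.lim" for t
      using Xm[of t D] by (cases "t \<in> D") (simp_all cong: measurable_cong_sets)
  qed
  define Q where "Q = distr P.lim (\<Pi>\<^sub>M t\<in>UNIV. borel) pth"
  show ?thesis
  proof (rule that)
    show "prob_space Q" unfolding Q_def by (rule P.P.prob_space_distr[OF pth])
    show "sets Q = sets (\<Pi>\<^sub>M t\<in>UNIV. borel)" by (simp add: Q_def)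
    fix n
    let ?A = "dyadic_level n \<times> (UNIV::nat set)"
    have AI: "?A \<subseteq> ?I" by (auto simp: D_def)
    have r1: "(\<lambda>v. restrict v ?A) \<in> measurable P.lim (\<Pi>\<^sub>M p\<in>?A. borel)"
      using measurable_restrict_subset[OF AI, of "\<lambda>_. borel"] by (simp cong: measurable_cong_sets)
    have r2: "(\<lambda>w. \<lambda>p\<in>?A. V n w p) \<in> measurable (S n) (\<Pi>\<^sub>M p\<in>?A. borel)"
      by (auto intro!: measurable_restrict)
    let ?V = "\<lambda>w. \<lambda>p\<in>?A. V n w p"
    let ?l = "distr P.lim (\<Pi>\<^sub>M p\<in>?A. borel) (\<lambda>v. restrict v ?A)" and ?r = "distr (S n) (\<Pi>\<^sub>M p\<in>?A. borel) ?V"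
    \<comment> \<open>The infinitely many coordinates at times of level n have jointly the law built
      from independent level-n increments; finite cylinders suffice to see this.\<close>
    have rest: "?l = ?r"
    proof (rule measure_eqI_PiM_infinite[where I = ?A and M = "\<lambda>_. borel"])
      show "finite_measure (?l)"
        by (rule prob_space.finite_measure[OF P.P.prob_space_distr[OF r1]])
      fix B :: "real \<times> nat \<Rightarrow> real set" and J
      assume J: "finite J" "J \<subseteq> ?A" and B: "\<And>i. i \<in> J \<Longrightarrow> B i \<in> sets borel"
      let ?e = "prod_emb ?A (\<lambda>_. borel :: real measure) J (Pi\<^sub>E J B)"
      have JI: "J \<subseteq> ?I" using J AI by blast
      have BS: "Pi\<^sub>E J B \<in> sets (\<Pi>\<^sub>M p\<in>J. borel)" using J B by (auto intro!: sets_PiM_I_finite)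
      have emS: "?e \<in> sets (\<Pi>\<^sub>M p\<in>?A. borel)"
        using J B by (intro sets_PiM_I) auto
      have "(\<lambda>v. restrict v ?A) -` ?e \<inter> space P.lim = P.emb ?I J (Pi\<^sub>E J B)"
        using restrict_vimage_prod_emb(1)[OF J(2) AI] by simp
      then have "emeasure (?l) (?e)
        = emeasure (P J) (Pi\<^sub>E J B)"
        using P.emeasure_lim_emb[OF JI J(1) BS] by (simp add: emeasure_distr[OF r1 emS])
      also have "P J = L J n" by (rule P_eq) (use J in auto)
      also have "emeasure (L J n) (Pi\<^sub>E J B) = emeasure (S n) ((\<lambda>w. \<lambda>p\<in>J. V n w p) -` Pi\<^sub>E J B \<inter> space (S n))"
        unfolding L_def by (rule emeasure_distr[OF _ BS]) (auto intro!: measurable_restrict)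
      also have "(\<lambda>w. \<lambda>p\<in>J. V n w p) -` Pi\<^sub>E J B \<inter> space (S n)
          = ?V -` ?e \<inter> space (S n)"
        by (simp only: restrict_vimage_prod_emb(2)[OF J(2)])
      finally show "emeasure (?l) (?e)
        = emeasure (?r) (?e)"
        unfolding emeasure_distr[OF r2 emS] .
    qed auto
    define H where "H u i = X u (real (Suc i) / 2 ^ n) - X u (real i / 2 ^ n)" for u and i :: nat
    have lv: "real i / 2 ^ n \<in> dyadic_level n" for i by (auto simp: dyadic_level_def)
    have H: "H \<in> measurable (\<Pi>\<^sub>M p\<in>?A. borel) seq_borel"
      unfolding H_def[abs_def] by (intro measurable_PiM_UNIV borel_measurable_diff Xm lv)
    have inc: "(\<lambda>f i. incr n i f :: 'a) \<in> measurable (\<Pi>\<^sub>M t\<in>UNIV. borel) seq_borel"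
      unfolding incr_def by (rule measurable_PiM_UNIV) measurable
    have "distr Q seq_borel (\<lambda>f i. incr n i f)
      = distr P.lim seq_borel (\<lambda>v. H (restrict v ?A))"
      unfolding Q_def
    proof (subst distr_distr[OF inc pth], rule distr_cong)
      fix v
      have "real i / 2 ^ n \<in> D" for i using lv by (auto simp: D_def)
      then show "((\<lambda>f i. incr n i f) \<circ> pth) v = H (restrict v ?A)"
        using lv by (simp add: fun_eq_iff incr_def H_def pth_def X_def del: of_nat_Suc)
    qed auto
    also have "\<dots> = distr (?l) seq_borel H"
      by (subst distr_distr[OF H r1]) (simp add: o_def)
    also have "\<dots> = distr (S n) seq_borel (\<lambda>w. H (\<lambda>p\<in>?A. V n w p))"
      unfolding rest by (subst distr_distr[OF H r2]) (simp add: o_def)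
    also have "\<dots> = distr (S n) (S n) (\<lambda>w. w)"
    proof (rule distr_cong)
      fix w
      \<comment> \<open>At a time of level n the entries of \<open>V\<close> are the coordinates of
        an actual vector, the partial sum, so \<open>G\<close> inverts them exactly and differences
        give back \<open>w\<close>.\<close>
      have "X (\<lambda>p\<in>?A. V n w p) (real i / 2 ^ n) = (\<Sum>l<i. w l)" for i
        using lv[of i] Gy by (simp add: X_def V_def psum_level)
      then show "H (\<lambda>p\<in>?A. V n w p) = w" by (simp add: fun_eq_iff H_def del: of_nat_Suc)
    qed (simp_all add: Ssets)
    finally show "distr Q seq_borel (\<lambda>f i. incr n i f) = (\<Pi>\<^sub>M i\<in>UNIV. \<kappa> n)"
      by (simp add: distr_id S_def)
  qed
qed

section \<open>Regularization of dyadic paths\<close>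

definition dyadics :: "real set" where
  "dyadics = (\<Union>n. dyadic_level n)"

definition dyadic_block :: "nat \<Rightarrow> nat \<Rightarrow> real set" where
  "dyadic_block p b = dyadics \<inter> {real b / 2 ^ p..real (Suc b) / 2 ^ p}"

text \<open>The counterpart for paths of \<open>phases\<close>: successive moves larger than
  \<epsilon>. A bound on the length of such chains for every \<epsilon> is what forces one-sided
  limits.\<close>

definition is_chain :: "(real \<Rightarrow> 'a::real_normed_vector) \<Rightarrow> real \<Rightarrow> nat \<Rightarrow> (nat \<Rightarrow> real) \<Rightarrow> bool" where
  "is_chain f \<epsilon> k c \<longleftrightarrow> (\<forall>l<k. c l < c (Suc l) \<and> norm (f (c (Suc l)) - f (c l)) > \<epsilon>)"

definition has_chain :: "(real \<Rightarrow> 'a::real_normed_vector) \<Rightarrow> real set \<Rightarrow> real \<Rightarrow> nat \<Rightarrow> bool" where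
  "has_chain f A \<epsilon> k \<longleftrightarrow> (\<exists>c. (\<forall>l\<le>k. c l \<in> A) \<and> is_chain f \<epsilon> k c)"

lemma has_chain_mono: "has_chain f A \<epsilon> k \<Longrightarrow> A \<subseteq> B \<Longrightarrow> \<epsilon>' \<le> \<epsilon> \<Longrightarrow> has_chain f B \<epsilon>' k"
  unfolding has_chain_def is_chain_def by (meson le_less_trans subsetD)

text \<open>Two values more than \<open>2 * \<epsilon>\<close> apart cannot both be within
  \<epsilon> of the first value of the chain, so one of the two times can be put in front of
  it.\<close>

lemma extend_chain:
  fixes f :: "real \<Rightarrow> 'a::real_normed_vector"
  assumes pair: "s \<in> A" "s' \<in> A" "s < s'" "norm (f s' - f s) > 2 * \<epsilon>"
    and c: "\<forall>l\<le>k. c l \<in> A" "is_chain f \<epsilon> k c" and "s' < c 0"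
  shows "\<exists>c'. c' 0 \<in> {s, s'} \<and> (\<forall>l\<le>Suc k. c' l \<in> A) \<and> is_chain f \<epsilon> (Suc k) c'"
proof -
  have "f s' - f s = (f (c 0) - f s) - (f (c 0) - f s')" by simp
  then have "norm (f s' - f s) \<le> norm (f (c 0) - f s) + norm (f (c 0) - f s')"
    by (metis norm_triangle_ineq4)
  then have "\<epsilon> < norm (f (c 0) - f s) \<or> \<epsilon> < norm (f (c 0) - f s')" using pair by linarith
  then obtain u where u: "u \<in> {s, s'}" "norm (f (c 0) - f u) > \<epsilon>" by blast
  show ?thesis
  proof (intro exI[of _ "case_nat u c"] conjI allI impI)
    show "case_nat u c 0 \<in> {s, s'}" using u by simp
    have u': "u \<in> A" "u < c 0" using u pair \<open>s' < c 0\<close> by auto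
    show "l \<le> Suc k \<Longrightarrow> case_nat u c l \<in> A" for l using u' c(1) by (cases l) auto
    show "is_chain f \<epsilon> (Suc k) (case_nat u c)"
      using u u' c(2) by (auto simp: is_chain_def split: nat.split)
  qed
qed

definition osc_le :: "('b::linorder \<Rightarrow> 'a::real_normed_vector) \<Rightarrow> 'b set \<Rightarrow> real \<Rightarrow> bool" where
  "osc_le f A e \<longleftrightarrow> (\<forall>s\<in>A. \<forall>s'\<in>A. s < s' \<longrightarrow> norm (f s' - f s) \<le> e)"

text \<open>If oscillations above \<open>2 * \<epsilon>\<close> persisted arbitrarily close to t,
  such a pair could always be found between t and the first time of a chain, and chains would grow
  without bound.\<close>

lemma chain_free_right:
  assumes free: "\<not> has_chain f (D \<inter> {t<..<t + \<delta>}) \<epsilon> k" and \<delta>: "0 < \<delta>"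
  shows "\<exists>d>0. osc_le f (D \<inter> {t<..<t + d}) (2 * \<epsilon>)"
proof (rule ccontr)
  assume "\<not> ?thesis"
  then have pairs: "\<exists>s\<in>D. \<exists>s'\<in>D. t < s \<and> s < s' \<and> s' < t + d \<and> norm (f s' - f s) > 2 * \<epsilon>" if "d > 0" for d
    using that by (fastforce simp: osc_le_def not_le)
  have "has_chain f (D \<inter> {t<..<t + \<delta>}) \<epsilon> k"
  proof (induction k)
    case 0
    from pairs[OF \<delta>] obtain s where "s \<in> D \<inter> {t<..<t + \<delta>}" by force
    then show ?case unfolding has_chain_def is_chain_def by (intro exI[of _ "\<lambda>_. s"]) auto
  next
    case (Suc k)
    then obtain c where c: "\<forall>l\<le>k. c l \<in> D \<inter> {t<..<t + \<delta>}" "is_chain f \<epsilon> k c"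
      by (auto simp: has_chain_def)
    from c(1) have c0: "t < c 0" "c 0 < t + \<delta>" by auto
    then obtain s s' where "s \<in> D" "s' \<in> D" "t < s" "s < s'" "s' < c 0" "norm (f s' - f s) > 2 * \<epsilon>"
      using pairs[of "c 0 - t"] by auto
    with extend_chain[where s = s and s' = s' and A = "D \<inter> {t<..<t + \<delta>}" and f = f and \<epsilon> = \<epsilon> and k = k and c = c] c c0
    show ?case unfolding has_chain_def by auto
  qed
  with free show False by simp
qed

text \<open>Chains grow only at their front, whereas the oscillations now accumulate behind it. The
  induction is therefore over all \<open>d\<close>: a pair is chosen first, and the shorter chain is
  taken between this pair and t.\<close>

lemma chain_free_left:
  assumes free: "\<not> has_chain f (D \<inter> {t - \<delta><..<t}) \<epsilon> k" and \<delta>: "0 < \<delta>"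
  shows "\<exists>d>0. osc_le f (D \<inter> {t - d<..<t}) (2 * \<epsilon>)"
proof (rule ccontr)
  assume "\<not> ?thesis"
  then have pairs: "\<exists>s\<in>D. \<exists>s'\<in>D. t - d < s \<and> s < s' \<and> s' < t \<and> norm (f s' - f s) > 2 * \<epsilon>" if "d > 0" for d
    using that by (fastforce simp: osc_le_def not_le)
  have "d > 0 \<Longrightarrow> has_chain f (D \<inter> {t - d<..<t}) \<epsilon> k" for d
  proof (induction k arbitrary: d)
    case 0
    from pairs[OF 0] obtain s where "s \<in> D \<inter> {t - d<..<t}" by force
    then show ?case unfolding has_chain_def is_chain_def by (intro exI[of _ "\<lambda>_. s"]) auto
  next
    case (Suc k)
    then obtain s s' where s: "s \<in> D" "s' \<in> D" "t - d < s" "s < s'" "s' < t" "norm (f s' - f s) > 2 * \<epsilon>"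
      using pairs[of d] by auto
    have "has_chain f (D \<inter> {t - (t - s')<..<t}) \<epsilon> k" by (rule Suc.IH) (use s in simp)
    then obtain c where c: "\<forall>l\<le>k. c l \<in> D \<inter> {s'<..<t}" "is_chain f \<epsilon> k c"
      by (auto simp: has_chain_def)
    from c(1) have "s' < c 0" by auto
    moreover have "\<forall>l\<le>k. c l \<in> D \<inter> {t - d<..<t}" using c(1) s by auto
    ultimately show ?case using extend_chain[where s = s and s' = s' and A = "D \<inter> {t - d<..<t}" and f = f and \<epsilon> = \<epsilon> and k = k and c = c] c(2) s
      unfolding has_chain_def by auto
  qed
  with free \<delta> show False by simp
qed

text \<open>Adding 1 to the floor keeps the point strictly to the right of t even when t is dyadic,
  so that the limit along these points is a right limit.\<close>

definition dyadic_above :: "nat \<Rightarrow> real \<Rightarrow> real" where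
  "dyadic_above j t = (of_int \<lfloor>t * 2 ^ j\<rfloor> + 1) / 2 ^ j"

lemma dyadic_above:
  shows "t < dyadic_above j t" "dyadic_above j t \<le> t + 1 / 2 ^ j"
    and "0 \<le> t \<Longrightarrow> dyadic_above j t = real (nat \<lfloor>t * 2 ^ j\<rfloor> + 1) / 2 ^ j"
    and "0 \<le> t \<Longrightarrow> dyadic_above j t \<in> dyadic_level j"
    and "s \<le> t \<Longrightarrow> dyadic_above j s \<le> dyadic_above j t"
proof -
  have "t * 2 ^ j < of_int \<lfloor>t * 2 ^ j\<rfloor> + 1" "of_int \<lfloor>t * 2 ^ j\<rfloor> \<le> t * 2 ^ j" by linarith+
  then show "t < dyadic_above j t" "dyadic_above j t \<le> t + 1 / 2 ^ j"
    by (simp_all add: dyadic_above_def field_simps)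
  show *: "0 \<le> t \<Longrightarrow> dyadic_above j t = real (nat \<lfloor>t * 2 ^ j\<rfloor> + 1) / 2 ^ j"
    by (simp add: dyadic_above_def)
  show "0 \<le> t \<Longrightarrow> dyadic_above j t \<in> dyadic_level j"
    using * unfolding dyadic_level_def by blast
  show "s \<le> t \<Longrightarrow> dyadic_above j s \<le> dyadic_above j t"
    by (simp add: dyadic_above_def divide_right_mono floor_mono mult_right_mono)
qed

lemma dyadic_above_tendsto: "(\<lambda>j. dyadic_above j t) \<longlonglongrightarrow> t"
proof (rule tendsto_sandwich[of "\<lambda>_. t" _ _ "\<lambda>j. t + 1 / 2 ^ j"])
  have "(\<lambda>j. t + 1 / 2 ^ j) \<longlonglongrightarrow> t + 0"
    by (intro tendsto_add tendsto_const) (simp add: LIMSEQ_divide_realpow_zero)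
  then show "(\<lambda>j. t + 1 / 2 ^ j) \<longlonglongrightarrow> t" by simp
qed (use dyadic_above in \<open>auto intro!: always_eventually less_imp_le\<close>)

text \<open>The block length may depend on \<epsilon> because small tails are available only over
  short times, and the chain length may depend on the block.\<close>

definition chain_bounded :: "(real \<Rightarrow> 'a::real_normed_vector) \<Rightarrow> bool" where
  "chain_bounded f \<longleftrightarrow> (\<forall>\<epsilon>>0. \<exists>p. \<forall>b. \<exists>k. \<not> has_chain f (dyadic_block p b) \<epsilon> k)"

definition regularize :: "(real \<Rightarrow> 'a::real_normed_vector) \<Rightarrow> real \<Rightarrow> 'a" where
  "regularize f t = lim (\<lambda>j. f (dyadic_above j t))"

lemma chain_bounded_osc:
  assumes f: "chain_bounded f" and \<epsilon>: "0 < \<epsilon>"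
  shows "0 \<le> t \<Longrightarrow> \<exists>d>0. osc_le f (dyadics \<inter> {t<..<t + d}) \<epsilon>"
    and "0 < t \<Longrightarrow> \<exists>d>0. osc_le f (dyadics \<inter> {t - d<..<t}) \<epsilon>"
proof -
  obtain p where p: "\<And>b. \<exists>k. \<not> has_chain f (dyadic_block p b) (\<epsilon> / 2) k"
    using f \<epsilon> unfolding chain_bounded_def by (meson half_gt_zero)
  show "\<exists>d>0. osc_le f (dyadics \<inter> {t<..<t + d}) \<epsilon>" if t: "0 \<le> t"
  proof -
    define b where "b = nat \<lfloor>t * 2 ^ p\<rfloor>"
    have b: "real b = of_int \<lfloor>t * 2 ^ p\<rfloor>" using t by (simp add: b_def)
    have "real b \<le> t * 2 ^ p" "t * 2 ^ p < real (Suc b)" unfolding of_nat_Suc b by linarith+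
    then have tb: "real b / 2 ^ p \<le> t" "t < real (Suc b) / 2 ^ p" by (simp_all add: field_simps)
    obtain k where "\<not> has_chain f (dyadic_block p b) (\<epsilon> / 2) k" using p by blast
    then have "\<not> has_chain f (dyadics \<inter> {t<..<t + (real (Suc b) / 2 ^ p - t)}) (\<epsilon> / 2) k"
      using tb by (auto simp: dyadic_block_def elim!: contrapos_nn has_chain_mono)
    from chain_free_right[OF this] tb show ?thesis by simp
  qed
  show "\<exists>d>0. osc_le f (dyadics \<inter> {t - d<..<t}) \<epsilon>" if t: "0 < t"
  proof -
    \<comment> \<open>The ceiling minus 1 selects the block that contains a left neighbourhood of t;
      for a dyadic t of level p this is the block ending at t.\<close>
    define b where "b = nat (\<lceil>t * 2 ^ p\<rceil> - 1)"
    have "0 < t * 2 ^ p" using t by simp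
    then have "1 \<le> \<lceil>t * 2 ^ p\<rceil>" by linarith
    then have b: "real b = of_int \<lceil>t * 2 ^ p\<rceil> - 1" by (simp add: b_def)
    have "real b < t * 2 ^ p" "t * 2 ^ p \<le> real (Suc b)" unfolding of_nat_Suc b by linarith+
    then have tb: "real b / 2 ^ p < t" "t \<le> real (Suc b) / 2 ^ p" by (simp_all add: field_simps)
    obtain k where "\<not> has_chain f (dyadic_block p b) (\<epsilon> / 2) k" using p by blast
    then have "\<not> has_chain f (dyadics \<inter> {t - (t - real b / 2 ^ p)<..<t}) (\<epsilon> / 2) k"
      using tb by (auto simp: dyadic_block_def elim!: contrapos_nn has_chain_mono)
    from chain_free_left[OF this] tb show ?thesis by simp
  qed
qed

text \<open>The Cauchy criterion, with \<open>U d\<close> standing for a dyadic neighbourhood to the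
  right or to the left of a time.\<close>

lemma limit_of_small_osc:
  fixes f :: "'b::linorder \<Rightarrow> 'a::banach" and U :: "real \<Rightarrow> 'b set"
  assumes osc: "\<And>\<epsilon>. 0 < \<epsilon> \<Longrightarrow> \<exists>d>0. osc_le f (U d) \<epsilon>"
    and p: "\<And>d. 0 < d \<Longrightarrow> \<forall>\<^sub>F j in sequentially. p j \<in> U d"
  shows "(\<lambda>j. f (p j)) \<longlonglongrightarrow> lim (\<lambda>j. f (p j))"
    and "0 < \<epsilon> \<Longrightarrow> \<exists>d>0. \<forall>s\<in>U d. norm (f s - lim (\<lambda>j. f (p j))) \<le> \<epsilon>"
proof -
  have osc': "\<exists>d>0. \<forall>s\<in>U d. \<forall>s'\<in>U d. norm (f s' - f s) \<le> \<epsilon>" if \<epsilon>: "0 < \<epsilon>" for \<epsilon>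
  proof -
    obtain d where d: "d > 0" "osc_le f (U d) \<epsilon>" using osc[OF \<epsilon>] by blast
    have "norm (f s' - f s) \<le> \<epsilon>" if "s \<in> U d" "s' \<in> U d" for s s'
      using d(2) that \<epsilon> by (cases s s' rule: linorder_cases) (auto simp: osc_le_def norm_minus_commute)
    then show ?thesis using d(1) by blast
  qed
  have "Cauchy (\<lambda>j. f (p j))"
  proof (rule CauchyI)
    fix e :: real assume e: "0 < e"
    then obtain d where d: "d > 0" "\<forall>s\<in>U d. \<forall>s'\<in>U d. norm (f s' - f s) \<le> e / 2" using osc'[of "e / 2"] by auto
    obtain N where N: "\<And>j. j \<ge> N \<Longrightarrow> p j \<in> U d" using p[OF d(1)] by (auto simp: eventually_sequentially)
    have "norm (f (p m) - f (p n)) < e" if "m \<ge> N" "n \<ge> N" for m n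
    proof -
      have "norm (f (p m) - f (p n)) \<le> e / 2" using d(2) N that by blast
      then show ?thesis using e by simp
    qed
    then show "\<exists>M. \<forall>m\<ge>M. \<forall>n\<ge>M. norm (f (p m) - f (p n)) < e" by blast
  qed
  then show lim: "(\<lambda>j. f (p j)) \<longlonglongrightarrow> lim (\<lambda>j. f (p j))"
    using Cauchy_convergent convergent_LIMSEQ_iff by blast
  assume "0 < \<epsilon>"
  then obtain d where d: "d > 0" "\<forall>s\<in>U d. \<forall>s'\<in>U d. norm (f s' - f s) \<le> \<epsilon>" using osc' by blast
  have "norm (f s - lim (\<lambda>j. f (p j))) \<le> \<epsilon>" if s: "s \<in> U d" for s
  proof (rule tendsto_upperbound)
    show "(\<lambda>j. norm (f s - f (p j))) \<longlonglongrightarrow> norm (f s - lim (\<lambda>j. f (p j)))" by (intro tendsto_intros lim)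
    show "\<forall>\<^sub>F j in sequentially. norm (f s - f (p j)) \<le> \<epsilon>"
      using p[OF d(1)] by eventually_elim (use d s in blast)
  qed simp
  then show "\<exists>d>0. \<forall>s\<in>U d. norm (f s - lim (\<lambda>j. f (p j))) \<le> \<epsilon>" using d(1) by blast
qed

lemma dyadic_above_in: "0 \<le> t \<Longrightarrow> dyadic_above j t \<in> dyadics"
  using dyadic_above(4) by (auto simp: dyadics_def)

lemma regularize_right:
  fixes f :: "real \<Rightarrow> 'a::banach"
  assumes f: "chain_bounded f" and t: "0 \<le> t"
  shows "(\<lambda>j. f (dyadic_above j t)) \<longlonglongrightarrow> regularize f t"
    and "0 < \<epsilon> \<Longrightarrow> \<exists>d>0. \<forall>s\<in>dyadics \<inter> {t<..<t + d}. norm (f s - regularize f t) \<le> \<epsilon>"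
proof -
  have ev: "\<forall>\<^sub>F j in sequentially. dyadic_above j t \<in> dyadics \<inter> {t<..<t + d}" if "0 < d" for d
  proof -
    have "\<forall>\<^sub>F j in sequentially. dyadic_above j t < t + d"
      using dyadic_above_tendsto by (rule order_tendstoD) (use that in simp)
    then show ?thesis by eventually_elim (use dyadic_above(1) dyadic_above_in[OF t] in auto)
  qed
  show "(\<lambda>j. f (dyadic_above j t)) \<longlonglongrightarrow> regularize f t"
    "0 < \<epsilon> \<Longrightarrow> \<exists>d>0. \<forall>s\<in>dyadics \<inter> {t<..<t + d}. norm (f s - regularize f t) \<le> \<epsilon>"
    unfolding regularize_def using limit_of_small_osc[OF chain_bounded_osc(1)[OF f _ t] ev] by auto
qed

lemma dyadics_left_limit:
  fixes f :: "real \<Rightarrow> 'a::banach"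
  assumes f: "chain_bounded f" and t: "0 < t"
  shows "\<exists>l. \<forall>\<epsilon>>0. \<exists>d>0. \<forall>s\<in>dyadics \<inter> {t - d<..<t}. norm (f s - l) \<le> \<epsilon>"
proof -
  \<comment> \<open>\<open>dyadic_above\<close> exceeds its argument by at most
    \<open>1 / 2 ^ j\<close>, so a distance of \<open>2 / 2 ^ j\<close> keeps the chosen points
    strictly below t.\<close>
  define q where "q j = t - 2 / 2 ^ j" for j :: nat
  have "(\<lambda>j. t - 2 / 2 ^ j) \<longlonglongrightarrow> t - 0"
    by (intro tendsto_diff tendsto_const) (simp add: LIMSEQ_divide_realpow_zero)
  then have q: "\<forall>\<^sub>F j in sequentially. a < q j" if "a < t" for a
    unfolding q_def using that by (intro order_tendstoD) simp_all
  have ev: "\<forall>\<^sub>F j in sequentially. dyadic_above j (q j) \<in> dyadics \<inter> {t - d<..<t}" if d: "0 < d" for d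
  proof -
    have "t - d < t" using d by simp
    from q[OF this] q[OF t] show ?thesis
    proof eventually_elim
      case (elim j)
      have "t - d < dyadic_above j (q j)" using elim dyadic_above(1)[of "q j" j] by simp
      moreover have "q j + 1 / 2 ^ j < t" by (simp add: q_def field_simps)
      then have "dyadic_above j (q j) < t" using dyadic_above(2)[of j "q j"] by linarith
      ultimately show ?case using dyadic_above_in elim by simp
    qed
  qed
  show ?thesis using limit_of_small_osc(2)[OF chain_bounded_osc(2)[OF f _ t] ev] by blast
qed

lemma regularize_near:
  fixes f :: "real \<Rightarrow> 'a::banach"
  assumes f: "chain_bounded f" and d: "\<forall>s\<in>dyadics \<inter> {a<..<b}. norm (f s - l) \<le> e / 2" "0 < e"
    and u: "0 \<le> u" "a < u" "u < b"
  shows "dist (regularize f u) l < e"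
proof -
  have "norm (regularize f u - l) \<le> e / 2"
  proof (rule tendsto_upperbound)
    show "(\<lambda>j. norm (f (dyadic_above j u) - l)) \<longlonglongrightarrow> norm (regularize f u - l)"
      by (intro tendsto_intros regularize_right(1)[OF f u(1)])
    have "\<forall>\<^sub>F j in sequentially. dyadic_above j u < b"
      using dyadic_above_tendsto u(3) by (rule order_tendstoD)
    then show "\<forall>\<^sub>F j in sequentially. norm (f (dyadic_above j u) - l) \<le> e / 2"
      by eventually_elim (use d(1) dyadic_above_in[OF u(1)] less_trans[OF u(2) dyadic_above(1)] in auto)
  qed simp
  then show ?thesis using d(2) by (simp add: dist_norm)
qed

lemma cadlag_regularize:
  fixes f :: "real \<Rightarrow> 'a::banach"
  assumes f: "chain_bounded f"
  shows "cadlag (regularize f)"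
  unfolding cadlag_def
proof (intro conjI allI impI)
  fix t :: real assume t: "0 \<le> t"
  have "(regularize f \<longlongrightarrow> regularize f t) (at_right t)"
  proof (rule tendstoI)
    fix e :: real assume e: "0 < e"
    obtain d where d: "d > 0" "\<forall>s\<in>dyadics \<inter> {t<..<t + d}. norm (f s - regularize f t) \<le> e / 2"
      using regularize_right(2)[OF f t, of "e / 2"] e by auto
    show "\<forall>\<^sub>F u in at_right t. dist (regularize f u) (regularize f t) < e"
      unfolding eventually_at_right_field
      using d(1) t by (intro exI[of _ "t + d"]) (auto intro!: regularize_near[OF f d(2) e])
  qed
  then show "continuous (at_right t) (regularize f)" by (simp add: continuous_within)
next
  fix t :: real assume t: "0 < t"
  obtain l where l: "\<And>\<epsilon>. \<epsilon> > 0 \<Longrightarrow> \<exists>d>0. \<forall>s\<in>dyadics \<inter> {t - d<..<t}. norm (f s - l) \<le> \<epsilon>"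
    using dyadics_left_limit[OF f t] by blast
  have "(regularize f \<longlongrightarrow> l) (at_left t)"
  proof (rule tendstoI)
    fix e :: real assume e: "0 < e"
    obtain d where d: "d > 0" "\<forall>s\<in>dyadics \<inter> {t - d<..<t}. norm (f s - l) \<le> e / 2"
      using l[of "e / 2"] e by auto
    show "\<forall>\<^sub>F u in at_left t. dist (regularize f u) l < e"
      unfolding eventually_at_left_field
      using d(1) t by (intro exI[of _ "max 0 (t - d)"]) (auto intro!: regularize_near[OF f d(2) e])
  qed
  then show "\<exists>l. (regularize f \<longlongrightarrow> l) (at_left t)" by blast
qed

text \<open>A chain has finitely many times, so all of them belong to every sufficiently fine level.
  There the path, measured from the left end of the block, is a walk of \<open>2 ^ (n - p)\<close>
  steps, and \<open>phases_chain\<close> counts the moves.\<close>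

lemma level_chain_phases:
  fixes f :: "real \<Rightarrow> 'a::real_normed_vector"
  assumes chain: "has_chain f (dyadic_block p b) (2 * \<eta>) k" and \<eta>: "0 \<le> \<eta>"
  shows "\<forall>\<^sub>F n in sequentially. k \<le> phases \<eta> (2 ^ (n - p)) 0
    (\<lambda>i. incr n (b * 2 ^ (n - p) + i) f)"
proof -
  obtain c where c: "\<And>l. l \<le> k \<Longrightarrow> c l \<in> dyadics" "\<And>l. l \<le> k \<Longrightarrow> c l \<in> {real b / 2 ^ p..real (Suc b) / 2 ^ p}"
    "\<And>l. l < k \<Longrightarrow> c l < c (Suc l)" "\<And>l. l < k \<Longrightarrow> norm (f (c (Suc l)) - f (c l)) > 2 * \<eta>"
    using chain unfolding has_chain_def is_chain_def dyadic_block_def by blast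
  have "\<forall>\<^sub>F n in sequentially. c l \<in> dyadic_level n" if l: "l \<le> k" for l
  proof -
    obtain m where "c l \<in> dyadic_level m" using c(1)[OF l] by (auto simp: dyadics_def)
    then show ?thesis using dyadic_level_mono unfolding eventually_sequentially by blast
  qed
  then have "\<forall>\<^sub>F n in sequentially. \<forall>l\<in>{..k}. c l \<in> dyadic_level n"
    by (intro eventually_ball_finite) auto
  then show ?thesis
    using eventually_ge_at_top[of p]
  proof eventually_elim
    case (elim n)
    \<comment> \<open>The number, at level n, of the left end of the block.\<close>
    define a where "a = b * 2 ^ (n - p)"
    let ?g = "\<lambda>j. incr n (a + j) f"
    have scale: "real x / 2 ^ p = real (x * 2 ^ (n - p)) / 2 ^ n" for x
    proof -
      have "(2::real) ^ n = 2 ^ p * 2 ^ (n - p)" using elim(2) by (simp flip: power_add)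
      then show ?thesis by (simp add: field_simps)
    qed
    define i where "i l = (SOME i. c l = real i / 2 ^ n)" for l
    have i: "c l = real (i l) / 2 ^ n" if "l \<le> k" for l
      unfolding i_def by (rule someI_ex) (use elim(1) that in \<open>auto simp: dyadic_level_def\<close>)
    have ib: "a \<le> i l" "i l \<le> a + 2 ^ (n - p)" if "l \<le> k" for l
    proof -
      have "real b / 2 ^ p \<le> c l" "c l \<le> real (Suc b) / 2 ^ p" using c(2)[OF that] by auto
      then have "real (b * 2 ^ (n - p)) \<le> real (i l)" "real (i l) \<le> real (Suc b * 2 ^ (n - p))"
        unfolding scale i[OF that] by (simp_all only: divide_le_cancel) auto
      then show "a \<le> i l" "i l \<le> a + 2 ^ (n - p)" unfolding a_def of_nat_le_iff by auto
    qed
    have S: "(\<Sum>j<m. ?g j) = f (real (a + m) / 2 ^ n) - f (real a / 2 ^ n)" for m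
      using sum_lessThan_telescope[of "\<lambda>j. f (real (a + j) / 2 ^ n)" m] by (simp add: incr_def)
    have Si: "(\<Sum>j<i l - a. ?g j) = f (c l) - f (real a / 2 ^ n)" if "l \<le> k" for l
      unfolding S using ib[OF that] i[OF that] by simp
    have "k \<le> phases \<eta> (2 ^ (n - p)) 0 ?g"
    proof (rule phases_chain[where c = "\<lambda>l. i l - a", OF \<eta>])
      show "i l - a \<le> 2 ^ (n - p)" if "l \<le> k" for l using ib[OF that] by simp
      fix l assume l: "l < k"
      have "real (i l) / 2 ^ n < real (i (Suc l)) / 2 ^ n" using c(3)[OF l] i[of l] i[of "Suc l"] l by simp
      then have "i l < i (Suc l)" by (simp add: divide_less_cancel)
      then show "i l - a < i (Suc l) - a" using ib[of l] l by simp
      show "norm ((\<Sum>j<i (Suc l) - a. ?g j) - (\<Sum>j<i l - a. ?g j)) > 2 * \<eta>"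
        using Si[of l] Si[of "Suc l"] l c(4)[OF l] by simp
    qed
    then show ?case by (simp add: a_def)
  qed
qed

section \<open>Independence of almost sure limits\<close>

text \<open>Continuous functions decreasing to the indicator of a closed set. The empty set has its
  own clause since \<open>infdist x {} = 0\<close>.\<close>

definition cutoff :: "'a::metric_space set \<Rightarrow> nat \<Rightarrow> 'a \<Rightarrow> real" where
  "cutoff C m x = (if C = {} then 0 else max 0 (1 - real m * infdist x C))"

lemma cutoff_bounds: "0 \<le> cutoff C m x" "cutoff C m x \<le> 1"
  by (auto simp: cutoff_def infdist_nonneg)

lemma cutoff_abs: "\<bar>cutoff C m x\<bar> \<le> 1"
  using cutoff_bounds[of C m x] by linarith

lemma isCont_cutoff: "isCont (cutoff C m) x"
  unfolding cutoff_def by (cases "C = {}") (auto intro!: continuous_intros)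

lemma cutoff_tendsto:
  assumes "closed C"
  shows "(\<lambda>m. cutoff C m x) \<longlonglongrightarrow> indicator C x"
proof (cases "C = {}")
  case False
  show ?thesis
  proof (cases "x \<in> C")
    case True
    then show ?thesis by (simp add: cutoff_def False infdist_zero)
  next
    case notin: False
    then have pos: "0 < infdist x C" using infdist_pos_not_in_closed[OF assms False] by simp
    have "\<forall>\<^sub>F m in sequentially. 1 / infdist x C \<le> real m"
      using filterlim_real_sequentially unfolding filterlim_at_top by blast
    then have "\<forall>\<^sub>F m in sequentially. cutoff C m x = indicator C x"
      by eventually_elim (use pos notin in \<open>auto simp: cutoff_def field_simps\<close>)
    then show ?thesis by (rule tendsto_eventually)
  qed
qed (simp add: cutoff_def)

text \<open>For a fixed cutoff the product formula for expectations passes to the limit in j by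
  dominated convergence. Sharpening the cutoffs then gives the formula for closed sets, an
  intersection-stable generator of the Borel sets.\<close>

lemma (in prob_space) indep_vars_limit:
  fixes X :: "nat \<Rightarrow> 'i \<Rightarrow> 'a \<Rightarrow> 'b::metric_space"
  assumes ind: "\<And>j. indep_vars (\<lambda>_. borel) (X j) K"
    and Z: "\<And>k. k \<in> K \<Longrightarrow> Z k \<in> borel_measurable M"
    and lim: "\<And>k. k \<in> K \<Longrightarrow> AE w in M. (\<lambda>j. X j k w) \<longlonglongrightarrow> Z k w"
  shows "indep_vars (\<lambda>_. borel) Z K"
proof -
  have Xm: "X j k \<in> borel_measurable M" if "k \<in> K" for j k
    using ind that by (auto simp: indep_vars_def)
  have cm[measurable]: "cutoff C m \<in> borel_measurable borel" for C :: "'b set" and m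
    by (intro borel_measurable_continuous_onI continuous_at_imp_continuous_on ballI isCont_cutoff)
  have closed_eq: "prob (\<Inter>k\<in>J. Z k -` C k \<inter> space M) = (\<Prod>k\<in>J. prob (Z k -` C k \<inter> space M))"
    if J: "J \<subseteq> K" "finite J" "J \<noteq> {}" and C: "\<And>k. k \<in> J \<Longrightarrow> closed (C k)" for J and C :: "'i \<Rightarrow> 'b set"
  proof -
    let ?V = "\<lambda>k. Z k -` C k \<inter> space M" and ?G = "\<lambda>m Z I w. \<Prod>k\<in>I. cutoff (C k) m (Z k w)"
    have m[measurable]: "k \<in> J \<Longrightarrow> X j k \<in> borel_measurable M" "k \<in> J \<Longrightarrow> Z k \<in> borel_measurable M" for j k
      using J Xm Z by auto
    have Vs: "?V k \<in> sets M" if "k \<in> J" for k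
      using C[OF that] m(2)[OF that] by (intro measurable_sets[of _ _ borel]) auto
    have b: "\<bar>\<Prod>k\<in>I. cutoff (C k) m (u k)\<bar> \<le> 1" for u m I
      by (simp add: abs_prod prod_le_1 cutoff_bounds)
    have limX: "(\<lambda>j. expectation (?G m (X j) I)) \<longlonglongrightarrow> expectation (?G m Z I)" if I: "I \<subseteq> J" for m I
    proof (rule integral_dominated_convergence[where w = "\<lambda>_. 1"])
      have "AE w in M. \<forall>k\<in>I. (\<lambda>j. X j k w) \<longlonglongrightarrow> Z k w"
        using I J lim by (intro AE_finite_allI) (auto intro: finite_subset)
      then show "AE w in M. (\<lambda>j. ?G m (X j) I w) \<longlonglongrightarrow> ?G m Z I w"
        by eventually_elim (intro tendsto_prod isCont_tendsto_compose[OF isCont_cutoff], auto)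
      have [measurable]: "k \<in> I \<Longrightarrow> X j k \<in> borel_measurable M" "k \<in> I \<Longrightarrow> Z k \<in> borel_measurable M" for j k
        using m I by auto
      show "?G m Z I \<in> borel_measurable M" "?G m (X j) I \<in> borel_measurable M" for j by measurable
    qed (use b in auto)
    have limZ: "(\<lambda>m. expectation (?G m Z I)) \<longlonglongrightarrow> prob (\<Inter>k\<in>I. ?V k)" if I: "I \<subseteq> J" "I \<noteq> {}" for I
    proof -
      have fin: "finite I" using I J by (auto intro: finite_subset)
      have ind: "(\<Prod>k\<in>I. indicat_real (C k) (Z k w)) = indicator (\<Inter>k\<in>I. ?V k) w" if w: "w \<in> space M" for w
      proof (cases "\<forall>k\<in>I. Z k w \<in> C k")
        case False
        then obtain k where k: "k \<in> I" "Z k w \<notin> C k" by blast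
        then have "(\<Prod>k\<in>I. indicat_real (C k) (Z k w)) = 0"
          using fin by (intro prod_zero bexI[of _ k]) auto
        then show ?thesis using k by (auto simp: indicator_def)
      qed (use w in simp)
      have "(\<lambda>m. expectation (?G m Z I)) \<longlonglongrightarrow> expectation (indicat_real (\<Inter>k\<in>I. ?V k))"
      proof (rule integral_dominated_convergence[where w = "\<lambda>_. 1"])
        show "AE w in M. (\<lambda>m. ?G m Z I w) \<longlonglongrightarrow> indicator (\<Inter>k\<in>I. ?V k) w"
        proof (rule AE_I2)
          fix w assume w: "w \<in> space M"
          show "(\<lambda>m. ?G m Z I w) \<longlonglongrightarrow> indicator (\<Inter>k\<in>I. ?V k) w"
            unfolding ind[OF w, symmetric] using I C by (intro tendsto_prod cutoff_tendsto) auto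
        qed
        have [measurable]: "k \<in> I \<Longrightarrow> Z k \<in> borel_measurable M" for k using m I by auto
        show "?G m Z I \<in> borel_measurable M" for m by measurable
        show "indicat_real (\<Inter>k\<in>I. ?V k) \<in> borel_measurable M"
          using I fin Vs by (intro borel_measurable_indicator sets.finite_INT) auto
      qed (use b in auto)
      moreover have "(\<Inter>k\<in>I. ?V k) \<subseteq> space M" using I(2) by auto
      ultimately show ?thesis by (simp add: Int_absorb2)
    qed
    have "expectation (?G m (X j) J) = (\<Prod>k\<in>J. expectation (?G m (X j) {k}))" for m j
    proof -
      have "indep_vars (\<lambda>_. borel) (\<lambda>k w. cutoff (C k) m (X j k w)) J"
        by (rule indep_vars_compose2[OF indep_vars_subset[OF ind J(1)]]) simp
      moreover have "integrable M (\<lambda>w. cutoff (C k) m (X j k w))" if "k \<in> J" for k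
        by (rule integrable_const_bound[of _ 1]) (use that cutoff_abs in auto)
      ultimately show ?thesis using indep_vars_lebesgue_integral[OF J(2), of "\<lambda>k w. cutoff (C k) m (X j k w)"] by simp
    qed
    then have "(\<lambda>j. expectation (?G m (X j) J)) \<longlonglongrightarrow> (\<Prod>k\<in>J. expectation (?G m Z {k}))" for m
      by (simp only:) (intro tendsto_prod limX, auto)
    then have "expectation (?G m Z J) = (\<Prod>k\<in>J. expectation (?G m Z {k}))" for m
      by (rule LIMSEQ_unique[OF limX[OF order.refl]])
    then have "(\<lambda>m. expectation (?G m Z J)) \<longlonglongrightarrow> (\<Prod>k\<in>J. prob (\<Inter>k\<in>{k}. ?V k))"
      by (simp only:) (intro tendsto_prod limZ, auto)
    from LIMSEQ_unique[OF limZ[OF order.refl J(3)] this] show ?thesis by simp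
  qed
  define F where "F k = {Z k -` C \<inter> space M | C. C \<in> Collect closed}" for k
  have "indep_sets F K"
  proof (rule indep_setsI)
    show "F k \<subseteq> events" if "k \<in> K" for k
      using Z[OF that] by (auto simp: F_def intro!: measurable_sets)
    fix A J assume J: "J \<noteq> {}" "J \<subseteq> K" "finite J" "\<forall>j\<in>J. A j \<in> F j"
    then have "\<forall>j\<in>J. \<exists>C. closed C \<and> A j = Z j -` C \<inter> space M" by (auto simp: F_def)
    then obtain C where C: "\<And>j. j \<in> J \<Longrightarrow> closed (C j)" "\<And>j. j \<in> J \<Longrightarrow> A j = Z j -` C j \<inter> space M"
      by metis
    show "prob (\<Inter>j\<in>J. A j) = (\<Prod>j\<in>J. prob (A j))"
      using closed_eq[OF J(2,3,1) C(1)] C(2) by (simp cong: INF_cong prod.cong)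
  qed
  moreover have "Int_stable (F k)" for k
  proof (rule Int_stableI)
    fix a b assume "a \<in> F k" "b \<in> F k"
    then obtain C D where "closed C" "closed D" "a = Z k -` C \<inter> space M" "b = Z k -` D \<inter> space M"
      by (auto simp: F_def)
    then show "a \<inter> b \<in> F k" unfolding F_def by (intro CollectI exI[of _ "C \<inter> D"]) auto
  qed
  ultimately have "indep_sets (\<lambda>k. sigma_sets (space M) (F k)) K" by (rule indep_sets_sigma)
  moreover have "{Z k -` A \<inter> space M | A. A \<in> sets borel} = sigma_sets (space M) (F k)" for k
    unfolding F_def borel_eq_closed by (subst sigma_sets_vimage_commute[symmetric]) auto
  ultimately show ?thesis
    unfolding indep_vars_def2 using Z
    by (auto intro: indep_sets_mono_sets)
qed

section \<open>Existence of Levy processes\<close>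

text \<open>The event is the increasing union of the intersections of all late \<open>B n\<close>,
  and each such intersection lies inside a single \<open>B n\<close>.\<close>

lemma (in prob_space) prob_eventually_le:
  assumes B: "\<And>n. p \<le> n \<Longrightarrow> B n \<in> events" "\<And>n. p \<le> n \<Longrightarrow> prob (B n) \<le> c"
  shows "{w\<in>space M. \<forall>\<^sub>F n in sequentially. w \<in> B n} \<in> events"
    and "prob {w\<in>space M. \<forall>\<^sub>F n in sequentially. w \<in> B n} \<le> c"
proof -
  let ?E = "{w\<in>space M. \<forall>\<^sub>F n in sequentially. w \<in> B n}"
  define L where "L m = (\<Inter>n\<in>{p + m..}. B n)" for m
  have Le: "L m \<in> events" for m unfolding L_def by (rule sets.countable_INT') (use B(1) in auto)
  have inc: "incseq L" unfolding L_def incseq_def by (auto intro!: INF_superset_mono)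
  have eq: "?E = (\<Union>m. L m)"
  proof safe
    fix w assume "\<forall>\<^sub>F n in sequentially. w \<in> B n"
    then obtain N where "\<And>n. n \<ge> N \<Longrightarrow> w \<in> B n" by (auto simp: eventually_sequentially)
    then have "w \<in> L N" by (auto simp: L_def)
    then show "w \<in> (\<Union>m. L m)" by blast
  next
    fix w m assume m: "w \<in> L m"
    then show "w \<in> space M" using Le sets.sets_into_space by blast
    show "\<forall>\<^sub>F n in sequentially. w \<in> B n" using m unfolding L_def eventually_sequentially by auto
  qed
  show "?E \<in> events" unfolding eq using Le by auto
  have "(\<lambda>m. prob (L m)) \<longlonglongrightarrow> prob (\<Union>m. L m)"
    by (rule finite_Lim_measure_incseq) (use Le inc in auto)
  moreover have "prob (L m) \<le> c" for m
    using finite_measure_mono[of "L m" "B (p + m)"] B[of "p + m"] by (auto simp: L_def intro: order_trans)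
  ultimately show "prob ?E \<le> c"
    unfolding eq by (intro LIMSEQ_le_const2) auto
qed

text \<open>Convolution is expressed through characteristic functionals. \<open>small\<close> is the
  form of continuity at 0 that the walks use, with the constant 1/3 of
  \<open>phases_bound\<close>.\<close>

locale convolution_semigroup =
  fixes \<kappa> :: "real \<Rightarrow> 'a::{banach,second_countable_topology} measure"
  assumes prob_\<kappa>: "\<And>t. 0 \<le> t \<Longrightarrow> prob_space (\<kappa> t)" and sets_\<kappa>: "\<And>t. 0 \<le> t \<Longrightarrow> sets (\<kappa> t) = sets borel"
    and cf_add: "\<And>y s t. bounded_linear y \<Longrightarrow> 0 \<le> s \<Longrightarrow> 0 \<le> t \<Longrightarrow> cf (\<kappa> (s + t)) y = cf (\<kappa> s) y * cf (\<kappa> t) y"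
    and cf_0: "\<And>y. bounded_linear y \<Longrightarrow> cf (\<kappa> 0) y = 1"
    and small: "\<And>\<epsilon>. 0 < \<epsilon> \<Longrightarrow> \<exists>\<delta>>0. \<forall>t. 0 \<le> t \<and> t < \<delta> \<longrightarrow> measure (\<kappa> t) {x. norm x > \<epsilon>} \<le> 1 / 3"
begin

lemma cf_mult:
  assumes "bounded_linear y" "0 \<le> t"
  shows "cf (\<kappa> (real n * t)) y = cf (\<kappa> t) y ^ n"
proof (induction n)
  case (Suc n)
  have "real (Suc n) * t = t + real n * t" by (simp add: algebra_simps)
  then show ?case using Suc assms by (simp add: cf_add)
qed (use assms in \<open>simp add: cf_0\<close>)

definition \<kappa>n :: "nat \<Rightarrow> 'a measure" where "\<kappa>n n = \<kappa> (1 / 2 ^ n)"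

lemma \<kappa>n: "prob_space (\<kappa>n n)" "sets (\<kappa>n n) = sets borel"
  by (simp_all add: \<kappa>n_def prob_\<kappa> sets_\<kappa>)

lemma cf_\<kappa>n: "bounded_linear y \<Longrightarrow> cf (\<kappa>n n) y ^ m = cf (\<kappa> (real m / 2 ^ n)) y"
  using cf_mult[of y "1 / 2 ^ n" m] by (simp add: \<kappa>n_def)

lemma partial_sum_tail:
  "measure (PiM (UNIV::nat set) (\<lambda>_. \<kappa>n n)) {w\<in>space (PiM UNIV (\<lambda>_. \<kappa>n n)). norm (\<Sum>i<j. w i) > \<epsilon>}
    = measure (\<kappa> (real j / 2 ^ n)) {x. norm x > \<epsilon>}"
proof -
  let ?S = "PiM (UNIV::nat set) (\<lambda>_. \<kappa>n n)"
  let ?s = "\<lambda>w. \<Sum>i<j. w i" and ?B = "{x :: 'a. norm x > \<epsilon>}"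
  interpret prob_space ?S by (rule prob_space_PiM) (rule \<kappa>n)
  have ind: "indep_vars (\<lambda>_. borel) (\<lambda>i w. w i) (UNIV::nat set)"
    by (rule indep_vars_PiM_coordinates) (rule \<kappa>n)+
  have m[measurable]: "(\<lambda>w. w i) \<in> borel_measurable ?S" for i
    using ind by (auto simp: indep_vars_def)
  have law: "distr ?S borel (\<lambda>w. w i) = \<kappa>n n" for i
    using distr_PiM_component[of UNIV "\<lambda>_. \<kappa>n n" i] \<kappa>n by (simp cong: distr_cong)
  have sm: "?s \<in> borel_measurable ?S" by measurable
  have "distr ?S borel ?s = \<kappa> (real j / 2 ^ n)"
  proof (rule cf_unique)
    show "prob_space (distr ?S borel ?s)" by (rule prob_space_distr[OF sm])
    fix y :: "'a \<Rightarrow> real" assume y: "bounded_linear y"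
    have "cf ?S (\<lambda>w. y (w i)) = cf (\<kappa>n n) y" for i using cf_distr[OF m y, of i] law by simp
    then show "cf (distr ?S borel ?s) y = cf (\<kappa> (real j / 2 ^ n)) y"
      using cf_indep_sum[OF indep_vars_subset[OF ind, of "{..<j}"] _ y] y
      by (simp add: cf_distr[OF sm y] cf_\<kappa>n[OF y])
  qed (simp_all add: prob_\<kappa> sets_\<kappa>)
  then have "measure (\<kappa> (real j / 2 ^ n)) ?B = measure (distr ?S borel ?s) ?B"
    by simp
  also have "\<dots> = measure ?S (?s -` ?B \<inter> space ?S)"
    by (rule measure_distr[OF sm]) simp
  also have "?s -` ?B \<inter> space ?S = {w\<in>space ?S. norm (\<Sum>i<j. w i) > \<epsilon>}" by auto
  finally show ?thesis by simp
qed

end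

section \<open>A cadlag version of the dyadic process\<close>

locale dyadic_process = convolution_semigroup \<kappa> + prob_space Q
  for \<kappa> :: "real \<Rightarrow> 'a::{banach,second_countable_topology} measure" and Q :: "(real \<Rightarrow> 'a) measure" +
  assumes sets_Q[measurable_cong]: "sets Q = sets (\<Pi>\<^sub>M t\<in>UNIV. borel)"
    and law_Q: "\<And>n. distr Q seq_borel (\<lambda>f i. incr n i f) = (\<Pi>\<^sub>M i\<in>UNIV. \<kappa>n n)"
begin

lemma measurable_incr[measurable]: "incr n i \<in> borel_measurable Q"
  unfolding incr_def[abs_def] by measurable

lemma measurable_incrs: "(\<lambda>f i. incr n i f) \<in> measurable Q seq_borel"
  by (rule measurable_PiM_UNIV) simp

lemma law_incr: "distr Q borel (incr n i) = \<kappa>n n"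
proof -
  have "distr (distr Q seq_borel (\<lambda>f i. incr n i f)) borel (\<lambda>w. w i) = distr Q borel (incr n i)"
    by (subst distr_distr[OF _ measurable_incrs]) (auto simp: o_def)
  then show ?thesis
    unfolding law_Q using distr_PiM_component[of UNIV "\<lambda>_. \<kappa>n n" i] \<kappa>n by (simp cong: distr_cong)
qed

lemma indep_incr: "indep_vars (\<lambda>_. borel) (incr n) UNIV"
proof (rule indep_vars_iff_distr_eq_PiM[THEN iffD2])
  show "distr Q seq_borel (\<lambda>x. \<lambda>i\<in>UNIV. incr n i x) = (\<Pi>\<^sub>M i\<in>UNIV. distr Q borel (incr n i))"
    using law_Q[of n] by (simp add: law_incr restrict_def)
qed simp_all

text \<open>Stationarity at a dyadic level: one bound for walks then serves every block, wherever it
  begins.\<close>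

lemma law_incrs_shift: "distr Q seq_borel (\<lambda>f i. incr n (a + i) f) = (\<Pi>\<^sub>M i\<in>(UNIV::nat set). \<kappa>n n)"
proof -
  let ?P = "\<Pi>\<^sub>M i\<in>(UNIV::nat set). \<kappa>n n"
  have "distr ?P ?P (\<lambda>w. \<lambda>i\<in>UNIV. w (a + i)) = ?P"
    using distr_PiM_reindex[of UNIV "\<lambda>_. \<kappa>n n" "\<lambda>i. a + i" UNIV] \<kappa>n by simp
  moreover have "distr Q seq_borel (\<lambda>f i. incr n (a + i) f)
      = distr (distr Q seq_borel (\<lambda>f i. incr n i f)) seq_borel (\<lambda>w i. w (a + i))"
    by (subst distr_distr[OF _ measurable_incrs]) (auto simp: o_def intro!: measurable_PiM_UNIV)
  moreover have "distr ?P seq_borel (\<lambda>w i. w (a + i)) = distr ?P ?P (\<lambda>w i. w (a + i))"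
    by (intro distr_cong sets_PiM_cong) (simp_all add: \<kappa>n)
  ultimately show ?thesis unfolding law_Q by (simp add: restrict_def)
qed

lemma phases_incr_bound:
  assumes tail: "\<And>t. 0 \<le> t \<Longrightarrow> t < \<delta> \<Longrightarrow> measure (\<kappa> t) {x. norm x > \<eta> / 2} \<le> 1 / 3"
    and m: "real m / 2 ^ n < \<delta>"
  shows "{f\<in>space Q. k \<le> phases \<eta> m 0 (\<lambda>i. incr n (a + i) f)} \<in> events"
    and "prob {f\<in>space Q. k \<le> phases \<eta> m 0 (\<lambda>i. incr n (a + i) f)} \<le> (1 / 2) ^ k"
proof -
  let ?B = "{f\<in>space Q. k \<le> phases \<eta> m 0 (\<lambda>i. incr n (a + i) f)}"
  interpret R: random_walk "\<kappa>n n"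
    by (intro random_walk.intro random_walk_axioms.intro \<kappa>n)
  let ?W = "\<Pi>\<^sub>M i\<in>(UNIV::nat set). \<kappa>n n"
  have sW: "sets ?W = sets (seq_borel :: (nat \<Rightarrow> 'a) measure)"
    by (rule sets_PiM_cong) (simp_all add: \<kappa>n)
  have ms: "(\<lambda>f i. incr n (a + i) f) \<in> measurable Q seq_borel"
    by (rule measurable_PiM_UNIV) simp
  have "(\<lambda>f. phases \<eta> m 0 (\<lambda>i. incr n (a + i) f)) \<in> measurable Q (count_space UNIV)"
    by (rule measurable_phases) auto
  then show "?B \<in> events" by measurable
  define A where "A = {w\<in>space ?W. k \<le> phases \<eta> m 0 w}"
  have A: "A \<in> sets ?W" using R.measurable_phases_W unfolding A_def pred_def .
  have "measure ?W A = measure (distr Q seq_borel (\<lambda>f i. incr n (a + i) f)) A"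
    unfolding law_incrs_shift ..
  also have "\<dots> = prob ((\<lambda>f i. incr n (a + i) f) -` A \<inter> space Q)"
    using A by (intro measure_distr[OF ms]) (simp add: sW)
  also have "(\<lambda>f i. incr n (a + i) f) -` A \<inter> space Q = ?B"
    using sets_eq_imp_space_eq[OF sW] by (auto simp: A_def space_PiM)
  finally have "prob ?B = measure ?W A" by simp
  also have "\<dots> \<le> (1 / 2) ^ k"
    unfolding A_def
  proof (rule R.phases_bound)
    fix j assume "j \<le> m"
    then have "real j / 2 ^ n \<le> real m / 2 ^ n" by (simp add: divide_right_mono)
    then show "measure ?W {w\<in>space ?W. norm (\<Sum>i<j. w i) > \<eta> / 2} \<le> 1 / 3"
      unfolding partial_sum_tail using m by (intro tail) auto
  qed
  finally show "prob ?B \<le> (1 / 2) ^ k" .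
qed

text \<open>Blocks shorter than \<delta> meet the tail condition of \<open>phases_bound\<close> at
  every level. Having a chain of length k thus implies an event \<open>L b k\<close> of probability
  at most \<open>(1 / 2) ^ k\<close>, and chains of every length occur only on a null set.\<close>

lemma AE_block_chain_free:
  assumes \<eta>: "0 < \<eta>"
  shows "\<exists>p. AE f in Q. \<forall>b. \<exists>k. \<not> has_chain f (dyadic_block p b) (2 * \<eta>) k"
proof -
  obtain \<delta> where \<delta>: "\<delta> > 0" "\<And>t. 0 \<le> t \<Longrightarrow> t < \<delta> \<Longrightarrow> measure (\<kappa> t) {x. norm x > \<eta> / 2} \<le> 1 / 3"
    using small[of "\<eta> / 2"] \<eta> by auto
  obtain p where p: "(1 / 2) ^ p < \<delta>" using real_arch_pow_inv[of \<delta> "1 / 2"] \<delta>(1) by auto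
  define B where "B b k n = {f\<in>space Q. k \<le> phases \<eta> (2 ^ (n - p)) 0 (\<lambda>i. incr n (b * 2 ^ (n - p) + i) f)}" for b k n
  have Bb: "B b k n \<in> events" "prob (B b k n) \<le> (1 / 2) ^ k" if "p \<le> n" for b k n
  proof -
    have "(2::real) ^ n = 2 ^ p * 2 ^ (n - p)" using that by (simp flip: power_add)
    \<comment> \<open>At level n a block consists of \<open>2 ^ (n - p)\<close> increments, whose
      total duration is \<open>1 / 2 ^ p\<close>.\<close>
    then have "real (2 ^ (n - p)) / 2 ^ n < \<delta>" using p by (simp add: power_one_over)
    note bound = phases_incr_bound[OF \<delta>(2) this]
    show "B b k n \<in> events" unfolding B_def by (rule bound(1))
    show "prob (B b k n) \<le> (1 / 2) ^ k" unfolding B_def by (rule bound(2))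
  qed
  define L where "L b k = {f\<in>space Q. \<forall>\<^sub>F n in sequentially. f \<in> B b k n}" for b k
  have L: "L b k \<in> events" "prob (L b k) \<le> (1 / 2) ^ k" for b k
    unfolding L_def by (rule prob_eventually_le[of p]; rule Bb; assumption)+
  have "AE f in Q. \<exists>k. f \<notin> L b k" for b
  proof -
    have ev: "(\<Inter>k. L b k) \<in> events" using L by blast
    have "prob (\<Inter>k. L b k) \<le> (1 / 2) ^ k" for k
      using finite_measure_mono[of "\<Inter>k. L b k" "L b k"] L[of b k] by fastforce
    then have "prob (\<Inter>k. L b k) \<le> 0"
      by (intro LIMSEQ_le_const[OF LIMSEQ_realpow_zero[of "1 / 2"]]) auto
    then have "(\<Inter>k. L b k) \<in> null_sets Q" using ev by (simp add: null_sets_def emeasure_eq_measure measure_le_0_iff)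
    then show ?thesis by (rule AE_I') auto
  qed
  then have "AE f in Q. \<forall>b. \<exists>k. f \<notin> L b k" by (intro AE_all_countable[THEN iffD2] allI)
  then have "AE f in Q. \<forall>b. \<exists>k. \<not> has_chain f (dyadic_block p b) (2 * \<eta>) k"
    using AE_space
  proof eventually_elim
    case (elim f)
    show ?case
    proof
      fix b
      obtain k where k: "f \<notin> L b k" using elim by blast
      have "\<not> has_chain f (dyadic_block p b) (2 * \<eta>) k"
      proof
        assume "has_chain f (dyadic_block p b) (2 * \<eta>) k"
        from level_chain_phases[OF this less_imp_le[OF \<eta>]]
        have "f \<in> L b k" unfolding L_def B_def using elim(2) by simp
        with k show False by simp
      qed
      then show "\<exists>k. \<not> has_chain f (dyadic_block p b) (2 * \<eta>) k" by blast
    qed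
  qed
  then show ?thesis by blast
qed

text \<open>A sequence of thresholds tending to 0 is enough, because a chain for a larger threshold
  is also one for a smaller threshold.\<close>

lemma AE_chain_bounded: "AE f in Q. chain_bounded f"
proof -
  let ?e = "\<lambda>j. 2 * inverse (real (Suc j))"
  have "\<exists>p. AE f in Q. \<forall>b. \<exists>k. \<not> has_chain f (dyadic_block p b) (?e j) k" for j
    by (rule AE_block_chain_free[of "inverse (real (Suc j))"]) simp
  then obtain p where p: "\<And>j. AE f in Q. \<forall>b. \<exists>k. \<not> has_chain f (dyadic_block (p j) b) (?e j) k"
    using choice[of "\<lambda>j p. AE f in Q. \<forall>b. \<exists>k. \<not> has_chain f (dyadic_block p b) (?e j) k"] by blast
  have "AE f in Q. \<forall>j. \<forall>b. \<exists>k. \<not> has_chain f (dyadic_block (p j) b) (?e j) k"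
    by (rule AE_all_countable[THEN iffD2], rule allI, rule p)
  then show ?thesis
  proof eventually_elim
    case (elim f)
    show ?case unfolding chain_bounded_def
    proof (intro allI impI)
      fix \<epsilon> :: real assume "0 < \<epsilon>"
      then obtain j where j: "inverse (real (Suc j)) < \<epsilon> / 2" using reals_Archimedean[of "\<epsilon> / 2"] by auto
      show "\<exists>p. \<forall>b. \<exists>k. \<not> has_chain f (dyadic_block p b) \<epsilon> k"
      proof (rule exI[of _ "p j"], rule allI)
        fix b :: nat
        obtain k where "\<not> has_chain f (dyadic_block (p j) b) (?e j) k"
          using elim by blast
        moreover have "?e j \<le> \<epsilon>" using j by linarith
        ultimately have "\<not> has_chain f (dyadic_block (p j) b) \<epsilon> k"
          using has_chain_mono[OF _ order.refl] by blast
        then show "\<exists>k. \<not> has_chain f (dyadic_block (p j) b) \<epsilon> k" by blast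
      qed
    qed
  qed
qed

lemma incr_sum: "a \<le> b \<Longrightarrow> (\<Sum>i\<in>{a..<b}. incr n i f) = (f (real b / 2 ^ n) - f (real a / 2 ^ n) :: 'a)"
  unfolding incr_def by (rule sum_Suc_diff')

lemma cf_incr_block:
  assumes y: "bounded_linear y" and "a \<le> b"
  shows "cf Q (\<lambda>f. y (f (real b / 2 ^ n) - f (real a / 2 ^ n))) = cf (\<kappa>n n) y ^ (b - a)"
proof -
  have "cf Q (\<lambda>f. y (incr n i f)) = cf (\<kappa>n n) y" for i
    using cf_distr[OF measurable_incr y] law_incr by simp
  then show ?thesis
    using cf_indep_sum[OF indep_vars_subset[OF indep_incr, of "{a..<b}"] _ y, of n] incr_sum[OF \<open>a \<le> b\<close>]
    by simp
qed

lemma exists_levy: "\<exists>Y. levy_process Q Y (\<kappa> 1)"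
proof -
  from AE_chain_bounded obtain N where N: "{f\<in>space Q. \<not> chain_bounded f} \<subseteq> N" "N \<in> null_sets Q"
    by (elim AE_E) (auto simp: null_sets_def)
  have [measurable]: "N \<in> sets Q" using N by auto
  have good: "chain_bounded f" if "f \<in> space Q" "f \<notin> N" for f using N that by auto
  have AEg: "AE f in Q. f \<in> space Q \<and> f \<notin> N" using N(2) AE_not_in[OF N(2)] AE_space by auto
  \<comment> \<open>Subtracting the value at 0 makes \<open>Y 0\<close> vanish at every outcome
    without changing increments; on the null set the zero path is cadlag.\<close>
  define Y where "Y t f = (if f \<in> N then 0 else regularize f t - regularize f 0)" for t f
  have [measurable]: "(\<lambda>f. regularize f t) \<in> borel_measurable Q" for t
    unfolding regularize_def by (rule borel_measurable_lim_metric) simp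
  have Ym[measurable]: "Y t \<in> borel_measurable Q" for t unfolding Y_def[abs_def] by measurable
  define A where "A j t = nat \<lfloor>t * 2 ^ j\<rfloor> + 1" for j and t :: real
  have A: "dyadic_above j t = real (A j t) / 2 ^ j" if "0 \<le> t" for j t
    using dyadic_above(3)[OF that] by (simp add: A_def)
  have A_mono: "A j s \<le> A j t" if "s \<le> t" for j s t
    using that by (simp add: A_def nat_mono floor_mono mult_right_mono)
  have reg_lim: "(\<lambda>j. f (real (A j t) / 2 ^ j)) \<longlonglongrightarrow> regularize f t" if "0 \<le> t" "chain_bounded f" for f :: "real \<Rightarrow> 'a" and t
    using regularize_right(1)[OF that(2,1)] A[OF that(1)] by simp
  have incr_lim: "AE f in Q. (\<lambda>j. f (real (A j t) / 2 ^ j) - f (real (A j s) / 2 ^ j)) \<longlonglongrightarrow> Y t f - Y s f"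
    if "0 \<le> s" "0 \<le> t" for s t
    using AEg
  proof eventually_elim
    case (elim f)
    have "Y t f - Y s f = regularize f t - regularize f s" using elim by (simp add: Y_def)
    then show ?case using elim good by (auto intro!: tendsto_diff reg_lim that)
  qed
  have cf_Y: "(\<lambda>j. cf (\<kappa>n j) y ^ (A j t - A j s)) \<longlonglongrightarrow> cf Q (\<lambda>f. y (Y t f - Y s f))"
    if y: "bounded_linear y" and st: "0 \<le> s" "s \<le> t" for y s t
  proof -
    have [measurable]: "y \<in> borel_measurable borel" by (rule bounded_linear_borel[OF y])
    have "(\<lambda>j. cf Q (\<lambda>f. y (f (real (A j t) / 2 ^ j) - f (real (A j s) / 2 ^ j)))) \<longlonglongrightarrow> cf Q (\<lambda>f. y (Y t f - Y s f))"
    proof (rule cf_tendsto_AE)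
      have "0 \<le> t" using st by simp
      from incr_lim[OF st(1) this]
      show "AE f in Q. (\<lambda>j. y (f (real (A j t) / 2 ^ j) - f (real (A j s) / 2 ^ j))) \<longlonglongrightarrow> y (Y t f - Y s f)"
        by eventually_elim (intro bounded_linear.tendsto[OF y])
    qed measurable
    then show ?thesis by (simp add: cf_incr_block[OF y A_mono[OF st(2)]])
  qed
  \<comment> \<open>For stationarity, \<open>Y (t - s)\<close> is approached over exactly as many
    level-j increments as \<open>Y t - Y s\<close> in \<open>cf_Y\<close>, starting at index 1 =
    \<open>A j 0\<close>. Both characteristic functionals are then limits of the same
    powers.\<close>
  have cf_Y0: "(\<lambda>j. cf (\<kappa>n j) y ^ (A j t - A j s)) \<longlonglongrightarrow> cf Q (\<lambda>f. y (Y (t - s) f))"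
    if y: "bounded_linear y" and st: "0 \<le> s" "s \<le> t" for y s t
  proof -
    have [measurable]: "y \<in> borel_measurable borel" by (rule bounded_linear_borel[OF y])
    define m where "m j = A j t - A j s" for j
    have dm: "real (1 + m j) / 2 ^ j = 1 / 2 ^ j + (dyadic_above j t - dyadic_above j s)" for j
      using st A_mono[OF st(2), of j] by (simp add: A m_def of_nat_diff add_divide_distrib diff_divide_distrib)
    \<comment> \<open>The number of increments read off from t and s may differ from that for t - s;
      what matters is that the end point stays to the right of t - s.\<close>
    have gt: "t - s < real (1 + m j) / 2 ^ j" for j
      unfolding dm using dyadic_above(1)[of t j] dyadic_above(2)[of j s] by linarith
    have "(\<lambda>j. 1 / 2 ^ j + (dyadic_above j t - dyadic_above j s)) \<longlonglongrightarrow> 0 + (t - s)"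
      by (intro tendsto_add tendsto_diff dyadic_above_tendsto) (simp add: LIMSEQ_divide_realpow_zero)
    then have to: "(\<lambda>j. real (1 + m j) / 2 ^ j) \<longlonglongrightarrow> t - s" unfolding dm by simp
    have dy: "real (1 + m j) / 2 ^ j \<in> dyadics" for j unfolding dyadics_def dyadic_level_def by blast
    have "(\<lambda>j. cf Q (\<lambda>f. y (f (real (1 + m j) / 2 ^ j) - f (real 1 / 2 ^ j)))) \<longlonglongrightarrow> cf Q (\<lambda>f. y (Y (t - s) f))"
    proof (rule cf_tendsto_AE)
      show "AE f in Q. (\<lambda>j. y (f (real (1 + m j) / 2 ^ j) - f (real 1 / 2 ^ j))) \<longlonglongrightarrow> y (Y (t - s) f)"
        using AEg
      proof eventually_elim
        case (elim f)
        then have cb: "chain_bounded f" using good by simp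
        have "(\<lambda>j. f (real (1 + m j) / 2 ^ j)) \<longlonglongrightarrow> regularize f (t - s)"
        proof (rule tendstoI)
          fix e :: real assume e: "0 < e"
          obtain d where d: "d > 0" "\<forall>u\<in>dyadics \<inter> {t - s<..<t - s + d}. norm (f u - regularize f (t - s)) \<le> e / 2"
            using regularize_right(2)[OF cb, of "t - s" "e / 2"] e st by auto
          have "\<forall>\<^sub>F j in sequentially. real (1 + m j) / 2 ^ j < t - s + d"
            using to by (rule order_tendstoD) (use d in simp)
          then show "\<forall>\<^sub>F j in sequentially. dist (f (real (1 + m j) / 2 ^ j)) (regularize f (t - s)) < e"
          proof eventually_elim
            case (elim j)
            then have "norm (f (real (1 + m j) / 2 ^ j) - regularize f (t - s)) \<le> e / 2"
              using d(2) dy[of j] gt[of j] by simp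
            then show ?case using e by (simp add: dist_norm del: of_nat_add)
          qed
        qed
        moreover have "(\<lambda>j. f (real 1 / 2 ^ j)) \<longlonglongrightarrow> regularize f 0"
          using reg_lim[OF order.refl cb] by (simp add: A_def)
        ultimately show ?case
          using elim by (auto simp: Y_def intro!: bounded_linear.tendsto[OF y] tendsto_diff)
      qed
    qed measurable
    moreover have "cf Q (\<lambda>f. y (f (real (1 + m j) / 2 ^ j) - f (real 1 / 2 ^ j))) = cf (\<kappa>n j) y ^ (A j t - A j s)" for j
      using cf_incr_block[OF y, of 1 "1 + m j" j] by (simp add: m_def)
    ultimately show ?thesis by (simp only:)
  qed
  have "levy_process Q Y (\<kappa> 1)"
    unfolding levy_process_def
  proof (intro conjI allI ballI impI)
    show "prob_space Q" by unfold_locales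
    show "Y t \<in> borel_measurable Q" for t by simp
    show "Y 0 f = 0" for f by (simp add: Y_def)
  next
    fix f and t :: real assume f: "f \<in> space Q" and t: "0 \<le> t"
    show "continuous (at_right t) (\<lambda>s. Y s f)"
    proof (cases "f \<in> N")
      case False
      then have "continuous (at_right t) (regularize f)"
        using cadlag_regularize[OF good[OF f False]] t by (simp add: cadlag_def)
      then show ?thesis using False by (simp add: Y_def continuous_diff)
    qed (simp add: Y_def)
  next
    fix f and t :: real assume f: "f \<in> space Q" and t: "0 < t"
    show "\<exists>l. ((\<lambda>s. Y s f) \<longlongrightarrow> l) (at_left t)"
    proof (cases "f \<in> N")
      case False
      then obtain l where "(regularize f \<longlongrightarrow> l) (at_left t)"
        using cadlag_regularize[OF good[OF f False]] t by (auto simp: cadlag_def)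
      then have "((\<lambda>s. regularize f s - regularize f 0) \<longlongrightarrow> l - regularize f 0) (at_left t)"
        by (intro tendsto_intros)
      then show ?thesis using False by (auto simp: Y_def)
    qed (auto simp: Y_def)
  next
    fix n and t :: "nat \<Rightarrow> real" assume t: "0 \<le> t 0 \<and> (\<forall>k<n. t k < t (Suc k))"
    have tm: "t k \<le> t l" if "k \<le> l" "l \<le> n" for k l
      using that
    proof (induction l rule: dec_induct)
      case (step l)
      then show ?case using t by (meson Suc_le_lessD less_imp_le order_trans)
    qed simp
    have t0: "0 \<le> t k" if "k \<le> n" for k using tm[of 0 k] t that by auto
    show "indep_vars (\<lambda>_. borel) (\<lambda>k f. Y (t (Suc k)) f - Y (t k) f) {..<n}"
    \<comment> \<open>At level j the increments of the process are replaced by sums of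
      \<open>incr\<close> over disjoint blocks of indices.\<close>
    proof (rule indep_vars_limit)
      fix j
      have "indep_vars (\<lambda>_. borel) (\<lambda>k f. \<Sum>i\<in>{A j (t k)..<A j (t (Suc k))}. incr j i f) {..<n}"
      proof (rule indep_vars_group_sums[OF indep_incr])
        have "{A j (t k)..<A j (t (Suc k))} \<inter> {A j (t l)..<A j (t (Suc l))} = {}" if "k < l" "l < n" for k l
          using A_mono[OF tm[of "Suc k" l], of j] that by auto
        then show "disjoint_family_on (\<lambda>k. {A j (t k)..<A j (t (Suc k))}) {..<n}"
          unfolding disjoint_family_on_def by (auto simp: neq_iff Int_commute)
      qed simp
      then show "indep_vars (\<lambda>_. borel) (\<lambda>k f. if k < n then \<Sum>i\<in>{A j (t k)..<A j (t (Suc k))}. incr j i f else 0) {..<n}"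
        by (rule indep_vars_cong[THEN iffD1, rotated -1]) auto
    next
      fix k assume k: "k \<in> {..<n}"
      have "AE f in Q. (\<lambda>j. f (real (A j (t (Suc k))) / 2 ^ j) - f (real (A j (t k)) / 2 ^ j)) \<longlonglongrightarrow> Y (t (Suc k)) f - Y (t k) f"
        by (rule incr_lim) (use k t0 in auto)
      then show "AE f in Q. (\<lambda>j. if k < n then \<Sum>i\<in>{A j (t k)..<A j (t (Suc k))}. incr j i f else 0) \<longlonglongrightarrow> Y (t (Suc k)) f - Y (t k) f"
        using k incr_sum[OF A_mono[OF tm[of k "Suc k"]]] by simp
    qed simp
  next
    fix s t :: real assume st: "0 \<le> s \<and> s \<le> t"
    show "distr Q borel (\<lambda>f. Y t f - Y s f) = distr Q borel (Y (t - s))"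
    proof (rule cf_unique)
      fix y :: "'a \<Rightarrow> real" assume y: "bounded_linear y"
      have "cf Q (\<lambda>f. y (Y t f - Y s f)) = cf Q (\<lambda>f. y (Y (t - s) f))"
        using cf_Y[OF y, of s t] cf_Y0[OF y, of s t] st by (auto intro: LIMSEQ_unique)
      then show "cf (distr Q borel (\<lambda>f. Y t f - Y s f)) y = cf (distr Q borel (Y (t - s))) y"
        using y by (simp add: cf_distr)
    qed (auto intro!: prob_space_distr)
  next
    show "distr Q borel (Y 1) = \<kappa> 1"
    proof (rule cf_unique)
      fix y :: "'a \<Rightarrow> real" assume y: "bounded_linear y"
      \<comment> \<open>Exactly \<open>2 ^ j\<close> level-j increments fill unit time, so the
        approximating powers do not depend on j.\<close>
      have "A j 1 - A j 0 = 2 ^ j" for j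
      proof -
        have "\<lfloor>(2::real) ^ j\<rfloor> = 2 ^ j" using floor_of_int[of "2 ^ j", where 'a = real] by simp
        then show ?thesis by (simp add: A_def nat_power_eq)
      qed
      then have "cf (\<kappa>n j) y ^ (A j 1 - A j 0) = cf (\<kappa> 1) y" for j
        using cf_\<kappa>n[OF y, of j "2 ^ j"] by simp
      then have "cf Q (\<lambda>f. y (Y 1 f)) = cf (\<kappa> 1) y"
        using cf_Y0[OF y, of 0 1] by (simp add: LIMSEQ_const_iff)
      then show "cf (distr Q borel (Y 1)) y = cf (\<kappa> 1) y" using y by (simp add: cf_distr)
    qed (auto intro!: prob_space_distr simp: prob_\<kappa> sets_\<kappa>)
  qed
  then show ?thesis by blast
qed

end

context convolution_semigroup
begin

theorem levy_process_exists: "\<exists>(M :: (real \<Rightarrow> 'a) measure) Y. levy_process M Y (\<kappa> 1)"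
proof -
  have half: "cf (\<kappa>n (Suc n)) y ^ 2 = cf (\<kappa>n n) y" if "bounded_linear y" for n y
    using cf_\<kappa>n[OF that, of "Suc n" 2] by (simp add: \<kappa>n_def)
  obtain Q :: "(real \<Rightarrow> 'a) measure" where Q: "prob_space Q" "sets Q = sets (\<Pi>\<^sub>M t\<in>UNIV. borel)"
    "\<And>n. distr Q seq_borel (\<lambda>f i. incr n i f) = (\<Pi>\<^sub>M i\<in>UNIV. \<kappa>n n)"
    using dyadic_process_exists[of \<kappa>n] \<kappa>n half by blast
  interpret dyadic_process \<kappa> Q
    using Q convolution_semigroup_axioms by (simp add: dyadic_process_def dyadic_process_axioms_def)
  show ?thesis using exists_levy by blast
qed

end

section \<open>Iterated integrals\<close>

lemma clock_id: "clock (\<lambda>s. s)"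
  by (auto simp: clock_def mono_on_def)

context levy
begin

text \<open>At a single functional the two n-th roots could differ by a root of unity. Along the ray
  \<open>u * z\<close> both are continuous, start from 1 and never vanish, by
  \<open>phi_1_nonzero\<close> for \<open>Y'\<close>.\<close>

lemma cf_root:
  assumes L': "levy_process M' Y' (law q)" and q: "clock q" and z: "bounded_linear z" and n: "n > 0"
  shows "levy.phi M' Y' z (1 / real n) = chi z (\<lambda>s. 1 / real n * q s)"
proof -
  interpret L': levy M' Y' "law q" using L' by unfold_locales
  have [measurable]: "z \<in> borel_measurable borel" by (rule bounded_linear_borel[OF z])
  have r: "clock (\<lambda>s. 1 / real n * q s)" by (rule clock_mult[OF _ q]) simp
  note [measurable] = measurable_RI[OF r] measurable_RI[OF q]
  define a where "a u = cf M' (\<lambda>w. u * z (Y' (1 / real n) w))" for u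
  define b where "b u = cf M (\<lambda>w. u * z (RI (\<lambda>s. 1 / real n * q s) w))" for u
  have uz: "bounded_linear (\<lambda>x. u * z x)" for u by (rule bounded_linear_const_mult[OF z])
  have a: "a u ^ n = L'.phi (\<lambda>x. u * z x) 1" for u
    using L'.phi_power[OF uz[of u], where t = "1 / real n" and n = n] n by (simp add: a_def L'.phi_def)
  have "L'.phi (\<lambda>x. u * z x) 1 = chi (\<lambda>x. u * z x) q" for u
    using cf_distr[OF L'.measurable_Y[of 1] uz[of u]] cf_law[OF q uz[of u]]
    by (simp add: L'.law_1 L'.phi_def)
  moreover have "b u ^ n = chi (\<lambda>x. u * z x) q" for u
    using cf_RI_power[OF uz[of u] r, where n = n] n by (simp add: b_def chi_def RI_cong[of "\<lambda>s. real n * (1 / real n * q s)" q])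
  ultimately have ab: "a u ^ n = b u ^ n" for u using a by simp
  have "a 1 = b 1"
  proof (rule nth_root_curve_unique[OF _ _ n ab])
    show "continuous_on UNIV a" unfolding a_def[abs_def] by (rule L'.continuous_cf_ray) measurable
    show "continuous_on UNIV b" unfolding b_def[abs_def] by (rule continuous_cf_ray) measurable
    have "b u ^ n \<noteq> 0" for u using ab a L'.phi_1_nonzero[OF uz] by metis
    then show "b u \<noteq> 0" for u using n by (metis zero_power)
    show "a 0 = b 0" by (simp add: a_def b_def cf_zero L'.cf_zero)
  qed
  then show ?thesis by (simp add: a_def b_def chi_def L'.phi_def)
qed

text \<open>The j-th factor of \<open>L'.phi_prod\<close> is the functional of the integral along
  \<open>g n j\<close>: \<open>cf_root\<close> slows the clock by 1/n, and the weight j/n compresses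
  it onto (0, j/n]. Adding these clocks and the constant 1/n, which does not change
  \<open>chi\<close>, gives the averages \<open>A n\<close>, and these converge from above.\<close>

lemma iterated_integral_law:
  assumes L': "levy_process M' Y' (law (tau_poly m))" and m: "m \<ge> 1"
  shows "levy.law M' Y' (\<lambda>s. s) = law (tau_poly (Suc m))"
proof -
  interpret L': levy M' Y' "law (tau_poly m)" using L' by unfold_locales
  let ?q = "tau_poly m"
  note q = clock_tau_poly[OF m]
  have q': "clock (tau_poly (Suc m))" by (rule clock_tau_poly) simp
  define A where "A n s = (1 + (\<Sum>j\<in>{1..<n}. ?q (min (s / (real j / n)) 1))) / n" for n :: nat and s
  define g where "g n j s = 1 / real n * ?q (min (s / (real j / n)) 1)" for n j :: nat and s
  have cA: "clock (g n j)" if "j \<in> {1..<n}" for n j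
    unfolding g_def[abs_def] by (rule clock_mult[OF _ clock_scale[OF _ q]]) (use that in auto)
  have A_eq: "A n = (\<lambda>s. 1 / real n + (\<Sum>j\<in>{1..<n}. g n j s))" for n
    by (simp add: A_def g_def fun_eq_iff add_divide_distrib sum_divide_distrib)
  have clA: "clock (A n)" for n
    unfolding A_eq by (intro clock_add clock_const clock_sum cA) auto
  show ?thesis
  proof (rule cf_unique[OF L'.law_prob[OF clock_id] L'.sets_law law_prob[OF q'] sets_law])
    fix y :: "'a \<Rightarrow> real" assume y: "bounded_linear y"
    interpret y: bounded_linear y by fact
    have [measurable]: "y \<in> borel_measurable borel" by (rule bounded_linear_borel[OF y])
    note [measurable] = measurable_RI[OF clA] measurable_RI[OF q']
    have lim: "L'.phi_prod y (\<lambda>s. s) \<longlonglongrightarrow> L'.chi y (\<lambda>s. s)"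
      by (rule L'.cf_RI_lim[OF y clock_id])
    have eq: "L'.phi_prod y (\<lambda>s. s) n = chi y (A n)" for n
    proof -
      have "L'.phi (\<lambda>x. real j / n * y x) (real (Suc j) / n - real j / n) = chi y (g n j)" if j: "j \<in> {1..<n}" for j
      proof -
        have n: "n > 0" using j by auto
        have c: "clock (\<lambda>s. 1 / real n * ?q s)" by (rule clock_mult[OF _ q]) simp
        have "real (Suc j) / n - real j / n = 1 / real n" by (simp add: diff_divide_distrib[symmetric])
        then have "L'.phi (\<lambda>x. real j / n * y x) (real (Suc j) / n - real j / n)
          = chi (\<lambda>x. real j / n * y x) (\<lambda>s. 1 / real n * ?q s)"
          using cf_root[OF L' q bounded_linear_const_mult[OF y, of "real j / n"] n] by (simp only:)
        also have "\<dots> = chi y (g n j)"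
          unfolding chi_def
        proof (rule cf_cong)
          fix w assume w: "w \<in> space M"
          have "RI (g n j) w = (real j / n) *\<^sub>R RI (\<lambda>s. 1 / real n * ?q s) w"
            unfolding g_def[abs_def] by (rule RI_scale[OF c _ _ w]) (use j in auto)
          then show "real j / n * y (RI (\<lambda>s. 1 / real n * ?q s) w) = y (RI (g n j) w)"
            by (simp only: y.scaleR real_scaleR_def)
        qed
        finally show ?thesis .
      qed
      then have "L'.phi_prod y (\<lambda>s. s) n = (\<Prod>j\<in>{1..<n}. chi y (g n j))"
        unfolding L'.phi_prod_def by (intro prod.cong refl)
      also have "\<dots> = chi y (\<lambda>s. \<Sum>j\<in>{1..<n}. g n j s)"
        by (rule cf_RI_sum[OF y cA, symmetric])
      also have "\<dots> = chi y (A n)"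
      proof -
        have "0 \<le> 1 / real n" and cs: "clock (\<lambda>s. \<Sum>j\<in>{1..<n}. g n j s)"
          by (simp, rule clock_sum[OF cA])
        then show ?thesis
          unfolding A_eq using cf_RI_add[OF y clock_const cs] cf_RI_const[OF y] by (simp only: mult_1_left)
      qed
      finally show ?thesis .
    qed
    have 1: "(\<lambda>n. chi y (A n)) \<longlonglongrightarrow> L'.chi y (\<lambda>s. s)"
      using lim by (simp only: eq[symmetric])
    \<comment> \<open>The index is shifted because the bounds of \<open>tau_poly_average\<close>
      need at least one cell; \<open>A 0\<close> is 0 by division by zero.\<close>
    have "(\<lambda>n. chi y (A (Suc n))) \<longlonglongrightarrow> chi y (tau_poly (Suc m))"
      unfolding chi_def
    proof (rule cf_tendsto)
      fix w assume w: "w \<in> space M"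
      have b: "tau_poly (Suc m) s \<le> A (Suc n) s" "A (Suc n) s \<le> tau_poly (Suc m) s + 1 / real (Suc n)" if "0 < s" "s \<le> 1" for n s
        using tau_poly_average[OF m that, of "Suc n"] by (simp_all add: A_def del: of_nat_Suc)
      have "(\<lambda>n. RI (A (Suc n)) w) \<longlonglongrightarrow> RI (tau_poly (Suc m)) w"
      proof (rule RI_tendsto[OF q' clA b(1) _ _ w])
        have "1 / real (Suc n) \<le> 1" for n by simp
        then show "A (Suc n) 1 \<le> 2" for n
          using b(2)[of 1 n] tau_poly_1[of "Suc m"] by (smt (verit) le_add1 plus_1_eq_Suc)
        fix s :: real assume s: "0 < s" "s \<le> 1"
        show "(\<lambda>n. A (Suc n) s) \<longlonglongrightarrow> tau_poly (Suc m) s"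
        proof (rule tendsto_sandwich[of "\<lambda>_. tau_poly (Suc m) s" _ _ "\<lambda>n. tau_poly (Suc m) s + 1 / real (Suc n)"])
          show "(\<lambda>n. tau_poly (Suc m) s + 1 / real (Suc n)) \<longlonglongrightarrow> tau_poly (Suc m) s"
            using tendsto_add[OF tendsto_const LIMSEQ_Suc[OF lim_1_over_n], of "tau_poly (Suc m) s"] by simp
        qed (use b[OF s] in auto)
      qed
      then show "(\<lambda>n. y (RI (A (Suc n)) w)) \<longlonglongrightarrow> y (RI (tau_poly (Suc m)) w)" by (rule y.tendsto)
    qed measurable
    then have "L'.chi y (\<lambda>s. s) = chi y (tau_poly (Suc m))"
      using LIMSEQ_Suc[OF 1] by (rule LIMSEQ_unique[rotated])
    then show "cf (L'.law (\<lambda>s. s)) y = cf (law (tau_poly (Suc m))) y"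
      by (simp add: L'.cf_law[OF clock_id y] cf_law[OF q' y])
  qed
qed

text \<open>Multiplying the clock by t embeds the law of an integral into a semigroup, so that a
  Levy process with this law at time 1 can be constructed.\<close>

lemma convolution_semigroup_RI:
  assumes q: "clock q"
  shows "convolution_semigroup (\<lambda>t. law (\<lambda>s. t * q s))"
proof (rule convolution_semigroup.intro)
  have c: "clock (\<lambda>s. t * q s)" if "0 \<le> t" for t by (rule clock_mult[OF that q])
  note RIm = measurable_RI[OF c]
  show "prob_space (law (\<lambda>s. t * q s))" if "0 \<le> t" for t
    by (rule law_prob[OF c[OF that]])
  show "sets (law (\<lambda>s. t * q s)) = sets borel" for t by (rule sets_law)
  show "cf (law (\<lambda>x. (s + t) * q x)) y = cf (law (\<lambda>x. s * q x)) y * cf (law (\<lambda>x. t * q x)) y"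
    if "bounded_linear y" "0 \<le> s" "0 \<le> t" for y s t
    using cf_RI_add[OF that(1) c[OF that(2)] c[OF that(3)]] cf_law[OF c[of "s + t"] that(1)] that
    by (simp add: cf_law[OF c] distrib_right)
  show "cf (law (\<lambda>x. 0 * q x)) y = 1" if "bounded_linear y" for y
    using cf_RI_const[OF that, of 0] that by (simp add: cf_law[OF clock_const])
  fix \<epsilon> :: real assume \<epsilon>: "0 < \<epsilon>"
  show "\<exists>\<delta>>0. \<forall>t. 0 \<le> t \<and> t < \<delta> \<longrightarrow> measure (law (\<lambda>s. t * q s)) {x. \<epsilon> < norm x} \<le> 1 / 3"
  proof (rule ccontr)
    assume "\<not> ?thesis"
    \<comment> \<open>Failure of the bound yields times tending to 0. The scaled clocks then tend to
      the zero clock from above, so the integrals tend to 0 pathwise and their tails cannot stay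
      above 1/3.\<close>
    then have "\<exists>t. 0 \<le> t \<and> t < inverse (real (Suc n)) \<and> measure (law (\<lambda>s. t * q s)) {x. \<epsilon> < norm x} > 1 / 3" for n
      by (auto simp: not_le dest: spec[of _ "inverse (real (Suc n))"])
    then obtain t where t: "\<And>n. 0 \<le> t n" "\<And>n. t n < inverse (real (Suc n))"
        "\<And>n. measure (law (\<lambda>s. t n * q s)) {x. \<epsilon> < norm x} > 1 / 3"
      by metis
    note [measurable] = RIm[OF t(1)]
    have t0: "t \<longlonglongrightarrow> 0"
      by (rule tendsto_sandwich[OF _ _ tendsto_const LIMSEQ_inverse_real_of_nat])
         (use t(1,2) in \<open>auto intro!: always_eventually less_imp_le\<close>)
    have lim: "(\<lambda>n. RI (\<lambda>s. t n * q s) w) \<longlonglongrightarrow> 0" if w: "w \<in> space M" for w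
    proof -
      have "(\<lambda>n. RI (\<lambda>s. t n * q s) w) \<longlonglongrightarrow> RI (\<lambda>_. 0) w"
      proof (rule RI_tendsto[OF clock_const c[OF t(1)] _ _ _ w])
        show "0 \<le> t n * q s" if "0 < s" "s \<le> 1" for n s
          using t(1) clockD(1)[OF q that(1) order.refl that(2)] by simp
        have "t n \<le> 1" for n
          using t(2)[of n] by (rule order_trans[OF less_imp_le]) (simp add: inverse_le_1_iff)
        then show "t n * q 1 \<le> q 1" for n
          using clockD(1)[OF q, of 1 1] t(1) by (simp add: mult_left_le_one_le)
        show "(\<lambda>n. t n * q s) \<longlonglongrightarrow> 0" for s
          using tendsto_mult_right[OF t0, of "q s"] by simp
      qed simp
      then show ?thesis by (simp add: RI_def path_int_const)
    qed
    let ?q = "\<lambda>n s. t n * q s" and ?B = "{x. \<epsilon> < norm x}"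
    have "(\<lambda>n. expectation (\<lambda>w. indicat_real ?B (RI (?q n) w))) \<longlonglongrightarrow> expectation (\<lambda>_. 0)"
    proof (rule integral_dominated_convergence[where w = "\<lambda>_. 1"])
      show "AE w in M. (\<lambda>n. indicat_real ?B (RI (?q n) w)) \<longlonglongrightarrow> 0"
      proof (rule AE_I2)
        fix w assume "w \<in> space M"
        then have "(\<lambda>n. norm (RI (?q n) w)) \<longlonglongrightarrow> 0" using lim tendsto_norm_zero by blast
        then have "\<forall>\<^sub>F n in sequentially. norm (RI (?q n) w) < \<epsilon>" by (rule order_tendstoD) (rule \<epsilon>)
        then have "\<forall>\<^sub>F n in sequentially. indicat_real ?B (RI (?q n) w) = 0"
          by eventually_elim simp
        then show "(\<lambda>n. indicat_real ?B (RI (?q n) w)) \<longlonglongrightarrow> 0"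
          by (rule tendsto_eventually)
      qed
    qed auto
    moreover have "expectation (\<lambda>w. indicat_real ?B (RI (?q n) w))
        = measure (law (?q n)) ?B" for n
    proof -
      have "measure (law (?q n)) ?B
         = (LINT x|law (?q n). indicator ?B x)" by (simp add: law_def)
      also have "\<dots> = expectation (\<lambda>w. indicat_real ?B (RI (?q n) w))"
        unfolding law_def by (rule integral_distr) measurable
      finally show ?thesis by simp
    qed
    ultimately have "(\<lambda>n. measure (law (?q n)) ?B) \<longlonglongrightarrow> 0" by simp
    then have "1 / 3 \<le> (0::real)"
      by (rule LIMSEQ_le_const) (use t(3) less_imp_le in blast)
    then show False by simp
  qed
qed

lemma law_tau: "m \<ge> 1 \<Longrightarrow> law (tau m) = law (tau_poly m)"
  unfolding law_def using RI_cong[OF tau_eq_tau_poly] by simp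

end

section \<open>Passage from one clock to the next\<close>

lemma is_law_rint_tau_iff:
  fixes \<nu> \<mu> :: "'a::{banach,second_countable_topology} measure"
  assumes m: "m \<ge> 1"
  shows "is_law_rint \<nu> (tau m) \<mu> \<longleftrightarrow>
    (\<exists>(M :: (real \<Rightarrow> 'a) measure) Y. levy_process M Y \<nu> \<and> \<mu> = levy.law M Y (tau_poly m))"
  unfolding is_law_rint_iff[OF clock_tau[OF m]]
  using levy.law_tau[OF levy.intro m] by metis

text \<open>From left to right the intermediate process is given and
  \<open>iterated_integral_law\<close> identifies the law. From right to left that process has to be
  supplied first.\<close>

lemma J_img_tau_laws:
  fixes S :: "'a::{banach,second_countable_topology} measure set"
  assumes m: "m \<ge> 1"
  shows "J_img {\<mu>. \<exists>\<nu>\<in>S. is_law_rint \<nu> (tau m) \<mu>} = {\<mu>. \<exists>\<nu>\<in>S. is_law_rint \<nu> (tau (Suc m)) \<mu>}"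
proof (intro set_eqI iffI)
  have Sm: "Suc m \<ge> 1" by simp
  fix \<mu> :: "'a measure"
  assume "\<mu> \<in> J_img {\<mu>. \<exists>\<nu>\<in>S. is_law_rint \<nu> (tau m) \<mu>}"
  then obtain \<nu> and M :: "(real \<Rightarrow> 'a) measure" and Y and M' :: "(real \<Rightarrow> 'a) measure" and Y'
    where \<nu>: "\<nu> \<in> S" and L: "levy_process M Y \<nu>"
      and L': "levy_process M' Y' (levy.law M Y (tau_poly m))" and \<mu>: "\<mu> = levy.law M' Y' (\<lambda>s. s)"
    unfolding J_img_def is_law_rint_tau_iff[OF m] is_law_rint_iff[OF clock_id] by auto
  have "\<mu> = levy.law M Y (tau_poly (Suc m))"
    using levy.iterated_integral_law[OF levy.intro[OF L] L' m] \<mu> by simp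
  then show "\<mu> \<in> {\<mu>. \<exists>\<nu>\<in>S. is_law_rint \<nu> (tau (Suc m)) \<mu>}"
    using \<nu> L is_law_rint_tau_iff[OF Sm] by blast
next
  have Sm: "Suc m \<ge> 1" by simp
  fix \<mu> :: "'a measure"
  assume "\<mu> \<in> {\<mu>. \<exists>\<nu>\<in>S. is_law_rint \<nu> (tau (Suc m)) \<mu>}"
  then obtain \<nu> and M :: "(real \<Rightarrow> 'a) measure" and Y
    where \<nu>: "\<nu> \<in> S" and L: "levy_process M Y \<nu>" and \<mu>: "\<mu> = levy.law M Y (tau_poly (Suc m))"
    using is_law_rint_tau_iff[OF Sm] by blast
  interpret L: levy M Y \<nu> using L by unfold_locales
  \<comment> \<open>The semigroup of the clocks \<open>t * tau_poly m s\<close>, taken at t = 1, has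
    the intermediate law.\<close>
  obtain M' :: "(real \<Rightarrow> 'a) measure" and Y' where L': "levy_process M' Y' (L.law (tau_poly m))"
    using convolution_semigroup.levy_process_exists[OF L.convolution_semigroup_RI[OF clock_tau_poly[OF m]]] by auto
  have "\<mu> = levy.law M' Y' (\<lambda>s. s)"
    using L.iterated_integral_law[OF L' m] \<mu> by simp
  then show "\<mu> \<in> J_img {\<mu>. \<exists>\<nu>\<in>S. is_law_rint \<nu> (tau m) \<mu>}"
    unfolding J_img_def is_law_rint_tau_iff[OF m] is_law_rint_iff[OF clock_id] using \<nu> L L' by blast
qed

theorem theorem4:
  fixes m :: nat
  assumes "m \<ge> 1"
  shows "(U_class m :: 'a::{banach,second_countable_topology} measure set)
           = {\<mu>. \<exists>\<nu>\<in>ID. is_law_rint \<nu> (tau m) \<mu>}"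
  using assms
proof (induction m rule: dec_induct)
  case base
  have "tau_poly 1 = (\<lambda>s. s)" by (simp add: tau_poly_def fun_eq_iff)
  then have "is_law_rint \<nu> (tau 1) \<mu> \<longleftrightarrow> is_law_rint \<nu> (\<lambda>s. s) \<mu>" for \<nu> \<mu> :: "'a measure"
    unfolding is_law_rint_tau_iff[OF order.refl] is_law_rint_iff[OF clock_id] by simp
  then show ?case by (simp add: U_class_def J_img_def)
next
  case (step m)
  have "U_class (Suc m) = J_img (U_class m :: 'a measure set)" by (simp add: U_class_def)
  also have "\<dots> = J_img {\<mu>. \<exists>\<nu>\<in>ID. is_law_rint \<nu> (tau m) \<mu>}" using step by simp
  also have "\<dots> = {\<mu>. \<exists>\<nu>\<in>ID. is_law_rint \<nu> (tau (Suc m)) \<mu>}" by (rule J_img_tau_laws) (use step in simp)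
  finally show ?case .
qed

end
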